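(* Let $N\ge 1$ and let $H:\mathbb{R}^N\to\mathbb{R}$ be of class $C^2$, satisfying $\nabla H(0)=0$ and $D^2H(p)\geqslant \alpha\,\mathbb{I}_N$ for all $p\in\mathbb{R}^N$, for some constant $\alpha>0$. Let $\{S_t\}_{t\ge 0}$ be the semigroup of viscosity solutions, on the domain $\mathrm{Lip}(\mathbb{R}^N)$, generated by the Hamilton-Jacobi equation $u_t+H(\nabla_x u)=0$. Then, given $L,M,T>0$, for every $\varepsilon>0$ sufficiently small the following estimates hold: $$\mathcal{H}_{\varepsilon}\Big(S_T(\mathcal C_{[L,M]})+T\cdot H(0)\ \big|\ \mathbf{W}^{1,1}(\mathbb{R}^N)\Big)\leqslant \Gamma^+_{[L,M,N,T]}\cdot\frac{1}{\varepsilon^N}$$ with $$\Gamma^+_{[L,M,N,T]}:= \omega_N^N \cdot \bigg(4N\cdot\Big(1+ M+\Big(\frac{1}{\alpha T}+1\Big)\cdot l_{[L,M,T]}\Big)\bigg)^{4N^2},\qquad l_{[L,M,T]}:=L+T\cdot\sup_{|p|\leqslant M}|\nabla H(p)|,$$ and $$\mathcal{H}_{\varepsilon}\Big(S_T(\mathcal C_{[L,M]})+T\cdot H(0)\ \big|\ \mathbf{W}^{1,1}(\mathbb{R}^N)\Big)\geqslant \Gamma^-_{[L,N,T]}\cdot\frac{1}{\varepsilon^N}$$ with $$\Gamma^-_{[L,N,T]}:=\frac{1}{8\cdot \ln 2}\Bigg(\frac{\omega_{N}}{192\, (N+1)\cdot\|D^2H(0)\|\cdot T} \Bigg)^{N}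\cdot\bigg(\frac{L}{4}\bigg)^{N(N+1)}.$$
   Context: $\mathrm{Lip}(\mathbb{R}^N)$ is the space of Lipschitz continuous functions $f:\mathbb{R}^N\to\mathbb{R}$ and $\mathrm{Lip}[f]$ is the Lipschitz seminorm of $f$. $|\cdot|$ is the Euclidean norm, $\|A\|$ is the operator norm of an $N\times N$ matrix $A$, $\mathbb{I}_N$ is the identity matrix, matrix inequalities are in the sense of positive semidefiniteness, and $\omega_N$ is the Lebesgue measure of the unit ball of $\mathbb{R}^N$. Semigroup: for $u_0\in\mathrm{Lip}(\mathbb{R}^N)$, $u(t,x):=S_tu_0(x)$ is the unique viscosity solution of the Cauchy problem $u_t(t,x)+H(\nabla_x u(t,x))=0$ ($t\ge0$, $x\in\mathbb{R}^N$), $u(0,\cdot)=u_0$. It is given by the Hopf-Lax formula $S_0u_0=u_0$ and $$S_tu_0(x)=\min_{y\in\mathbb{R}^N}\Big\{t\,H^*\Big(\frac{x-y}{t}\Big)+u_0(y)\Big\}\quad (t>0),\qquad H^*(q)=\max_{p\in\mathbb{R}^N}\{\langle p,q\rangle-H(p)\}.$$ Class of initial data: $\mathcal{C}_{[L,M]}:=\{u_0\in\mathrm{Lip}(\mathbb{R}^N)\,|\,\mathrm{supp}(u_0)\subset[-L,L]^N,\ \mathrm{Lip}[u_0]\leqslant M\}$. The set $S_T(\mathcal{C}_{[L,M]})+T\cdot H(0)$ is $\{S_Tu_0+T\,H(0)\,|\,u_0\in\mathcal{C}_{[L,M]}\}$, where $T\,H(0)$ is a constant function. $\varepsilon$-entropy: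 for a metric space $(X,d)$, a totally bounded subset $K\subset X$ and $\varepsilon>0$, $\mathcal{N}_\varepsilon(K|X)$ is the minimal number of sets in a cover of $K$ by subsets of $X$ having diameter no larger than $2\varepsilon$, and $\mathcal{H}_\varepsilon(K|X):=\log_2\mathcal{N}_\varepsilon(K|X)$. The space $\mathbf{W}^{1,1}(\mathbb{R}^N)$ is equipped with its usual norm. *)

theory Defs
  imports "HOL-Analysis.Analysis" "HOL-Library.Extended_Nat"
begin

section \<open>Metric entropy\<close>

text \<open>
  The metric space is given by a carrier \<open>X\<close> and a distance \<open>d\<close>. The condition "diameter at most
  \<open>2 \<epsilon>\<close>" is stated pointwise, so that it is also meaningful for unbounded sets. The covering number
  is an extended natural number: it is \<open>\<infinity>\<close> if there is no finite cover, in particular if \<open>K\<close> is not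
  contained in \<open>X\<close>. Hence a real upper bound on the entropy entails the existence of a finite cover.
\<close>

definition covering_number ::
  "'a set \<Rightarrow> ('a \<Rightarrow> 'a \<Rightarrow> real) \<Rightarrow> 'a set \<Rightarrow> real \<Rightarrow> enat" where
  "covering_number X d K \<epsilon> = Inf {enat (card \<U>) | \<U>.
     finite \<U> \<and> K \<subseteq> \<Union>\<U> \<and> (\<forall>A\<in>\<U>. A \<subseteq> X \<and> (\<forall>x\<in>A. \<forall>y\<in>A. d x y \<le> 2 * \<epsilon>))}"

definition metric_entropy ::
  "'a set \<Rightarrow> ('a \<Rightarrow> 'a \<Rightarrow> real) \<Rightarrow> 'a set \<Rightarrow> real \<Rightarrow> ereal" where
  "metric_entropy X d K \<epsilon> =
     (case covering_number X d K \<epsilon> of enat n \<Rightarrow> ereal (log 2 (real n)) | \<infinity> \<Rightarrow> \<infinity>)"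

section \<open>The Sobolev space \<open>W\<^sup>1\<^sup>,\<^sup>1\<close>\<close>

definition partial_deriv :: "'n \<Rightarrow> (real^'n::finite \<Rightarrow> real) \<Rightarrow> real^'n \<Rightarrow> real" where
  "partial_deriv i f x = frechet_derivative f (at x) (axis i 1)"

primrec iter_partial :: "'n list \<Rightarrow> (real^'n::finite \<Rightarrow> real) \<Rightarrow> real^'n \<Rightarrow> real" where
  "iter_partial [] f = f"
| "iter_partial (i # is) f = partial_deriv i (iter_partial is f)"

text \<open>
  If every iterated partial derivative is everywhere differentiable, then every iterated partial
  derivative is also continuous, so this is the usual class of smooth functions.
\<close>

definition smooth :: "(real^'n::finite \<Rightarrow> real) \<Rightarrow> bool" where
  "smooth f \<longleftrightarrow> (\<forall>is x. iter_partial is f differentiable (at x))"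

definition test_functions :: "(real^'n::finite \<Rightarrow> real) set" where
  "test_functions = {\<phi>. smooth \<phi> \<and> compact (closure (support_on UNIV \<phi>))}"

definition weak_gradient :: "(real^'n::finite \<Rightarrow> real) \<Rightarrow> (real^'n \<Rightarrow> real^'n) \<Rightarrow> bool" where
  "weak_gradient f g \<longleftrightarrow>
     (\<forall>\<phi>\<in>test_functions. \<forall>i.
        integral\<^sup>L lebesgue (\<lambda>x. f x * partial_deriv i \<phi> x) = - integral\<^sup>L lebesgue (\<lambda>x. g x $ i * \<phi> x))"

definition W11_fun :: "(real^'n::finite \<Rightarrow> real) set" where
  "W11_fun = {f. integrable lebesgue f \<and> (\<exists>g. integrable lebesgue g \<and> weak_gradient f g)}"

text \<open>
  The integrable weak gradient is unique up to null sets, so the choice does not affect the norm.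
\<close>

definition W11_norm :: "(real^'n::finite \<Rightarrow> real) \<Rightarrow> real" where
  "W11_norm f = integral\<^sup>L lebesgue (\<lambda>x. \<bar>f x\<bar>) +
     integral\<^sup>L lebesgue (\<lambda>x. norm ((SOME g. integrable lebesgue g \<and> weak_gradient f g) x))"

text \<open>The elements of the Sobolev space are classes of functions that agree almost everywhere.\<close>

definition W11_eq :: "((real^'n::finite \<Rightarrow> real) \<times> (real^'n \<Rightarrow> real)) set" where
  "W11_eq = {(f, g). f \<in> W11_fun \<and> g \<in> W11_fun \<and> (AE x in lebesgue. f x = g x)}"

definition W11 :: "(real^'n::finite \<Rightarrow> real) set set" where
  "W11 = W11_fun // W11_eq"

definition W11_class :: "(real^'n::finite \<Rightarrow> real) \<Rightarrow> (real^'n \<Rightarrow> real) set" where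
  "W11_class f = W11_eq `` {f}"

definition W11_dist :: "(real^'n::finite \<Rightarrow> real) set \<Rightarrow> (real^'n \<Rightarrow> real) set \<Rightarrow> real" where
  "W11_dist A B = W11_norm (\<lambda>x. (SOME f. f \<in> A) x - (SOME g. g \<in> B) x)"

section \<open>Lipschitz functions and the class of initial data\<close>

definition Lip_space :: "(real^'n::finite \<Rightarrow> real) set" where
  "Lip_space = {f. \<exists>C. C-lipschitz_on UNIV f}"

definition Lip_seminorm :: "(real^'n::finite \<Rightarrow> real) \<Rightarrow> real" where
  "Lip_seminorm f = (SUP (x, y) \<in> {(x, y). x \<noteq> y}. \<bar>f x - f y\<bar> / norm (x - y))"

definition initial_data :: "real \<Rightarrow> real \<Rightarrow> (real^'n::finite \<Rightarrow> real) set" where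
  "initial_data L M = {u0 \<in> Lip_space.
     closure (support_on UNIV u0) \<subseteq> {x. \<forall>i. x $ i \<in> {- L..L}} \<and> Lip_seminorm u0 \<le> M}"

section \<open>Viscosity solutions of \<open>u\<^sub>t + H (\<nabla>u) = 0\<close>\<close>

text \<open>
  Test functions for viscosity solutions are \<open>C\<^sup>1\<close> on the open half space \<open>t > 0\<close>; \<open>a\<close> and \<open>b\<close> are
  the time derivative and the spatial gradient of \<open>\<phi>\<close>.
\<close>

definition C1_test ::
  "(real \<times> (real^'n::finite) \<Rightarrow> real) \<Rightarrow> (real \<times> (real^'n) \<Rightarrow> real) \<Rightarrow> (real \<times> (real^'n) \<Rightarrow> real^'n) \<Rightarrow> bool"
  where
  "C1_test \<phi> a b \<longleftrightarrow>
     (\<forall>z\<in>{0<..} \<times> UNIV. (\<phi> has_derivative (\<lambda>(s, h). a z * s + b z \<bullet> h)) (at z)) \<and>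
     continuous_on ({0<..} \<times> UNIV) a \<and> continuous_on ({0<..} \<times> UNIV) b"

definition viscosity_subsolution ::
  "(real^'n::finite \<Rightarrow> real) \<Rightarrow> (real \<times> (real^'n) \<Rightarrow> real) \<Rightarrow> bool" where
  "viscosity_subsolution H u \<longleftrightarrow>
     (\<forall>\<phi> a b. \<forall>z\<in>{0<..} \<times> UNIV. C1_test \<phi> a b \<longrightarrow>
        (\<forall>\<^sub>F w in nhds z. u w - \<phi> w \<le> u z - \<phi> z) \<longrightarrow> a z + H (b z) \<le> 0)"

definition viscosity_supersolution ::
  "(real^'n::finite \<Rightarrow> real) \<Rightarrow> (real \<times> (real^'n) \<Rightarrow> real) \<Rightarrow> bool" where
  "viscosity_supersolution H u \<longleftrightarrow>
     (\<forall>\<phi> a b. \<forall>z\<in>{0<..} \<times> UNIV. C1_test \<phi> a b \<longrightarrow>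
        (\<forall>\<^sub>F w in nhds z. u w - \<phi> w \<ge> u z - \<phi> z) \<longrightarrow> a z + H (b z) \<ge> 0)"

text \<open>
  Uniqueness for the Cauchy problem with Lipschitz initial data is understood in the class of
  functions that are Lipschitz on \<open>[0, \<infinity>) \<times> \<real>\<^sup>N\<close>, to which the Hopf-Lax solution belongs.
\<close>

definition viscosity_solution ::
  "(real^'n::finite \<Rightarrow> real) \<Rightarrow> (real^'n \<Rightarrow> real) \<Rightarrow> (real \<times> (real^'n) \<Rightarrow> real) \<Rightarrow> bool" where
  "viscosity_solution H u0 u \<longleftrightarrow>
     (\<exists>C. C-lipschitz_on ({0..} \<times> UNIV) u) \<and> (\<forall>x. u (0, x) = u0 x) \<and>
     viscosity_subsolution H u \<and> viscosity_supersolution H u"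

text \<open>
  \<open>S t u0\<close> is constrained only for \<open>t \<ge> 0\<close> and Lipschitz \<open>u0\<close>. By uniqueness of the viscosity
  solution it is determined there, and the semigroup law follows.
\<close>

definition viscosity_semigroup ::
  "(real^'n::finite \<Rightarrow> real) \<Rightarrow> (real \<Rightarrow> (real^'n \<Rightarrow> real) \<Rightarrow> real^'n \<Rightarrow> real) \<Rightarrow> bool" where
  "viscosity_semigroup H S \<longleftrightarrow>
     (\<forall>u0\<in>Lip_space. viscosity_solution H u0 (\<lambda>(t, x). S t u0 x))"

section \<open>Matrices and constants\<close>

definition positive_semidefinite :: "real^'n^'n::finite \<Rightarrow> bool" where
  "positive_semidefinite A \<longleftrightarrow> transpose A = A \<and> (\<forall>x. 0 \<le> x \<bullet> (A *v x))"

definition ball_vol :: "'n::finite itself \<Rightarrow> real" where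
  "ball_vol _ = measure lebesgue (ball (0 :: real^'n) 1)"

definition prop_radius :: "(real^'n::finite \<Rightarrow> real^'n) \<Rightarrow> real \<Rightarrow> real \<Rightarrow> real \<Rightarrow> real" where
  "prop_radius DH L M T = L + T * (SUP p\<in>{p. norm p \<le> M}. norm (DH p))"

definition Gamma_upper ::
  "(real^'n::finite \<Rightarrow> real^'n) \<Rightarrow> real \<Rightarrow> real \<Rightarrow> real \<Rightarrow> real \<Rightarrow> real" where
  "Gamma_upper DH \<alpha> L M T = (let N = CARD('n) in
     ball_vol TYPE('n) ^ N *
     (4 * real N * (1 + M + (1 / (\<alpha> * T) + 1) * prop_radius DH L M T)) ^ (4 * N\<^sup>2))"

definition Gamma_lower :: "real^'n^'n::finite \<Rightarrow> real \<Rightarrow> real \<Rightarrow> real" where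
  "Gamma_lower A L T = (let N = CARD('n) in
     1 / (8 * ln 2) *
     (ball_vol TYPE('n) / (192 * (real N + 1) * onorm ((*v) A) * T)) ^ N *
     (L / 4) ^ (N * (N + 1)))"

end

theory Submission
  imports Defs
begin

text \<open>
  Both estimates are statements about one explicit family of functions. By uniqueness of viscosity
  solutions (\<open>viscosity_comparison\<close>) the semigroup is given by the Hopf-Lax formula
  (\<open>semigroup_eq_hopf_lax\<close>), an infimum of the functions \<open>x \<mapsto> u0 y + T H\<^sup>*((x - y) / T)\<close>. Everything that
  is used about the values of the semigroup is read off from this formula.

  Upper estimate. Uniform convexity of \<open>H\<close> makes \<open>H\<^sup>*\<close> a function with second derivatives at most
  \<open>1 / \<alpha>\<close>, so \<open>S T u0\<close> lies below a paraboloid of opening \<open>K = 1 / (\<alpha> T)\<close> at each of its points; and it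
  is constant outside the cube of half side \<open>l\<close>, by finite speed of propagation. Along each coordinate
  line, such a function is determined up to controlled errors by its values on a grid of step \<open>h\<close>: since
  second differences are at most \<open>K h\<^sup>2\<close> and add up to \<open>0\<close> along a line, their absolute values
  add up to at most a multiple of the number of grid points times \<open>K h\<^sup>2\<close>, and these sums control the errors
  of linear interpolation and of difference quotients. Replacing the coordinates of a point
  by grid coordinates one at a time, only pure second differences are ever needed, never mixed ones. Two
  functions whose grid values agree up to \<open>K h\<^sup>2\<close> are therefore at distance \<open>O(h)\<close>. The grid values, rounded
  to multiples of \<open>K h\<^sup>2\<close>, are encoded by \<open>3\<close> minus their second differences in one direction; this is a
  family of natural numbers with mean \<open>3\<close>, and there are only exponentially many such families in the
  number \<open>h\<^sup>-\<^sup>N\<close> of grid points. This is what avoids a factor \<open>log (1 / \<epsilon>)\<close>. The result is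
  \<open>semiconcave_class_entropy_le\<close>.

  Lower estimate. A compactly supported function \<open>w\<close> whose gradient is small, with
  Lipschitz constant less than \<open>1 / (T \<parallel>D\<^sup>2H(0)\<parallel>)\<close> up to a factor close to \<open>1\<close>, can be transported backwards along
  characteristics without crossings, so \<open>w - T H 0\<close> is a value of \<open>S T\<close> (\<open>hopf_lax_reaches\<close>). Sums of
  disjoint bumps of radius \<open>r\<close> placed at arbitrary subsets of a grid of centres are such
  functions, and their distance is at least the number of differing positions times a
  quantity of order \<open>r\<^sup>N\<^sup>+\<^sup>1\<close>. Since a Hamming ball of small radius contains an exponentially small part of all
  subsets, many sets of diameter \<open>2 \<epsilon>\<close> are needed (\<open>metric_entropy_ge_if_hamming\<close>); the estimate
  follows with \<open>r\<close> a multiple of \<open>\<epsilon>\<close>.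

  The distance of \<open>W\<^sup>1\<^sup>,\<^sup>1\<close> is computed from one-sided partial difference quotients:
  for a compactly supported Lipschitz function, their pointwise limits form a weak gradient
  (\<open>lipschitz_weak_gradient\<close>), and weak gradients are unique almost everywhere (\<open>weak_gradient_unique\<close>).
\<close>

section \<open>Legendre duality\<close>

lemma coercive_attains_inf:
  fixes f :: "'a::euclidean_space \<Rightarrow> real"
  assumes cont: "continuous_on S f" and S: "closed S" "S \<noteq> {}"
    and coercive: "\<And>y. y \<in> S \<Longrightarrow> norm (y - a) - B \<le> f y"
  obtains y where "y \<in> S" "\<And>z. z \<in> S \<Longrightarrow> f y \<le> f z"
proof -
  obtain s where s: "s \<in> S" using S by blast
  define R where "R = f s + B"
  have sR: "s \<in> S \<inter> cball a R"
    using coercive[OF s] s by (simp add: R_def dist_norm norm_minus_commute)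
  have "compact (S \<inter> cball a R)" using S by (simp add: closed_Int_compact)
  moreover have "continuous_on (S \<inter> cball a R) f" using cont continuous_on_subset by blast
  ultimately obtain y where y: "y \<in> S \<inter> cball a R" "\<forall>z\<in>S \<inter> cball a R. f y \<le> f z"
    using continuous_attains_inf[of "S \<inter> cball a R" f] sR by blast
  have "f y \<le> f z" if z: "z \<in> S" for z
  proof (cases "z \<in> cball a R")
    case False
    then have "R < norm (z - a)" by (simp add: dist_norm norm_minus_commute)
    then have "f s \<le> f z" using coercive[OF z] by (simp add: R_def)
    then show ?thesis using y(2) sR by (meson order_trans)
  qed (use y z in blast)
  then show ?thesis using that y by blast
qed

lemma young_quadratic:
  fixes w v :: "'a::real_inner"
  assumes "\<alpha> > 0"
  shows "w \<bullet> v \<le> \<alpha> / 2 * (norm w)\<^sup>2 + (norm v)\<^sup>2 / (2 * \<alpha>)"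
proof -
  have "0 \<le> (norm (\<alpha> *\<^sub>R w - v))\<^sup>2 / (2 * \<alpha>)" using assms by simp
  also have "(norm (\<alpha> *\<^sub>R w - v))\<^sup>2 = \<alpha>\<^sup>2 * (norm w)\<^sup>2 + (norm v)\<^sup>2 - 2 * \<alpha> * (w \<bullet> v)"
    unfolding power2_norm_eq_inner
    by (simp add: inner_diff inner_commute[of v w] power2_eq_square algebra_simps)
  also have "\<dots> / (2 * \<alpha>) = \<alpha> / 2 * (norm w)\<^sup>2 + (norm v)\<^sup>2 / (2 * \<alpha>) - w \<bullet> v"
    using assms by (simp add: field_simps power2_eq_square)
  finally show ?thesis by simp
qed

text \<open>
  Strong convexity has the integrated form in which duality uses it; it follows from a bound on the Hessian by
  \<open>strong_convexity_of_hessian\<close>.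
\<close>

locale convex_hamiltonian =
  fixes H :: "real^'n::finite \<Rightarrow> real" and DH :: "real^'n \<Rightarrow> real^'n" and \<alpha> :: real
  assumes gradient: "\<And>p. GDERIV H p :> DH p"
    and alpha_pos: "\<alpha> > 0"
    and strong_convexity: "\<And>p p'. H p + DH p \<bullet> (p' - p) + \<alpha> / 2 * (norm (p' - p))\<^sup>2 \<le> H p'"
begin

lemma H_has_derivative: "(H has_derivative (\<lambda>h. h \<bullet> DH p)) (at p)"
  using gradient[of p] by (simp add: gderiv_def)

lemma continuous_on_H: "continuous_on S H"
  by (meson H_has_derivative continuous_at_imp_continuous_on has_derivative_continuous)

lemma DH_strongly_monotone: "\<alpha> * (norm (p - p'))\<^sup>2 \<le> (DH p - DH p') \<bullet> (p - p')"
  using strong_convexity[of p p'] strong_convexity[of p' p]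
  by (simp add: inner_diff_left inner_diff_right norm_minus_commute[of p' p] algebra_simps)

lemma inj_DH: "inj DH"
proof (rule injI)
  fix p p' assume "DH p = DH p'"
  then have "\<alpha> * (norm (p - p'))\<^sup>2 \<le> 0" using DH_strongly_monotone[of p p'] by simp
  then show "p = p'" using alpha_pos by (simp add: mult_le_0_iff)
qed

text \<open>
  A minimizer of \<open>p \<mapsto> H p - p \<bullet> q\<close>, which exists because strong convexity makes this function coercive, is a
  critical point, that is, a solution of \<open>DH p = q\<close>.
\<close>

lemma surj_DH: "surj DH"
proof -
  have "\<exists>p. DH p = q" for q
  proof -
    define \<psi> where "\<psi> p = H p - p \<bullet> q" for p
    define k where "k = norm (DH 0) + norm q + 1"
    have deriv: "(\<psi> has_derivative (\<lambda>h. h \<bullet> DH p - h \<bullet> q)) (at p)" for p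
      unfolding \<psi>_def by (auto intro!: derivative_eq_intros H_has_derivative)
    then have "continuous_on UNIV \<psi>"
      by (meson continuous_at_imp_continuous_on has_derivative_continuous)
    moreover have "norm (p - 0) - (k\<^sup>2 / (2 * \<alpha>) - H 0) \<le> \<psi> p" for p
    proof -
      have "- (norm (DH 0) * norm p) \<le> DH 0 \<bullet> p" "p \<bullet> q \<le> norm q * norm p"
        using Cauchy_Schwarz_ineq2[of "DH 0" p] Cauchy_Schwarz_ineq2[of p q] by (auto simp: mult.commute)
      moreover have "norm p * k \<le> \<alpha> / 2 * (norm p)\<^sup>2 + k\<^sup>2 / (2 * \<alpha>)"
        using young_quadratic[OF alpha_pos, of "norm p" k] by simp
      ultimately show ?thesis using strong_convexity[of 0 p] by (simp add: \<psi>_def k_def algebra_simps)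
    qed
    ultimately obtain p where p: "\<And>z. \<psi> p \<le> \<psi> z"
      using coercive_attains_inf[of UNIV \<psi> 0] by (metis UNIV_I UNIV_not_empty closed_UNIV)
    have "(\<lambda>h. h \<bullet> DH p - h \<bullet> q) = (\<lambda>h. 0)"
      using differential_zero_maxmin[OF _ open_UNIV deriv[of p]] p by auto
    then have "(DH p - q) \<bullet> (DH p - q) = 0" by (metis inner_diff_right)
    then show ?thesis by auto
  qed
  then show ?thesis by (metis surj_def)
qed

text \<open>
  The inverse of the gradient of \<open>H\<close> is the gradient of the conjugate function.
\<close>

definition grad_inv :: "real^'n \<Rightarrow> real^'n" where "grad_inv = inv DH"

text \<open>
  This is \<open>H\<^sup>*(q) = max\<^sub>p (p \<bullet> q - H p)\<close>: the maximum is attained at the point where \<open>DH p = q\<close>.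
\<close>

definition legendre :: "real^'n \<Rightarrow> real" where "legendre q = grad_inv q \<bullet> q - H (grad_inv q)"

lemma DH_grad_inv [simp]: "DH (grad_inv q) = q"
  by (simp add: grad_inv_def surj_DH surj_f_inv_f)

lemma grad_inv_DH [simp]: "grad_inv (DH p) = p"
  by (simp add: grad_inv_def inj_DH)

lemma fenchel_young: "p \<bullet> q \<le> H p + legendre q"
proof -
  have "0 \<le> \<alpha> / 2 * (norm (p - grad_inv q))\<^sup>2" using alpha_pos by simp
  then show ?thesis
    using strong_convexity[of "grad_inv q" p] by (simp add: legendre_def inner_diff_right inner_commute)
qed

lemma legendre_DH: "legendre (DH p) = p \<bullet> DH p - H p"
  by (simp add: legendre_def)

lemma legendre_lower: "legendre q + grad_inv q \<bullet> v \<le> legendre (q + v)"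
  using fenchel_young[of "grad_inv q" "q + v"] by (simp add: legendre_def inner_add_right)

text \<open>
  Duality turns the lower bound \<open>\<alpha>\<close> on the second derivatives of \<open>H\<close> into the upper bound \<open>1 / \<alpha>\<close> for
  those of the conjugate. This one-sided bound is the origin of all regularity of the solutions.
\<close>

lemma legendre_upper: "legendre (q + v) \<le> legendre q + grad_inv q \<bullet> v + (norm v)\<^sup>2 / (2 * \<alpha>)"
proof -
  define w where "w = grad_inv (q + v) - grad_inv q"
  have "H (grad_inv q) + q \<bullet> w + \<alpha> / 2 * (norm w)\<^sup>2 \<le> H (grad_inv (q + v))"
    using strong_convexity[of "grad_inv q" "grad_inv (q + v)"] by (simp add: w_def)
  then have "legendre (q + v) \<le> grad_inv (q + v) \<bullet> (q + v) - H (grad_inv q) - q \<bullet> w - \<alpha> / 2 * (norm w)\<^sup>2"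
    by (simp add: legendre_def)
  also have "\<dots> = legendre q + grad_inv q \<bullet> v + (w \<bullet> v - \<alpha> / 2 * (norm w)\<^sup>2)"
    by (simp add: legendre_def w_def inner_diff inner_add inner_commute algebra_simps)
  also have "\<dots> \<le> legendre q + grad_inv q \<bullet> v + (norm v)\<^sup>2 / (2 * \<alpha>)"
    using young_quadratic[OF alpha_pos, of w v] by simp
  finally show ?thesis .
qed

text \<open>
  The conjugate lies between its tangent and a tangent paraboloid.
\<close>

lemma legendre_has_derivative: "(legendre has_derivative (\<lambda>v. grad_inv q \<bullet> v)) (at q)"
  unfolding has_derivative_at
proof
  show "bounded_linear ((\<bullet>) (grad_inv q))" by (rule bounded_linear_inner_right)
  have lim: "(\<lambda>v. norm v / (2 * \<alpha>)) \<midarrow>0\<rightarrow> 0" using alpha_pos by (auto intro!: tendsto_eq_intros)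
  have bound: "norm (norm (legendre (q + v) - legendre q - grad_inv q \<bullet> v) / norm v) \<le> norm v / (2 * \<alpha>)" for v
  proof -
    have "norm (norm (legendre (q + v) - legendre q - grad_inv q \<bullet> v) / norm v) = (legendre (q + v) - legendre q - grad_inv q \<bullet> v) / norm v"
      using legendre_lower[of q v] by simp
    also have "\<dots> \<le> ((norm v)\<^sup>2 / (2 * \<alpha>)) / norm v"
      by (intro divide_right_mono) (use legendre_upper[of q v] in auto)
    also have "\<dots> = norm v / (2 * \<alpha>)" by (simp add: power2_eq_square)
    finally show ?thesis .
  qed
  show "(\<lambda>v. norm (legendre (q + v) - legendre q - grad_inv q \<bullet> v) / norm v) \<midarrow>0\<rightarrow> 0"
    by (rule Lim_null_comparison[OF always_eventually[OF allI[OF bound]] lim])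
qed

lemma continuous_on_legendre: "continuous_on S legendre"
  by (meson legendre_has_derivative continuous_at_imp_continuous_on has_derivative_continuous)

lemma legendre_convex:
  assumes "0 \<le> s" "s \<le> 1"
  shows "legendre ((1 - s) *\<^sub>R a + s *\<^sub>R b) \<le> (1 - s) * legendre a + s * legendre b"
proof -
  define q where "q = (1 - s) *\<^sub>R a + s *\<^sub>R b"
  have "(1 - s) * (legendre q + grad_inv q \<bullet> (a - q)) \<le> (1 - s) * legendre a" "s * (legendre q + grad_inv q \<bullet> (b - q)) \<le> s * legendre b"
    using legendre_lower[of q "a - q"] legendre_lower[of q "b - q"] assms by (auto intro!: mult_left_mono)
  moreover have "(1 - s) * (grad_inv q \<bullet> (a - q)) + s * (grad_inv q \<bullet> (b - q)) = grad_inv q \<bullet> ((1 - s) *\<^sub>R a + s *\<^sub>R b - q)"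
    by (simp add: inner_diff inner_add algebra_simps)
  then have "(1 - s) * (grad_inv q \<bullet> (a - q)) + s * (grad_inv q \<bullet> (b - q)) = 0" by (simp add: q_def)
  ultimately show ?thesis unfolding q_def[symmetric] by (simp add: algebra_simps)
qed

text \<open>
  Testing the Fenchel-Young inequality with the vector of length \<open>c\<close> in direction \<open>q\<close> gives growth faster
  than any linear function. This makes the minimum in the Hopf-Lax formula exist for Lipschitz data.
\<close>

lemma legendre_growth:
  assumes "c \<ge> 0"
  obtains B where "\<And>q. c * norm q - B \<le> legendre q"
proof -
  have "bounded (H ` cball 0 c)"
    by (intro compact_imp_bounded compact_continuous_image continuous_on_H) simp
  then obtain B where B: "\<And>p. p \<in> cball 0 c \<Longrightarrow> H p \<le> B"
    unfolding bounded_iff by (metis abs_le_D1 image_eqI real_norm_def)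
  have "c * norm q - B \<le> legendre q" for q
  proof -
    define p where "p = c *\<^sub>R sgn q"
    have "p \<in> cball 0 c" using assms by (simp add: p_def norm_sgn)
    moreover have "p \<bullet> q = c * norm q"
      by (cases "q = 0") (simp_all add: p_def sgn_div_norm power2_norm_eq_inner[symmetric] power2_eq_square)
    ultimately show ?thesis using fenchel_young[of p q] B[of p] by simp
  qed
  then show ?thesis using that by blast
qed

section \<open>The Hopf-Lax formula\<close>

definition hopf_lax_cost :: "(real^'n \<Rightarrow> real) \<Rightarrow> real \<Rightarrow> real^'n \<Rightarrow> real^'n \<Rightarrow> real" where
  "hopf_lax_cost u0 t x y = u0 y + t * legendre ((x - y) /\<^sub>R t)"

text \<open>
  The initial time is set apart: as \<open>(x - y) /\<^sub>R 0 = 0\<close>, the cost at \<open>t = 0\<close> would be \<open>u0 y\<close>, whatever \<open>x\<close> is.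
\<close>

definition hopf_lax :: "(real^'n \<Rightarrow> real) \<Rightarrow> real \<Rightarrow> real^'n \<Rightarrow> real" where
  "hopf_lax u0 t x = (if t = 0 then u0 x else INF y. hopf_lax_cost u0 t x y)"

lemma hopf_lax_0 [simp]: "hopf_lax u0 0 x = u0 x" by (simp add: hopf_lax_def)

lemma hopf_lax_minimizer:
  assumes lip: "C-lipschitz_on UNIV u0" and t: "t > 0"
  obtains y where "hopf_lax u0 t x = hopf_lax_cost u0 t x y" "\<And>z. hopf_lax_cost u0 t x y \<le> hopf_lax_cost u0 t x z"
proof -
  have C: "C \<ge> 0" using lip lipschitz_on_nonneg by blast
  obtain B where B: "\<And>q. (C + 1) * norm q - B \<le> legendre q" using legendre_growth[of "C + 1"] C by auto
  have "continuous_on UNIV (hopf_lax_cost u0 t x)"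
    unfolding hopf_lax_cost_def
    by (intro continuous_intros lipschitz_on_continuous_on[OF lip]
        continuous_on_compose2[OF continuous_on_legendre[of UNIV]]) auto
  moreover have "norm (y - x) - (t * B - u0 x) \<le> hopf_lax_cost u0 t x y" for y
  proof -
    have "u0 x - u0 y \<le> C * norm (y - x)"
      using lipschitz_onD[OF lip, of x y] by (simp add: dist_norm norm_minus_commute)
    moreover have "t * ((C + 1) * norm ((x - y) /\<^sub>R t) - B) \<le> t * legendre ((x - y) /\<^sub>R t)"
      using t B[of "(x - y) /\<^sub>R t"] by (intro mult_left_mono) simp_all
    moreover have "t * norm ((x - y) /\<^sub>R t) = norm (y - x)" using t by (simp add: norm_minus_commute)
    then have "t * ((C + 1) * norm ((x - y) /\<^sub>R t) - B) = (C + 1) * norm (y - x) - t * B"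
      by (metis (no_types, opaque_lifting) mult.left_commute right_diff_distrib)
    ultimately show ?thesis by (simp add: hopf_lax_cost_def algebra_simps)
  qed
  ultimately obtain y where y: "\<And>z. hopf_lax_cost u0 t x y \<le> hopf_lax_cost u0 t x z"
    using coercive_attains_inf[of UNIV "hopf_lax_cost u0 t x" x] by (metis UNIV_I UNIV_not_empty closed_UNIV)
  then have "(INF y. hopf_lax_cost u0 t x y) = hopf_lax_cost u0 t x y"
    by (intro cInf_eq_minimum) auto
  then show ?thesis using that y t by (simp add: hopf_lax_def)
qed

lemma hopf_lax_le:
  assumes "C-lipschitz_on UNIV u0" "t > 0"
  shows "hopf_lax u0 t x \<le> hopf_lax_cost u0 t x y"
  by (metis hopf_lax_minimizer[OF assms])

text \<open>
  One half of the dynamic programming principle, for straight paths: going from \<open>y\<close> to \<open>x - h q\<close> and then with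
  velocity \<open>q\<close> to \<open>x\<close> is at least as expensive as going straight, by convexity of the conjugate.
\<close>

lemma hopf_lax_step_le:
  assumes lip: "C-lipschitz_on UNIV u0" and h: "0 < h" "h \<le> t"
  shows "hopf_lax u0 t x \<le> hopf_lax u0 (t - h) (x - h *\<^sub>R q) + h * legendre q"
proof (cases "h = t")
  case True
  then show ?thesis using hopf_lax_le[OF lip, of t x "x - t *\<^sub>R q"] h by (simp add: hopf_lax_cost_def)
next
  case False
  then have t: "0 < t - h" "0 < t" using h by auto
  obtain y where y: "hopf_lax u0 (t - h) (x - h *\<^sub>R q) = hopf_lax_cost u0 (t - h) (x - h *\<^sub>R q) y"
    using hopf_lax_minimizer[OF lip t(1)] by metis
  define r where "r = (x - h *\<^sub>R q - y) /\<^sub>R (t - h)"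
  have r: "(t - h) *\<^sub>R r = x - h *\<^sub>R q - y" using t by (simp add: r_def)
  have "(x - y) /\<^sub>R t = ((t - h) *\<^sub>R r + h *\<^sub>R q) /\<^sub>R t" unfolding r by simp
  also have "\<dots> = (1 - h / t) *\<^sub>R r + (h / t) *\<^sub>R q"
    using t by (simp add: scaleR_add_right diff_divide_distrib divide_inverse_commute right_diff_distrib)
  finally have "legendre ((x - y) /\<^sub>R t) \<le> (1 - h / t) * legendre r + h / t * legendre q"
    using legendre_convex[of "h / t" r q] h t by simp
  then have "t * legendre ((x - y) /\<^sub>R t) \<le> t * ((1 - h / t) * legendre r + h / t * legendre q)"
    using t by simp
  also have "\<dots> = (t - h) * legendre r + h * legendre q" using t by (simp add: field_simps)
  finally show ?thesis
    using hopf_lax_le[OF lip t(2), of x y] unfolding y by (simp add: hopf_lax_cost_def r_def)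
qed

text \<open>
  The other half: the minimizing straight path can be cut at any time.
\<close>

lemma hopf_lax_step_eq:
  assumes lip: "C-lipschitz_on UNIV u0" and h: "0 < h" "h \<le> t"
  obtains q where "hopf_lax u0 (t - h) (x - h *\<^sub>R q) + h * legendre q \<le> hopf_lax u0 t x"
proof -
  have t: "0 < t" using h by auto
  obtain y where y: "hopf_lax u0 t x = hopf_lax_cost u0 t x y" using hopf_lax_minimizer[OF lip t] by metis
  define q where "q = (x - y) /\<^sub>R t"
  have q: "t *\<^sub>R q = x - y" using t by (simp add: q_def)
  have "hopf_lax u0 (t - h) (x - h *\<^sub>R q) \<le> u0 y + (t - h) * legendre q"
  proof (cases "h = t")
    case True
    then show ?thesis using q by simp
  next
    case False
    then have t': "0 < t - h" using h by auto
    have "x - h *\<^sub>R q - y = (t - h) *\<^sub>R q" using q by (simp add: algebra_simps)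
    then show ?thesis using hopf_lax_le[OF lip t', of "x - h *\<^sub>R q" y] t' by (simp add: hopf_lax_cost_def)
  qed
  then have "hopf_lax u0 (t - h) (x - h *\<^sub>R q) + h * legendre q \<le> hopf_lax u0 t x"
    unfolding y hopf_lax_cost_def q_def[symmetric] by (simp add: algebra_simps)
  then show ?thesis using that by blast
qed

text \<open>
  Translating an optimal path costs only the change of the initial datum at its starting point.
\<close>

lemma hopf_lax_lipschitz_space:
  assumes lip: "C-lipschitz_on UNIV u0" and t: "t \<ge> 0"
  shows "C-lipschitz_on UNIV (hopf_lax u0 t)"
proof (cases "t = 0")
  case True
  then have "hopf_lax u0 t = u0" by auto
  then show ?thesis using lip by simp
next
  case False
  then have t: "t > 0" using t by simp
  have *: "hopf_lax u0 t x \<le> hopf_lax u0 t z + C * dist x z" for x z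
  proof -
    obtain y where y: "hopf_lax u0 t z = hopf_lax_cost u0 t z y" using hopf_lax_minimizer[OF lip t] by metis
    have "hopf_lax u0 t x \<le> hopf_lax_cost u0 t x (x - z + y)" by (rule hopf_lax_le[OF lip t])
    also have "\<dots> = u0 (x - z + y) + t * legendre ((z - y) /\<^sub>R t)" by (simp add: hopf_lax_cost_def)
    also have "u0 (x - z + y) \<le> u0 y + C * dist x z"
      using lipschitz_onD[OF lip, of "x - z + y" y] by (simp add: dist_norm)
    finally show ?thesis by (simp add: y hopf_lax_cost_def)
  qed
  show ?thesis
  proof (rule lipschitz_onI)
    show "dist (hopf_lax u0 t x) (hopf_lax u0 t z) \<le> C * dist x z" for x z
      using *[of x z] *[of z x] by (simp add: dist_real_def dist_commute abs_le_iff)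
  qed (use lip lipschitz_on_nonneg in blast)
qed

lemma hopf_lax_lipschitz_time:
  assumes lip: "C-lipschitz_on UNIV u0"
  obtains B where "B \<ge> 0" "\<And>s t x. 0 \<le> s \<Longrightarrow> s \<le> t \<Longrightarrow> \<bar>hopf_lax u0 t x - hopf_lax u0 s x\<bar> \<le> B * (t - s)"
proof -
  have "C \<ge> 0" using lip lipschitz_on_nonneg by blast
  then obtain B1 where B1: "\<And>q. C * norm q - B1 \<le> legendre q" using legendre_growth by blast
  define B where "B = \<bar>B1\<bar> + \<bar>legendre 0\<bar>"
  have "\<bar>hopf_lax u0 t x - hopf_lax u0 s x\<bar> \<le> B * (t - s)" if st: "0 \<le> s" "s \<le> t" for s t x
  proof (cases "s = t")
    case False
    define h where "h = t - s"
    have h: "0 < h" "h \<le> t" "t - h = s" using st False by (auto simp: h_def)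
    have "hopf_lax u0 t x \<le> hopf_lax u0 s x + h * legendre 0" using hopf_lax_step_le[OF lip h(1,2), of x 0] h(3) by simp
    moreover have "h * legendre 0 \<le> h * B" using h by (intro mult_left_mono) (auto simp: B_def)
    moreover obtain q where q: "hopf_lax u0 s (x - h *\<^sub>R q) + h * legendre q \<le> hopf_lax u0 t x"
      using hopf_lax_step_eq[OF lip h(1,2), of x] h(3) by metis
    have "hopf_lax u0 s x - hopf_lax u0 s (x - h *\<^sub>R q) \<le> C * (h * norm q)"
      using lipschitz_onD[OF hopf_lax_lipschitz_space[OF lip st(1)], of x "x - h *\<^sub>R q"] h(1)
      by (simp add: dist_norm)
    moreover have "h * (C * norm q - B1) \<le> h * legendre q" using B1 h by (intro mult_left_mono) auto
    moreover have "h * B1 \<le> h * B" using h by (intro mult_left_mono) (auto simp: B_def)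
    moreover have "C * (h * norm q) = h * (C * norm q)" by simp
    ultimately have "hopf_lax u0 t x - hopf_lax u0 s x \<le> h * B" "hopf_lax u0 s x - hopf_lax u0 t x \<le> h * B"
      using q by (auto simp: right_diff_distrib)
    then show ?thesis by (simp add: abs_le_iff h_def mult.commute)
  qed simp
  moreover have "B \<ge> 0" by (simp add: B_def)
  ultimately show ?thesis using that by blast
qed

lemma hopf_lax_lipschitz:
  assumes lip: "C-lipschitz_on UNIV u0"
  obtains C' where "C'-lipschitz_on ({0..} \<times> UNIV) (\<lambda>(t, x). hopf_lax u0 t x)"
proof -
  have C: "C \<ge> 0" using lip lipschitz_on_nonneg by blast
  obtain B where B: "B \<ge> 0" "\<And>s t x. 0 \<le> s \<Longrightarrow> s \<le> t \<Longrightarrow> \<bar>hopf_lax u0 t x - hopf_lax u0 s x\<bar> \<le> B * (t - s)"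
    using hopf_lax_lipschitz_time[OF lip] by metis
  have B': "\<bar>hopf_lax u0 t x - hopf_lax u0 s x\<bar> \<le> B * \<bar>t - s\<bar>" if "0 \<le> s" "0 \<le> t" for s t x
    using B(2)[of s t x] B(2)[of t s x] that by (cases "s \<le> t") (auto simp: abs_minus_commute)
  have "(B + C)-lipschitz_on ({0..} \<times> UNIV) (\<lambda>(t, x). hopf_lax u0 t x)"
  proof (rule lipschitz_onI)
    fix z w :: "real \<times> (real^'n)" assume zw: "z \<in> {0..} \<times> UNIV" "w \<in> {0..} \<times> UNIV"
    obtain t x s y where [simp]: "z = (t, x)" "w = (s, y)" by (metis surj_pair)
    have "\<bar>hopf_lax u0 t x - hopf_lax u0 s y\<bar> \<le> \<bar>hopf_lax u0 t x - hopf_lax u0 s x\<bar> + \<bar>hopf_lax u0 s x - hopf_lax u0 s y\<bar>" by simp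
    also have "\<dots> \<le> B * \<bar>t - s\<bar> + C * dist x y"
      using B'[of s t x] zw lipschitz_onD[OF hopf_lax_lipschitz_space[OF lip, of s], of x y]
      by (intro add_mono) (auto simp: dist_real_def)
    also have "\<dots> \<le> B * dist z w + C * dist z w"
      using dist_fst_le[of z w] dist_snd_le[of z w] B(1) C
      by (intro add_mono mult_left_mono) (auto simp: dist_real_def)
    finally show "dist (case z of (t, x) \<Rightarrow> hopf_lax u0 t x) (case w of (t, x) \<Rightarrow> hopf_lax u0 t x) \<le> (B + C) * dist z w"
      by (simp add: dist_real_def algebra_simps)
  qed (use B C in simp)
  then show ?thesis using that by blast
qed

lemma hopf_lax_cost_has_derivative:
  assumes "t > 0"
  shows "((\<lambda>(t, x). hopf_lax_cost u0 t x y) has_derivative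
     (\<lambda>(s, h). - H (grad_inv ((x - y) /\<^sub>R t)) * s + grad_inv ((x - y) /\<^sub>R t) \<bullet> h)) (at (t, x))"
proof -
  let ?q = "(x - y) /\<^sub>R t"
  have "((\<lambda>z. (snd z - y) /\<^sub>R fst z) has_derivative
      (\<lambda>z. (- inverse t * fst z * inverse t) *\<^sub>R (x - y) + inverse t *\<^sub>R snd z)) (at (t, x))"
    using assms by (auto intro!: derivative_eq_intros simp: fun_eq_iff)
  from has_derivative_compose[OF this, of legendre "\<lambda>v. grad_inv ?q \<bullet> v"] legendre_has_derivative[of ?q]
  have "((\<lambda>z. legendre ((snd z - y) /\<^sub>R fst z)) has_derivative
      (\<lambda>z. grad_inv ?q \<bullet> ((- inverse t * fst z * inverse t) *\<^sub>R (x - y) + inverse t *\<^sub>R snd z))) (at (t, x))"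
    by simp
  then have "((\<lambda>z. u0 y + fst z * legendre ((snd z - y) /\<^sub>R fst z)) has_derivative
      (\<lambda>z. t * (grad_inv ?q \<bullet> ((- inverse t * fst z * inverse t) *\<^sub>R (x - y) + inverse t *\<^sub>R snd z))
        + fst z * legendre ?q)) (at (t, x))"
    by (auto intro!: derivative_eq_intros)
  moreover have "t * (grad_inv ?q \<bullet> ((- inverse t * s * inverse t) *\<^sub>R (x - y) + inverse t *\<^sub>R h)) + s * legendre ?q
      = - H (grad_inv ?q) * s + grad_inv ?q \<bullet> h" for s h
  proof -
    define d where "d = x - y"
    show ?thesis unfolding d_def[symmetric] legendre_def using assms by (simp add: inner_add_right inner_diff_right field_simps)
  qed
  ultimately show ?thesis by (simp add: hopf_lax_cost_def case_prod_unfold)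
qed

text \<open>
  The formula is an infimum of classical solutions. A test function touching the infimum from below at a point
  touches the classical solution of the minimizer there, so it has the derivatives of that solution.
\<close>

lemma hopf_lax_supersolution:
  assumes lip: "C-lipschitz_on UNIV u0"
  shows "viscosity_supersolution H (\<lambda>(t, x). hopf_lax u0 t x)"
  unfolding viscosity_supersolution_def
proof (intro allI ballI impI)
  fix \<phi> a b and z :: "real \<times> (real^'n)"
  assume z: "z \<in> {0<..} \<times> UNIV" and \<phi>: "C1_test \<phi> a b"
    and min: "\<forall>\<^sub>F w in nhds z. (case z of (t, x) \<Rightarrow> hopf_lax u0 t x) - \<phi> z \<le> (case w of (t, x) \<Rightarrow> hopf_lax u0 t x) - \<phi> w"
  obtain t x where [simp]: "z = (t, x)" by (metis surj_pair)
  have t: "t > 0" using z by simp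
  obtain y where y: "hopf_lax u0 t x = hopf_lax_cost u0 t x y" using hopf_lax_minimizer[OF lip t] by metis
  define q where "q = (x - y) /\<^sub>R t"
  define f where "f = (\<lambda>w. (case w of (t, x) \<Rightarrow> hopf_lax_cost u0 t x y) - \<phi> w)"
  have "open ({0::real<..} \<times> (UNIV :: (real^'n) set))" by (simp add: open_Times)
  then have "\<forall>\<^sub>F w in nhds z. w \<in> {0<..} \<times> UNIV" using z by (rule eventually_nhds_in_open)
  with min have "\<forall>\<^sub>F w in nhds z. f z \<le> f w"
  proof eventually_elim
    case (elim w)
    then show ?case using hopf_lax_le[OF lip, of "fst w" "snd w" y] y by (cases w) (auto simp: f_def)
  qed
  then obtain S where S: "open S" "z \<in> S" "\<forall>w\<in>S. f z \<le> f w" unfolding eventually_nhds by blast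
  have "(f has_derivative (\<lambda>v. (case v of (s, h) \<Rightarrow> - H (grad_inv q) * s + grad_inv q \<bullet> h) -
      (case v of (s, h) \<Rightarrow> a z * s + b z \<bullet> h))) (at z)"
    unfolding f_def q_def
    by (intro has_derivative_diff) (use hopf_lax_cost_has_derivative[OF t] \<phi> z in \<open>auto simp: C1_test_def\<close>)
  from differential_zero_maxmin[OF S(2,1) this] S(3)
  have *: "(case v of (s, h) \<Rightarrow> - H (grad_inv q) * s + grad_inv q \<bullet> h) - (case v of (s, h) \<Rightarrow> a z * s + b z \<bullet> h) = 0" for v
    by meson
  have "a z = - H (grad_inv q)" using *[of "(1, 0)"] by simp
  moreover have "(grad_inv q - b z) \<bullet> (grad_inv q - b z) = 0" using *[of "(0, grad_inv q - b z)"] by (simp add: inner_diff_left)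
  then have "b z = grad_inv q" by simp
  ultimately show "0 \<le> a z + H (b z)" by simp
qed

text \<open>
  Dynamic programming along the velocity \<open>q = DH b\<close>, where \<open>b\<close> is the spatial gradient of the test function, gives
  \<open>a + b \<bullet> q \<le> H\<^sup>*(q)\<close>, and for this \<open>q\<close> the Fenchel-Young inequality is an equality.
\<close>

lemma hopf_lax_subsolution:
  assumes lip: "C-lipschitz_on UNIV u0"
  shows "viscosity_subsolution H (\<lambda>(t, x). hopf_lax u0 t x)"
  unfolding viscosity_subsolution_def
proof (intro allI ballI impI)
  fix \<phi> a b and z :: "real \<times> (real^'n)"
  assume z: "z \<in> {0<..} \<times> UNIV" and \<phi>: "C1_test \<phi> a b"
    and max: "\<forall>\<^sub>F w in nhds z. (case w of (t, x) \<Rightarrow> hopf_lax u0 t x) - \<phi> w \<le> (case z of (t, x) \<Rightarrow> hopf_lax u0 t x) - \<phi> z"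
  obtain t x where [simp]: "z = (t, x)" by (metis surj_pair)
  have t: "t > 0" using z by simp
  define q where "q = DH (b z)"
  define g where "g h = \<phi> (t - h, x - h *\<^sub>R q)" for h
  have "((\<lambda>h. (t - h, x - h *\<^sub>R q)) has_derivative (\<lambda>h. (- h, - (h *\<^sub>R q)))) (at 0)"
    by (auto intro!: derivative_eq_intros)
  moreover have "(\<phi> has_derivative (\<lambda>(s, h). a z * s + b z \<bullet> h)) (at (t - 0, x - 0 *\<^sub>R q))"
    using \<phi> z by (simp add: C1_test_def)
  ultimately have "(g has_derivative (\<lambda>h. case (- h, - (h *\<^sub>R q)) of (s, h) \<Rightarrow> a z * s + b z \<bullet> h)) (at 0)"
    unfolding g_def by (rule has_derivative_compose)
  then have "(g has_field_derivative - (a z + b z \<bullet> q)) (at 0)"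
    unfolding has_field_derivative_def by (rule has_derivative_eq_rhs) (auto simp: algebra_simps)
  then have "((\<lambda>h. (g h - g 0) / h) \<longlongrightarrow> - (a z + b z \<bullet> q)) (at_right 0)"
    unfolding has_field_derivative_iff by (simp add: filterlim_at_split)
  moreover have "\<forall>\<^sub>F h in at_right 0. - legendre q \<le> (g h - g 0) / h"
  proof -
    have "((\<lambda>h. (t - h, x - h *\<^sub>R q)) \<longlongrightarrow> z) (at_right 0)"
      by (auto intro!: tendsto_eq_intros)
    then have "\<forall>\<^sub>F h in at_right 0. (case (t - h, x - h *\<^sub>R q) of (t, x) \<Rightarrow> hopf_lax u0 t x) - \<phi> (t - h, x - h *\<^sub>R q)
        \<le> (case z of (t, x) \<Rightarrow> hopf_lax u0 t x) - \<phi> z"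
      using max by (rule eventually_compose_filterlim[rotated])
    moreover have "\<forall>\<^sub>F h in at_right 0. h \<in> {0<..<t}" using t by (rule eventually_at_right_real)
    ultimately show ?thesis
    proof eventually_elim
      case (elim h)
      then have "- (h * legendre q) \<le> g h - g 0"
        using hopf_lax_step_le[OF lip, of h t x q] by (auto simp: g_def)
      then show ?case using elim by (simp add: field_simps)
    qed
  qed
  ultimately have "- legendre q \<le> - (a z + b z \<bullet> q)"
    by (rule tendsto_lowerbound) simp
  then show "a z + H (b z) \<le> 0" using legendre_DH[of "b z"] by (simp add: q_def)
qed

lemma hopf_lax_viscosity_solution:
  assumes lip: "C-lipschitz_on UNIV u0"
  shows "viscosity_solution H u0 (\<lambda>(t, x). hopf_lax u0 t x)"
  unfolding viscosity_solution_def
  using hopf_lax_lipschitz[OF lip] hopf_lax_subsolution[OF lip] hopf_lax_supersolution[OF lip]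
  by (metis case_prod_conv hopf_lax_0)

end

section \<open>Comparison of viscosity solutions\<close>

lemma quadratic_dominates_linear:
  fixes a b r :: real
  assumes "a > 0"
  shows "2 * r - (b + 2)\<^sup>2 / (4 * a) \<le> a * r\<^sup>2 - b * r"
proof -
  have "0 \<le> (2 * a * r - (b + 2))\<^sup>2 / (4 * a)" using assms by simp
  also have "\<dots> = a * r\<^sup>2 - (b + 2) * r + (b + 2)\<^sup>2 / (4 * a)"
    using assms by (simp add: field_simps power2_eq_square)
  finally show ?thesis by (simp add: algebra_simps)
qed

text \<open>
  Doubling of variables. If the subsolution exceeded the supersolution somewhere, then
  \<open>u z - v w - |z - w|\<^sup>2 / (2 \<epsilon>) - \<mu> (t\<^sup>2 + t) - \<delta> |x|\<^sup>2\<close>, where \<open>z = (t, x)\<close>, would have a positive maximum at positive times. The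
  quadratic coupling provides test functions with the same derivatives at both points, except for the
  penalties: the term in \<open>t\<close> contributes at least \<open>\<mu>\<close> with the right sign for all \<open>t > 0\<close>, which gives the
  contradiction, and the term in \<open>x\<close> provides compactness and disappears as \<open>\<delta>\<close> tends to \<open>0\<close>. Lipschitz continuity
  keeps \<open>z - w\<close> of order \<open>\<epsilon>\<close>, so the gradients stay in a fixed ball, on which \<open>H\<close> is uniformly continuous.
\<close>

theorem viscosity_comparison:
  fixes H :: "real^'n::finite \<Rightarrow> real" and u v :: "real \<times> (real^'n) \<Rightarrow> real"
  assumes H: "continuous_on UNIV H"
    and u_lip: "Cu-lipschitz_on ({0..} \<times> UNIV) u" and v_lip: "Cv-lipschitz_on ({0..} \<times> UNIV) v"
    and sub: "viscosity_subsolution H u" and super: "viscosity_supersolution H v"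
    and initial: "\<And>x. u (0, x) \<le> v (0, x)" and t1: "t1 \<ge> 0"
  shows "u (t1, x1) \<le> v (t1, x1)"
proof (rule ccontr)
  define D :: "(real \<times> (real^'n)) set" where "D = {0..} \<times> UNIV"
  define \<sigma> where "\<sigma> = u (t1, x1) - v (t1, x1)"
  assume "\<not> ?thesis"
  then have \<sigma>: "\<sigma> > 0" by (simp add: \<sigma>_def)
  define C where "C = max 1 (max Cu Cv)"
  have C: "C \<ge> 1" "C > 0" by (auto simp: C_def)
  have u: "C-lipschitz_on D u" unfolding D_def C_def by (rule lipschitz_on_mono[OF u_lip]) auto
  have v: "C-lipschitz_on D v" unfolding D_def C_def by (rule lipschitz_on_mono[OF v_lip]) auto
  have uD: "\<bar>u z - u w\<bar> \<le> C * norm (z - w)" if "z \<in> D" "w \<in> D" for z w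
    using lipschitz_onD[OF u that] by (simp add: dist_norm)
  have vD: "\<bar>v z - v w\<bar> \<le> C * norm (z - w)" if "z \<in> D" "w \<in> D" for z w
    using lipschitz_onD[OF v that] by (simp add: dist_norm)
  have diag: "u (t, x) - v (t, x) \<le> 2 * C * t" if "t \<ge> 0" for t x
    using uD[of "(t, x)" "(0, x)"] vD[of "(t, x)" "(0, x)"] initial[of x] that
    by (simp add: D_def norm_Pair)
  \<comment> \<open>The penalties in time and space together cost at most half of the excess at the given point.\<close>
  define \<mu> where "\<mu> = \<sigma> / (4 * (t1\<^sup>2 + t1 + 1))"
  have t1': "t1\<^sup>2 + t1 + 1 > 0" using t1 by (simp add: add_nonneg_pos)
  have \<mu>: "\<mu> > 0" "\<mu> * (t1\<^sup>2 + t1) \<le> \<sigma> / 4"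
    using \<sigma> t1 t1' by (auto simp: \<mu>_def field_simps)
  \<comment> \<open>Then the coupled points are so close that moving one onto the other changes the functions by at most a quarter of the excess.\<close>
  define \<epsilon> where "\<epsilon> = \<sigma> / (8 * C\<^sup>2)"
  have \<epsilon>: "\<epsilon> > 0" "2 * C\<^sup>2 * \<epsilon> = \<sigma> / 4" using \<sigma> C by (auto simp: \<epsilon>_def)
  \<comment> \<open>A bound for the spatial penalty at the maximum that does not depend on its coefficient.\<close>
  define B where "B = \<sigma> / 4 + C\<^sup>2 / \<mu>"
  have B: "B > 0" using \<sigma> \<mu> by (simp add: B_def add_pos_nonneg)
  have "uniformly_continuous_on (cball 0 (2 * C + 1)) H"
    by (intro compact_uniformly_continuous continuous_on_subset[OF H]) auto
  then obtain \<eta>0 where \<eta>0: "\<eta>0 > 0" and unif0: "\<And>p q. p \<in> cball 0 (2 * C + 1) \<Longrightarrow> q \<in> cball 0 (2 * C + 1) \<Longrightarrow>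
      dist p q < \<eta>0 \<Longrightarrow> dist (H p) (H q) < \<mu>"
    unfolding uniformly_continuous_on_def using \<mu>(1) by metis
  define \<eta> where "\<eta> = min \<eta>0 1"
  have \<eta>: "\<eta> > 0" "\<eta> \<le> 1" using \<eta>0 by (auto simp: \<eta>_def)
  have unif: "\<bar>H p - H q\<bar> < \<mu>" if "norm p \<le> 2 * C + 1" "norm q \<le> 2 * C + 1" "norm (p - q) < \<eta>" for p q
    using unif0[of p q] that by (auto simp: \<eta>_def dist_norm)
  define \<delta> where "\<delta> = min (\<sigma> / (4 * ((norm x1)\<^sup>2 + 1))) (\<eta>\<^sup>2 / (4 * (B + 1)))"
  have x1': "(norm x1)\<^sup>2 + 1 > 0" by (simp add: add_nonneg_pos)
  have \<delta>: "\<delta> > 0" using \<sigma> \<eta> B x1' by (simp add: \<delta>_def)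
  have "\<delta> * (norm x1)\<^sup>2 \<le> \<sigma> / (4 * ((norm x1)\<^sup>2 + 1)) * (norm x1)\<^sup>2"
    by (intro mult_right_mono) (auto simp: \<delta>_def)
  also have "\<dots> \<le> \<sigma> / 4" using \<sigma> x1' by (simp add: field_simps)
  finally have \<delta>1: "\<delta> * (norm x1)\<^sup>2 \<le> \<sigma> / 4" .
  have "4 * \<delta> * (B + 1) \<le> 4 * (\<eta>\<^sup>2 / (4 * (B + 1))) * (B + 1)"
    using B by (intro mult_right_mono mult_left_mono) (auto simp: \<delta>_def)
  also have "\<dots> = \<eta>\<^sup>2" using B by (simp add: field_simps)
  finally have \<delta>2: "4 * \<delta> * B < \<eta>\<^sup>2" using \<delta> B by (simp add: algebra_simps)
  define pen where "pen z = \<mu> * ((fst z)\<^sup>2 + fst z) + \<delta> * (norm (snd z))\<^sup>2" for z :: "real \<times> (real^'n)"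
  define f where "f = (\<lambda>(z, w). v w - u z + (norm (z - w))\<^sup>2 / (2 * \<epsilon>) + pen z)"
  have lower: "1 / (2 * \<epsilon>) * (norm (z - w))\<^sup>2 - C * norm (z - w) + (\<mu> * (fst z)\<^sup>2 - 2 * C * fst z)
      + \<delta> * (norm (snd z))\<^sup>2 \<le> f (z, w)" if "z \<in> D" "w \<in> D" for z w
  proof -
    have "fst z \<ge> 0" using that by (auto simp: D_def)
    moreover have "\<mu> * fst z \<ge> 0" using calculation \<mu>(1) by simp
    ultimately show ?thesis
      using vD[OF that] diag[of "fst z" "snd z"] by (simp add: f_def pen_def algebra_simps)
  qed
  define K where "K = (C + 2)\<^sup>2 / (4 * (1 / (2 * \<epsilon>))) + (2 * C + 2)\<^sup>2 / (4 * \<mu>) + (0 + 2)\<^sup>2 / (4 * \<delta>)"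
  have coercive: "norm (zw - 0) - K \<le> f zw" if "zw \<in> D \<times> D" for zw
  proof -
    obtain z w where [simp]: "zw = (z, w)" by (metis surj_pair)
    have zw: "z \<in> D" "w \<in> D" using that by auto
    have "norm zw \<le> norm z + norm w" by (simp add: norm_Pair_le)
    also have "norm w \<le> norm z + norm (z - w)" by norm
    finally have "norm zw \<le> 2 * norm z + 2 * norm (z - w)" using norm_ge_zero[of "z - w"] by linarith
    also have "norm z \<le> fst z + norm (snd z)"
      using norm_Pair_le[of "fst z" "snd z"] zw by (auto simp: D_def)
    finally have n: "norm zw \<le> 2 * fst z + 2 * norm (snd z) + 2 * norm (z - w)" by simp
    have "2 * norm (z - w) - (C + 2)\<^sup>2 / (4 * (1 / (2 * \<epsilon>))) \<le> 1 / (2 * \<epsilon>) * (norm (z - w))\<^sup>2 - C * norm (z - w)"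
      by (rule quadratic_dominates_linear) (use \<epsilon> in simp)
    moreover have "2 * fst z - (2 * C + 2)\<^sup>2 / (4 * \<mu>) \<le> \<mu> * (fst z)\<^sup>2 - 2 * C * fst z"
      by (rule quadratic_dominates_linear) (rule \<mu>)
    moreover have "2 * norm (snd z) - (0 + 2)\<^sup>2 / (4 * \<delta>) \<le> \<delta> * (norm (snd z))\<^sup>2 - 0 * norm (snd z)"
      by (rule quadratic_dominates_linear) (rule \<delta>)
    ultimately show ?thesis using lower[OF zw] n unfolding K_def by simp
  qed
  have closed: "closed (D \<times> D)" unfolding D_def by (intro closed_Times) auto
  have ne: "D \<times> D \<noteq> {}" by (auto simp: D_def)
  have cont: "continuous_on (D \<times> D) f"
    unfolding f_def case_prod_unfold pen_def
    by (intro continuous_intros continuous_on_compose2[OF lipschitz_on_continuous_on[OF u]]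
        continuous_on_compose2[OF lipschitz_on_continuous_on[OF v]]) (use \<epsilon> in auto)
  obtain zw where zw': "zw \<in> D \<times> D" and min': "\<And>q. q \<in> D \<times> D \<Longrightarrow> f zw \<le> f q"
    using coercive_attains_inf[OF cont closed ne coercive] by blast
  obtain z w where "zw = (z, w)" by (metis surj_pair)
  then have zw: "z \<in> D" "w \<in> D" and min: "\<And>z' w'. z' \<in> D \<Longrightarrow> w' \<in> D \<Longrightarrow> f (z, w) \<le> f (z', w')"
    using zw' min' by auto
  have "f (z, w) \<le> f ((t1, x1), (t1, x1))" using t1 by (intro min) (auto simp: D_def)
  also have "\<dots> = - \<sigma> + \<mu> * (t1\<^sup>2 + t1) + \<delta> * (norm x1)\<^sup>2" by (simp add: f_def pen_def \<sigma>_def)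
  finally have neg: "f (z, w) \<le> - \<sigma> / 2" using \<mu>(2) \<delta>1 by simp
  have "f (z, w) \<le> f (z, z)" by (intro min zw)
  then have "(norm (z - w))\<^sup>2 / (2 * \<epsilon>) \<le> v z - v w" by (simp add: f_def)
  also have "\<dots> \<le> C * norm (z - w)" using vD[OF zw] by simp
  finally have "norm (z - w) * norm (z - w) \<le> (2 * C * \<epsilon>) * norm (z - w)"
    using \<epsilon> by (simp add: field_simps power2_eq_square)
  then have dist: "norm (z - w) \<le> 2 * C * \<epsilon>"
  proof (cases "norm (z - w) = 0")
    case False
    then have "0 < norm (z - w)" by simp
    then show ?thesis using mult_right_le_imp_le \<open>norm (z - w) * norm (z - w) \<le> _\<close> by blast
  qed (use \<epsilon> C in simp)
  then have "C * norm (z - w) \<le> C * (2 * C * \<epsilon>)" using C by (intro mult_left_mono) auto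
  also have "\<dots> = \<sigma> / 4" using \<epsilon>(2) by (simp add: power2_eq_square)
  finally have dist': "C * norm (z - w) \<le> \<sigma> / 4" .
  have pen_ge: "pen z \<ge> 0" using \<mu> \<delta> zw by (auto simp: pen_def D_def)
  then have gap: "v w - u z \<le> - \<sigma> / 2"
    using neg \<epsilon> by (simp add: f_def) (smt (verit) divide_nonneg_pos zero_le_power2)
  have z0: "fst z > 0"
  proof (rule ccontr)
    assume "\<not> fst z > 0"
    then have "z = (0, snd z)" using zw by (auto simp: D_def)
    then have "u z \<le> v z" using initial by metis
    then show False using gap vD[OF zw] dist' \<sigma> by linarith
  qed
  have w0: "fst w > 0"
  proof (rule ccontr)
    assume "\<not> fst w > 0"
    then have "w = (0, snd w)" using zw by (auto simp: D_def)
    then have "u w \<le> v w" using initial by metis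
    then show False using gap uD[OF zw] dist' \<sigma> by linarith
  qed
  have nhds: "\<forall>\<^sub>F z' in nhds z. z' \<in> D" if "fst z > 0" for z :: "real \<times> (real^'n)"
  proof -
    have "open ({0::real<..} \<times> (UNIV :: (real^'n) set))" by (intro open_Times) auto
    then have "\<forall>\<^sub>F z' in nhds z. z' \<in> {0<..} \<times> UNIV"
      by (rule eventually_nhds_in_open) (use that in \<open>auto simp: mem_Times_iff\<close>)
    then show ?thesis by eventually_elim (auto simp: D_def)
  qed
  define a where "a z' = (fst z' - fst w) / \<epsilon> + \<mu> * (2 * fst z' + 1)" for z' :: "real \<times> (real^'n)"
  define b where "b z' = (snd z' - snd w) /\<^sub>R \<epsilon> + (2 * \<delta>) *\<^sub>R snd z'" for z' :: "real \<times> (real^'n)"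
  have "C1_test (\<lambda>z'. (norm (z' - w))\<^sup>2 / (2 * \<epsilon>) + pen z') a b"
    unfolding C1_test_def
  proof (intro conjI ballI)
    fix z' :: "real \<times> (real^'n)"
    have "((\<lambda>z'. (norm (z' - w))\<^sup>2 / (2 * \<epsilon>) + pen z') has_derivative
        (\<lambda>h. (2 * ((z' - w) \<bullet> h)) / (2 * \<epsilon>) + (\<mu> * (2 * fst z' * fst h + fst h) + \<delta> * (2 * (snd z' \<bullet> snd h))))) (at z')"
      unfolding pen_def power2_norm_eq_inner divide_inverse
      by (auto intro!: derivative_eq_intros simp: inner_commute fun_eq_iff algebra_simps) 
    moreover have "(2 * ((z' - w) \<bullet> h)) / (2 * \<epsilon>) + (\<mu> * (2 * fst z' * fst h + fst h) + \<delta> * (2 * (snd z' \<bullet> snd h)))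
       = a z' * fst h + b z' \<bullet> snd h" for h
      using \<epsilon> by (simp add: a_def b_def inner_prod_def inner_add_left inner_diff_left field_simps)
    ultimately show "((\<lambda>z'. (norm (z' - w))\<^sup>2 / (2 * \<epsilon>) + pen z') has_derivative
        (\<lambda>(s, h). a z' * s + b z' \<bullet> h)) (at z')" by (simp add: case_prod_unfold)
  qed (use \<epsilon> in \<open>auto simp: a_def b_def intro!: continuous_intros\<close>)
  moreover have "\<forall>\<^sub>F z' in nhds z. u z' - ((norm (z' - w))\<^sup>2 / (2 * \<epsilon>) + pen z') \<le> u z - ((norm (z - w))\<^sup>2 / (2 * \<epsilon>) + pen z)"
    using nhds[OF z0]
  proof eventually_elim
    case (elim z')
    then show ?case using min[OF elim zw(2)] by (simp add: f_def)
  qed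
  moreover have "z \<in> {0<..} \<times> UNIV" "w \<in> {0<..} \<times> UNIV" using z0 w0 by (auto simp: mem_Times_iff)
  ultimately have s1: "a z + H (b z) \<le> 0" using sub unfolding viscosity_subsolution_def by blast
  define a' where "a' w' = (fst z - fst w') / \<epsilon>" for w' :: "real \<times> (real^'n)"
  define b' where "b' w' = (snd z - snd w') /\<^sub>R \<epsilon>" for w' :: "real \<times> (real^'n)"
  have "C1_test (\<lambda>w'. - ((norm (z - w'))\<^sup>2 / (2 * \<epsilon>))) a' b'"
    unfolding C1_test_def
  proof (intro conjI ballI)
    fix w' :: "real \<times> (real^'n)"
    have "((\<lambda>w'. - ((norm (z - w'))\<^sup>2 / (2 * \<epsilon>))) has_derivative (\<lambda>h. (2 * ((z - w') \<bullet> h)) / (2 * \<epsilon>))) (at w')"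
      unfolding power2_norm_eq_inner divide_inverse
      by (auto intro!: derivative_eq_intros simp: inner_commute fun_eq_iff algebra_simps) 
    moreover have "(2 * ((z - w') \<bullet> h)) / (2 * \<epsilon>) = a' w' * fst h + b' w' \<bullet> snd h" for h
      using \<epsilon> by (simp add: a'_def b'_def inner_prod_def inner_add_left inner_diff_left field_simps)
    ultimately show "((\<lambda>w'. - ((norm (z - w'))\<^sup>2 / (2 * \<epsilon>))) has_derivative
        (\<lambda>(s, h). a' w' * s + b' w' \<bullet> h)) (at w')" by (simp add: case_prod_unfold)
  qed (use \<epsilon> in \<open>auto simp: a'_def b'_def intro!: continuous_intros\<close>)
  moreover have "\<forall>\<^sub>F w' in nhds w. v w' - - ((norm (z - w'))\<^sup>2 / (2 * \<epsilon>)) \<ge> v w - - ((norm (z - w))\<^sup>2 / (2 * \<epsilon>))"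
    using nhds[OF w0]
  proof eventually_elim
    case (elim w')
    then show ?case using min[OF zw(1) elim] by (simp add: f_def)
  qed
  ultimately have s2: "a' w + H (b' w) \<ge> 0"
    using super \<open>w \<in> {0<..} \<times> UNIV\<close> unfolding viscosity_supersolution_def by blast
  have "\<delta> * (norm (snd z))\<^sup>2 \<le> B"
  proof -
    have "2 * C * fst z - \<mu> * (fst z)\<^sup>2 \<le> C\<^sup>2 / \<mu>"
    proof -
      have "0 \<le> (\<mu> * fst z - C)\<^sup>2 / \<mu>" using \<mu> by simp
      also have "\<dots> = C\<^sup>2 / \<mu> - (2 * C * fst z - \<mu> * (fst z)\<^sup>2)"
        using \<mu> by (simp add: field_simps power2_eq_square)
      finally show ?thesis by simp
    qed
    moreover have "1 / (2 * \<epsilon>) * (norm (z - w))\<^sup>2 \<ge> 0" using \<epsilon> by simp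
    ultimately show ?thesis using lower[OF zw] neg \<sigma> dist' unfolding B_def by linarith
  qed
  then have "(2 * \<delta> * norm (snd z))\<^sup>2 \<le> 4 * \<delta> * B" using \<delta> by (simp add: power2_eq_square mult_ac)
  also note \<delta>2
  finally have small: "2 * \<delta> * norm (snd z) < \<eta>" by (rule power_less_imp_less_base) (use \<eta> in simp)
  have diff: "norm (b z - b' w) < \<eta>" using small \<delta> by (simp add: b_def b'_def)
  have "norm (b' w) = norm (snd (z - w)) / \<epsilon>"
    unfolding b'_def norm_scaleR snd_diff using \<epsilon>(1) by (simp add: divide_inverse_commute)
  also have "\<dots> \<le> norm (z - w) / \<epsilon>" using \<epsilon>(1) norm_snd_le[of "snd (z - w)" "fst (z - w)"] by (intro divide_right_mono) (simp_all del: snd_diff fst_diff)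
  also have "\<dots> \<le> 2 * C" using dist \<epsilon> by (simp add: field_simps)
  finally have b': "norm (b' w) \<le> 2 * C" .
  then have "norm (b z) \<le> 2 * C + 1" using diff \<eta> norm_triangle_sub[of "b z" "b' w"] by simp
  then have "\<bar>H (b z) - H (b' w)\<bar> < \<mu>" using b' diff by (intro unif) auto
  moreover have "a z = a' w + \<mu> * (2 * fst z + 1)" by (simp add: a_def a'_def)
  moreover have "\<mu> * (2 * fst z + 1) \<ge> \<mu>" using \<mu> z0 by (simp add: algebra_simps)
  ultimately show False using s1 s2 by linarith
qed

section \<open>Regularity and reachability of solutions\<close>

text \<open>
  For a Lipschitz function, the supremum in the seminorm is taken over a bounded set, so it bounds each difference
  quotient; and a closed cube contains the closure of the support as soon as it contains the support.
\<close>

lemma initial_data_iff: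
  fixes u0 :: "real^'n::finite \<Rightarrow> real"
  shows "u0 \<in> initial_data L M \<longleftrightarrow>
     M \<ge> 0 \<and> M-lipschitz_on UNIV u0 \<and> (\<forall>x. (\<exists>i. L < \<bar>x $ i\<bar>) \<longrightarrow> u0 x = 0)"
  (is "?l \<longleftrightarrow> ?r")
proof
  assume ?l
  then obtain C where C: "C-lipschitz_on UNIV u0"
    and supp: "closure (support_on UNIV u0) \<subseteq> {x. \<forall>i. x $ i \<in> {- L..L}}" and M: "Lip_seminorm u0 \<le> M"
    by (auto simp: initial_data_def Lip_space_def)
  let ?q = "\<lambda>(x, y). \<bar>u0 x - u0 y\<bar> / norm (x - y)"
  have "bdd_above (?q ` {(x, y). x \<noteq> y})"
  proof (rule bdd_aboveI2)
    fix z :: "(real^'n) \<times> (real^'n)" assume "z \<in> {(x, y). x \<noteq> y}"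
    then show "?q z \<le> C"
      using lipschitz_onD[OF C, of "fst z" "snd z"]
      by (auto simp: field_simps dist_real_def dist_norm)
  qed
  then have q: "?q (x, y) \<le> M" if "x \<noteq> y" for x y
    using cSUP_upper[of "(x, y)" "{(x, y). x \<noteq> y}" ?q] that M unfolding Lip_seminorm_def by fastforce
  have "0 \<le> ?q (0, axis undefined 1)" by simp
  also have "\<dots> \<le> M" by (rule q) (simp add: axis_eq_0_iff eq_commute[of 0])
  finally have "M \<ge> 0" .
  moreover have "M-lipschitz_on UNIV u0"
  proof (rule lipschitz_onI)
    show "dist (u0 x) (u0 y) \<le> M * dist x y" for x y
      using q[of x y] by (cases "x = y") (auto simp: field_simps dist_real_def dist_norm)
  qed fact
  moreover have "u0 x = 0" if "L < \<bar>x $ i\<bar>" for x i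
  proof (rule ccontr)
    assume "u0 x \<noteq> 0"
    then have "x \<in> closure (support_on UNIV u0)"
      using closure_subset[of "support_on UNIV u0"] by (auto simp: support_on_def)
    then have "x $ i \<in> {- L..L}" using supp by blast
    then show False using that by auto
  qed
  ultimately show ?r by blast
next
  assume r: ?r
  then have M: "M-lipschitz_on UNIV u0" by blast
  have cube: "{x::real^'n. \<forall>i. x $ i \<in> {- L..L}} = cbox (\<chi> i. - L) (\<chi> i. L)"
    by (auto simp: mem_box_cart)
  have closed: "closed {x::real^'n. \<forall>i. x $ i \<in> {- L..L}}" unfolding cube by (rule closed_cbox)
  have "support_on UNIV u0 \<subseteq> {x. \<forall>i. x $ i \<in> {- L..L}}"
  proof clarsimp
    fix x i assume x: "x \<in> support_on UNIV u0"
    have "\<not> L < \<bar>x $ i\<bar>" using r x by (auto simp: support_on_def)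
    then show "- L \<le> x $ i \<and> x $ i \<le> L" by auto
  qed
  then have "closure (support_on UNIV u0) \<subseteq> {x. \<forall>i. x $ i \<in> {- L..L}}"
    using closed by (rule closure_minimal)
  moreover have "Lip_seminorm u0 \<le> M"
    unfolding Lip_seminorm_def
  proof (rule cSUP_least)
    have "(0, axis undefined 1) \<in> {(x::real^'n, y). x \<noteq> y}"
      by (simp add: axis_eq_0_iff eq_commute[of 0])
    then show "{(x::real^'n, y). x \<noteq> y} \<noteq> {}" by blast
    fix z :: "(real^'n) \<times> (real^'n)" assume "z \<in> {(x, y). x \<noteq> y}"
    then show "(case z of (x, y) \<Rightarrow> \<bar>u0 x - u0 y\<bar> / norm (x - y)) \<le> M"
      using lipschitz_onD[OF M, of "fst z" "snd z"]
      by (auto simp: field_simps dist_real_def dist_norm)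
  qed
  ultimately show ?l using M by (auto simp: initial_data_def Lip_space_def)
qed

lemma lipschitz_if_gradient_bounded:
  fixes w :: "real^'n::finite \<Rightarrow> real"
  assumes grad: "\<And>x. GDERIV w x :> Dw x" and le: "\<And>x. norm (Dw x) \<le> \<rho>"
  shows "\<rho>-lipschitz_on UNIV w"
proof (rule bounded_derivative_imp_lipschitz)
  show "(w has_derivative (\<lambda>h. h \<bullet> Dw x)) (at x within UNIV)" for x
    using grad[of x] by (simp add: gderiv_def)
  show "onorm (\<lambda>h. h \<bullet> Dw x) \<le> \<rho>" for x
  proof (rule onorm_le)
    fix h
    have "norm (h \<bullet> Dw x) \<le> norm h * norm (Dw x)" by (simp add: Cauchy_Schwarz_ineq2)
    also have "\<dots> \<le> norm h * \<rho>" by (intro mult_left_mono le) auto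
    finally show "norm (h \<bullet> Dw x) \<le> \<rho> * norm h" by (simp add: mult.commute)
  qed
  show "0 \<le> \<rho>" using order_trans[OF norm_ge_zero le] .
qed simp

context convex_hamiltonian
begin

lemma semigroup_eq_hopf_lax:
  assumes S: "viscosity_semigroup H S" and lip: "C-lipschitz_on UNIV u0" and t: "t \<ge> 0"
  shows "S t u0 x = hopf_lax u0 t x"
proof -
  have "u0 \<in> Lip_space" using lip by (auto simp: Lip_space_def)
  then have s: "viscosity_solution H u0 (\<lambda>(t, x). S t u0 x)"
    using S by (auto simp: viscosity_semigroup_def)
  note h = hopf_lax_viscosity_solution[OF lip]
  have le: "u (t, x) \<le> v (t, x)" if "viscosity_solution H u0 u" "viscosity_solution H u0 v" for u v
    using that viscosity_comparison[OF continuous_on_H, of _ u _ v t x] t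
    unfolding viscosity_solution_def by (metis order_refl)
  from le[OF s h] le[OF h s] show ?thesis by simp
qed

text \<open>
  The cost function of the minimizer at \<open>x\<close> lies above the formula everywhere, touches it at \<open>x\<close>, and lies below
  a paraboloid.
\<close>

lemma hopf_lax_semiconcave:
  assumes lip: "C-lipschitz_on UNIV u0" and t: "t > 0"
  shows "\<exists>P. \<forall>v. hopf_lax u0 t (x + v) \<le> hopf_lax u0 t x + P \<bullet> v + (norm v)\<^sup>2 / (2 * \<alpha> * t)"
proof -
  obtain y where y: "hopf_lax u0 t x = hopf_lax_cost u0 t x y" using hopf_lax_minimizer[OF lip t] by metis
  define q where "q = (x - y) /\<^sub>R t"
  have "hopf_lax u0 t (x + v) \<le> hopf_lax u0 t x + grad_inv q \<bullet> v + (norm v)\<^sup>2 / (2 * \<alpha> * t)" for v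
  proof -
    have "hopf_lax u0 t (x + v) \<le> u0 y + t * legendre (q + v /\<^sub>R t)"
      using hopf_lax_le[OF lip t, of "x + v" y] by (simp add: hopf_lax_cost_def q_def algebra_simps)
    also have "t * legendre (q + v /\<^sub>R t) \<le> t * (legendre q + grad_inv q \<bullet> (v /\<^sub>R t) + (norm (v /\<^sub>R t))\<^sup>2 / (2 * \<alpha>))"
      using t by (intro mult_left_mono legendre_upper) auto
    also have "\<dots> = t * legendre q + grad_inv q \<bullet> v + (norm v)\<^sup>2 / (2 * \<alpha> * t)"
      using t alpha_pos by (simp add: field_simps power2_eq_square)
    finally show ?thesis by (simp add: y hopf_lax_cost_def q_def)
  qed
  then show ?thesis by blast
qed

text \<open>
  Finite speed of propagation. Minimality of \<open>y\<close> forces the momentum \<open>p\<close> of the minimizing path to satisfy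
  \<open>|p| \<le> C\<close>, by comparison with small displacements of \<open>y\<close> in direction \<open>p\<close>. Hence the path has
  length at most \<open>t R\<close> and starts where \<open>u0\<close> vanishes. Among such paths, standing still is cheapest.
\<close>

lemma hopf_lax_outside_cube:
  assumes DH0: "DH 0 = 0" and lip: "C-lipschitz_on UNIV u0" and t: "t > 0"
    and supp: "\<And>x i. L < \<bar>x $ i\<bar> \<Longrightarrow> u0 x = 0"
    and speed: "\<And>p. norm p \<le> C \<Longrightarrow> norm (DH p) \<le> R" and x: "L + t * R < \<bar>x $ i\<bar>"
  shows "hopf_lax u0 t x = - t * H 0"
proof -
  have C: "C \<ge> 0" using lip lipschitz_on_nonneg by blast
  have R: "R \<ge> 0" using speed[of 0] C DH0 by simp
  have "grad_inv 0 = 0" using grad_inv_DH[of 0] DH0 by simp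
  then have Hs0: "legendre 0 = - H 0" by (simp add: legendre_def)
  have "0 \<le> t * R" using R t by simp
  then have "u0 x = 0" using x by (intro supp[of x i]) linarith
  then have upper: "hopf_lax u0 t x \<le> - t * H 0" using hopf_lax_le[OF lip t, of x x] Hs0 by (simp add: hopf_lax_cost_def)
  obtain y where y: "hopf_lax u0 t x = hopf_lax_cost u0 t x y" and min: "\<And>z. hopf_lax_cost u0 t x y \<le> hopf_lax_cost u0 t x z"
    using hopf_lax_minimizer[OF lip t] by metis
  define q where "q = (x - y) /\<^sub>R t"
  define p where "p = grad_inv q"
  define k where "k = (norm p)\<^sup>2 / (2 * \<alpha> * t)"
  have p: "norm p \<le> C"
  proof (rule ccontr)
    assume less: "\<not> norm p \<le> C"
    then have np: "norm p > 0" using C by linarith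
    have k: "k > 0" using np t alpha_pos by (simp add: k_def)
    have *: "norm p * (norm p - C) \<le> s * k" if s: "s > 0" for s
    proof -
      define v where "v = s *\<^sub>R p"
      have "u0 y + t * legendre q \<le> u0 (y + v) + t * legendre (q + (- v /\<^sub>R t))"
        using min[of "y + v"] by (simp add: hopf_lax_cost_def q_def algebra_simps)
      also have "t * legendre (q + (- v /\<^sub>R t)) \<le> t * (legendre q + p \<bullet> (- v /\<^sub>R t) + (norm (- v /\<^sub>R t))\<^sup>2 / (2 * \<alpha>))"
        unfolding p_def using t by (intro mult_left_mono legendre_upper) auto
      also have "\<dots> = t * legendre q - p \<bullet> v + (norm v)\<^sup>2 / (2 * \<alpha> * t)"
        using t alpha_pos by (simp add: field_simps power2_eq_square)
      also have "u0 (y + v) \<le> u0 y + C * norm v"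
        using lipschitz_onD[OF lip, of "y + v" y] by (simp add: dist_norm)
      finally have "p \<bullet> v \<le> C * norm v + (norm v)\<^sup>2 / (2 * \<alpha> * t)" by simp
      then have "s * (norm p * norm p) \<le> s * (C * norm p) + s * (s * k)"
        using s by (simp add: v_def k_def power2_norm_eq_inner[symmetric] power2_eq_square mult_ac)
      then have "s * (norm p * norm p) \<le> s * (C * norm p + s * k)" by (simp add: distrib_left)
      then have "norm p * norm p \<le> C * norm p + s * k" using s by simp
      then show ?thesis by (simp add: algebra_simps)
    qed
    \<comment> \<open>The right side of the inequality can be made smaller than the left side, which does not depend on \<open>s\<close>.\<close>
    define c where "c = norm p * (norm p - C)"
    have c: "c > 0" using np less by (simp add: c_def)
    have "c \<le> c / (2 * k) * k" using *[of "c / (2 * k)"] c k by (simp add: c_def)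
    then show False using c k by simp
  qed
  have "x - y = t *\<^sub>R DH p" using t by (simp add: p_def q_def)
  then have "norm (x - y) \<le> t * R" using speed[OF p] t by simp
  then have "\<bar>(x - y) $ i\<bar> \<le> t * R" using component_le_norm_cart[of "x - y" i] by linarith
  then have "L < \<bar>y $ i\<bar>" using x by simp
  then have "u0 y = 0" by (rule supp)
  moreover have "- H 0 \<le> legendre q" using fenchel_young[of 0 q] by simp
  then have "t * (- H 0) \<le> t * legendre q" using t by (intro mult_left_mono) auto
  ultimately show ?thesis using upper y by (simp add: hopf_lax_cost_def q_def)
qed

text \<open>
  Backward construction. The candidate for the initial datum is the smallest function whose evolution lies
  above \<open>w - t H 0\<close>; up to sign, a constant and reflection of space it is a Hopf-Lax evolution of \<open>- w\<close>, which yields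
  its Lipschitz constant and its support. That the evolution does not exceed \<open>w - t H 0\<close> at \<open>x\<close> is seen at the
  foot \<open>y = x - t DH (Dw x)\<close> of the characteristic: the supremum defining \<open>u0 y\<close> is attained at a point whose
  characteristic has the same foot, and by the contraction hypothesis \<open>x\<close> is the only such point.
\<close>

lemma hopf_lax_reaches:
  assumes DH0: "DH 0 = 0" and t: "t > 0"
    and grad: "\<And>x. GDERIV w x :> Dw x" and Dw_le: "\<And>x. norm (Dw x) \<le> \<rho>"
    and Dw_lip: "\<And>x y. norm (Dw x - Dw y) \<le> k * norm (x - y)"
    and DH_lip: "\<And>p q. norm p \<le> \<rho> \<Longrightarrow> norm q \<le> \<rho> \<Longrightarrow> norm (DH p - DH q) \<le> \<Lambda> * norm (p - q)"
    and contraction: "t * \<Lambda> * k < 1" and \<Lambda>: "\<Lambda> \<ge> 0"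
    and supp: "\<And>x i. L' < \<bar>x $ i\<bar> \<Longrightarrow> w x = 0"
    and L: "L' + t * (\<Lambda> * \<rho>) \<le> L" and M: "\<rho> \<le> M"
  obtains u0 where "u0 \<in> initial_data L M" "\<And>x. hopf_lax u0 t x = w x - t * H 0"
proof -
  have \<rho>: "\<rho> \<ge> 0" using Dw_le[of 0] norm_ge_zero order_trans by blast
  define W where "W x = - w (- x)" for x
  have w_deriv: "(w has_derivative (\<lambda>h. h \<bullet> Dw x)) (at x)" for x
    using grad[of x] by (simp add: gderiv_def)
  have "\<rho>-lipschitz_on UNIV w" using grad Dw_le by (rule lipschitz_if_gradient_bounded)
  then have w_lip: "\<bar>w x - w y\<bar> \<le> \<rho> * norm (x - y)" for x y
    using lipschitz_onD[of \<rho> UNIV w x y] by (simp add: dist_norm)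
  have W_lip: "\<rho>-lipschitz_on UNIV W"
  proof (rule lipschitz_onI)
    show "dist (W x) (W y) \<le> \<rho> * dist x y" for x y
      using w_lip[of "- x" "- y"] by (simp add: W_def dist_norm norm_minus_commute abs_minus_commute)
  qed (fact \<rho>)
  \<comment> \<open>That is, the supremum over \<open>x\<close> of \<open>w x - t H 0 - t H\<^sup>*((x - y) / t)\<close>.\<close>
  define u0 where "u0 y = - hopf_lax W t (- y) - t * H 0" for y
  have hopf_lax_W_lip: "\<rho>-lipschitz_on UNIV (hopf_lax W t)"
    using hopf_lax_lipschitz_space[OF W_lip] t by simp
  have u0_lip': "\<rho>-lipschitz_on UNIV u0"
  proof (rule lipschitz_onI)
    show "dist (u0 x) (u0 y) \<le> \<rho> * dist x y" for x y
      using lipschitz_onD[OF hopf_lax_W_lip, of "- x" "- y"]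
      by (simp add: u0_def dist_norm norm_minus_commute abs_minus_commute)
  qed (fact \<rho>)
  then have u0_lip: "M-lipschitz_on UNIV u0" by (rule lipschitz_on_le) (fact M)
  have speed: "norm (DH p) \<le> \<Lambda> * \<rho>" if "norm p \<le> \<rho>" for p
  proof -
    have "norm (DH p) \<le> \<Lambda> * norm p" using DH_lip[of p 0] that \<rho> DH0 by simp
    also have "\<dots> \<le> \<Lambda> * \<rho>" using that \<Lambda> by (rule mult_left_mono)
    finally show ?thesis .
  qed
  have "u0 y = 0" if "L < \<bar>y $ i\<bar>" for y i
  proof -
    have "hopf_lax W t (- y) = - t * H 0"
    proof (rule hopf_lax_outside_cube[OF DH0 W_lip t])
      show "W x = 0" if "L' < \<bar>x $ i\<bar>" for x i using supp[of "- x" i] that by (simp add: W_def)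
      show "L' + t * (\<Lambda> * \<rho>) < \<bar>(- y) $ i\<bar>" using that L by simp
    qed (rule speed)
    then show ?thesis by (simp add: u0_def)
  qed
  then have "u0 \<in> initial_data L M"
    using u0_lip \<rho> M by (auto simp: initial_data_iff)
  moreover have "hopf_lax u0 t x = w x - t * H 0" for x
  proof (rule antisym)
    \<comment> \<open>The minimum for the reflected problem is attained at \<open>z\<close>, and it is to be shown that \<open>z = - x\<close>.\<close>
    define y where "y = x - t *\<^sub>R DH (Dw x)"
    obtain z where z: "hopf_lax W t (- y) = hopf_lax_cost W t (- y) z" and
      min: "\<And>z'. hopf_lax_cost W t (- y) z \<le> hopf_lax_cost W t (- y) z'"
      using hopf_lax_minimizer[OF W_lip t] by metis
    define q where "q = (- y - z) /\<^sub>R t"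
    have "((\<lambda>z. (- y - z) /\<^sub>R t) has_derivative (\<lambda>h. (- h) /\<^sub>R t)) (at z)"
      by (auto intro!: derivative_eq_intros)
    from has_derivative_compose[OF this, of legendre "\<lambda>v. grad_inv q \<bullet> v"] legendre_has_derivative[of q]
    have "((\<lambda>z. legendre ((- y - z) /\<^sub>R t)) has_derivative (\<lambda>h. grad_inv q \<bullet> ((- h) /\<^sub>R t))) (at z)"
      by (simp add: q_def)
    moreover have "((\<lambda>x. w (- x)) has_derivative (\<lambda>h. (- h) \<bullet> Dw (- z))) (at z)"
      by (rule has_derivative_compose[OF _ w_deriv]) (auto intro!: derivative_eq_intros)
    ultimately have "(hopf_lax_cost W t (- y) has_derivative
        (\<lambda>h. - ((- h) \<bullet> Dw (- z)) + t * (grad_inv q \<bullet> ((- h) /\<^sub>R t)))) (at z)"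
      unfolding hopf_lax_cost_def W_def by (auto intro!: derivative_eq_intros)
    from differential_zero_maxmin[OF _ open_UNIV this] min
    have "(\<lambda>h. - ((- h) \<bullet> Dw (- z)) + t * (grad_inv q \<bullet> ((- h) /\<^sub>R t))) = (\<lambda>h. 0)" by blast
    then have "h \<bullet> Dw (- z) - grad_inv q \<bullet> h = 0" for h
      using t by (simp add: fun_eq_iff)
    then have "(Dw (- z) - grad_inv q) \<bullet> (Dw (- z) - grad_inv q) = 0"
      by (metis inner_commute inner_diff_right)
    then have "grad_inv q = Dw (- z)" by simp
    then have "t *\<^sub>R q = t *\<^sub>R DH (Dw (- z))" using DH_grad_inv by metis
    then have "- y - z = t *\<^sub>R DH (Dw (- z))" using t by (simp add: q_def)
    moreover have "- z = y + (- y - z)" by simp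
    ultimately have "- z = y + t *\<^sub>R DH (Dw (- z))" by metis
    then have "x - (- z) = t *\<^sub>R (DH (Dw x) - DH (Dw (- z)))"
      by (simp add: y_def algebra_simps)
    then have "norm (x - (- z)) = t * norm (DH (Dw x) - DH (Dw (- z)))" using t by simp
    also have "\<dots> \<le> t * (\<Lambda> * norm (Dw x - Dw (- z)))"
      using t Dw_le by (intro mult_left_mono DH_lip) auto
    also have "\<dots> \<le> t * (\<Lambda> * (k * norm (x - (- z))))"
      using t \<Lambda> by (intro mult_left_mono Dw_lip) auto
    also have "\<dots> = (t * \<Lambda> * k) * norm (x - (- z))" by simp
    finally have "(1 - t * \<Lambda> * k) * norm (x - (- z)) \<le> 0" by (simp add: algebra_simps)
    then have zx: "z = - x" using contraction by (simp add: mult_le_0_iff eq_neg_iff_add_eq_0 add.commute)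
    have "hopf_lax u0 t x \<le> hopf_lax_cost u0 t x y" by (rule hopf_lax_le[OF u0_lip t])
    also have "\<dots> = w x - t * H 0"
      using z by (simp add: hopf_lax_cost_def u0_def zx W_def)
    finally show "hopf_lax u0 t x \<le> w x - t * H 0" .
    obtain y' where y': "hopf_lax u0 t x = hopf_lax_cost u0 t x y'" using hopf_lax_minimizer[OF u0_lip t] by metis
    have "hopf_lax W t (- y') \<le> hopf_lax_cost W t (- y') (- x)" by (rule hopf_lax_le[OF W_lip t])
    then show "w x - t * H 0 \<le> hopf_lax u0 t x" unfolding y' by (simp add: hopf_lax_cost_def u0_def W_def)
  qed
  ultimately show ?thesis using that by blast
qed

end

section \<open>Smooth cut-off functions\<close>

text \<open>
  The class of the functions \<open>t\<^sup>-\<^sup>k exp (- 1 / t)\<close>, extended by \<open>0\<close>, is closed under differentiation up to linear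
  combinations, which makes smoothness at \<open>0\<close> a matter of one difference quotient.
\<close>

definition exp_tail :: "nat \<Rightarrow> real \<Rightarrow> real" where
  "exp_tail k t = (if t > 0 then (1 / t) ^ k * exp (- (1 / t)) else 0)"

lemma exp_tail_tendsto_0: "(exp_tail k \<longlongrightarrow> 0) (at_right 0)"
proof -
  have "((\<lambda>t. (inverse t) ^ k / exp (inverse t)) \<longlongrightarrow> 0) (at_right (0::real))"
    by (rule filterlim_compose[OF tendsto_power_div_exp_0 filterlim_inverse_at_top_right])
  moreover have "\<forall>\<^sub>F t in at_right 0. (inverse t) ^ k / exp (inverse t) = exp_tail k t"
    using eventually_at_right_less[of "0::real"]
    by eventually_elim (simp add: exp_tail_def exp_minus divide_inverse)
  ultimately show ?thesis using Lim_transform_eventually by blast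
qed

lemma exp_tail_has_derivative:
  "(exp_tail k has_real_derivative exp_tail (k + 2) t - of_nat k * exp_tail (k + 1) t) (at t)"
proof (cases t "0::real" rule: linorder_cases)
  case less
  have "((\<lambda>t. 0) has_real_derivative 0) (at t)" by simp
  then have "(exp_tail k has_real_derivative 0) (at t)"
    by (rule has_field_derivative_transform_within_open[of _ _ _ "{..<0}"]) (use less in \<open>auto simp: exp_tail_def\<close>)
  then show ?thesis using less by (simp add: exp_tail_def)
next
  case greater
  have "((\<lambda>t. (1 / t) ^ k * exp (- (1 / t))) has_real_derivative
     exp_tail (k + 2) t - of_nat k * exp_tail (k + 1) t) (at t)"
  proof (cases k)
    case 0
    then show ?thesis using greater
      by (auto intro!: derivative_eq_intros simp: exp_tail_def power2_eq_square field_simps)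
  next
    case (Suc l)
    have "((\<lambda>t. (1 / t) ^ Suc l * exp (- (1 / t))) has_real_derivative
       (1 / t) ^ Suc l * (exp (- (1 / t)) * (1 / t ^ 2)) +
       of_nat (Suc l) * (1 / t) ^ l * (- (1 / t ^ 2)) * exp (- (1 / t))) (at t)"
      using greater by (auto intro!: derivative_eq_intros simp: power2_eq_square simp del: of_nat_Suc power_Suc)
    also have "(1 / t) ^ Suc l * (exp (- (1 / t)) * (1 / t ^ 2)) +
       of_nat (Suc l) * (1 / t) ^ l * (- (1 / t ^ 2)) * exp (- (1 / t))
      = exp_tail (k + 2) t - of_nat k * exp_tail (k + 1) t"
      using greater by (simp add: Suc exp_tail_def power2_eq_square algebra_simps add_divide_distrib)
    finally show ?thesis by (simp add: Suc)
  qed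
  then show ?thesis
    by (rule has_field_derivative_transform_within_open[of _ _ _ "{0<..}"]) (use greater in \<open>auto simp: exp_tail_def\<close>)
next
  case equal
  have "((\<lambda>h. exp_tail k h / h) \<longlongrightarrow> 0) (at_left 0)"
  proof (rule tendsto_eventually)
    have "\<forall>\<^sub>F h in at_left (0::real). h \<in> {-1<..<0}" by (rule eventually_at_left_real) simp
    then show "\<forall>\<^sub>F h in at_left 0. exp_tail k h / h = 0" by eventually_elim (auto simp: exp_tail_def)
  qed
  moreover have "((\<lambda>h. exp_tail k h / h) \<longlongrightarrow> 0) (at_right 0)"
  proof (rule Lim_transform_eventually[OF exp_tail_tendsto_0[of "Suc k"]])
    show "\<forall>\<^sub>F h in at_right 0. exp_tail (Suc k) h = exp_tail k h / h"
      using eventually_at_right_less[of "0::real"] by eventually_elim (simp add: exp_tail_def)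
  qed
  ultimately have "((\<lambda>h. exp_tail k h / h) \<longlongrightarrow> 0) (at 0)" by (simp add: filterlim_at_split)
  then show ?thesis by (simp add: equal has_field_derivative_iff exp_tail_def)
qed

text \<open>
  Since this class is closed under partial derivatives and consists of differentiable functions, all iterated
  partial derivatives of its members exist.
\<close>

inductive smooth_algebra :: "(real^'n::finite \<Rightarrow> real) \<Rightarrow> bool" where
  const: "smooth_algebra (\<lambda>x. c)"
| tail: "smooth_algebra (\<lambda>x. exp_tail k (c * x $ j + d))"
| add: "smooth_algebra f \<Longrightarrow> smooth_algebra g \<Longrightarrow> smooth_algebra (\<lambda>x. f x + g x)"
| mult: "smooth_algebra f \<Longrightarrow> smooth_algebra g \<Longrightarrow> smooth_algebra (\<lambda>x. f x * g x)"

lemma smooth_algebra_derivative: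
  fixes f :: "real^'n::finite \<Rightarrow> real"
  shows
  "smooth_algebra f \<Longrightarrow>
    \<exists>F. (\<forall>x. (f has_derivative F x) (at x)) \<and> (\<forall>i. smooth_algebra (\<lambda>x. F x (axis i 1)))"
proof (induction rule: smooth_algebra.induct)
  case (const c)
  then show ?case by (intro exI[of _ "\<lambda>x h. 0"]) (auto intro: smooth_algebra.const)
next
  case (tail k c j d)
  define D where "D x = exp_tail (k + 2) (c * x $ j + d) + (- of_nat k) * exp_tail (k + 1) (c * x $ j + d)" for x :: "real^'n"
  have "((\<lambda>x. exp_tail k (c * x $ j + d)) has_derivative (\<lambda>h. D x * (c * h $ j))) (at x)" for x
  proof -
    have "((\<lambda>x. c * x $ j + d) has_derivative (\<lambda>h. c * h $ j)) (at x)"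
      by (auto intro!: derivative_eq_intros bounded_linear.has_derivative[OF bounded_linear_vec_nth])
    from has_derivative_compose[OF this exp_tail_has_derivative[of k, unfolded has_field_derivative_def]]
    show ?thesis by (simp add: D_def mult.commute)
  qed
  moreover have "smooth_algebra (\<lambda>x. D x * (c * axis i 1 $ j))" for i
    unfolding D_def by (intro smooth_algebra.intros)
  ultimately show ?case by (intro exI[of _ "\<lambda>x h. D x * (c * h $ j)"]) auto
next
  case (add f g)
  then obtain F G where "\<forall>x. (f has_derivative F x) (at x)" "\<forall>i. smooth_algebra (\<lambda>x. F x (axis i 1))"
    "\<forall>x. (g has_derivative G x) (at x)" "\<forall>i. smooth_algebra (\<lambda>x. G x (axis i 1))" by metis
  then show ?case
    by (intro exI[of _ "\<lambda>x h. F x h + G x h"]) (auto intro!: has_derivative_add smooth_algebra.add)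
next
  case (mult f g)
  then obtain F G where "\<forall>x. (f has_derivative F x) (at x)" "\<forall>i. smooth_algebra (\<lambda>x. F x (axis i 1))"
    "\<forall>x. (g has_derivative G x) (at x)" "\<forall>i. smooth_algebra (\<lambda>x. G x (axis i 1))" by metis
  then show ?case using mult
    by (intro exI[of _ "\<lambda>x h. f x * G x h + F x h * g x"])
      (auto intro!: has_derivative_mult smooth_algebra.add smooth_algebra.mult)
qed

lemma smooth_algebra_partial_deriv: "smooth_algebra f \<Longrightarrow> smooth_algebra (partial_deriv i f)"
proof -
  assume "smooth_algebra f"
  then obtain F where F: "\<And>x. (f has_derivative F x) (at x)" "smooth_algebra (\<lambda>x. F x (axis i 1))"
    using smooth_algebra_derivative by blast
  then have "partial_deriv i f = (\<lambda>x. F x (axis i 1))"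
    unfolding partial_deriv_def by (simp add: frechet_derivative_at[OF F(1), symmetric])
  then show ?thesis using F by simp
qed

lemma smooth_algebra_imp_smooth: "smooth_algebra f \<Longrightarrow> smooth f"
proof -
  assume f: "smooth_algebra f"
  have "smooth_algebra (iter_partial is f)" for "is"
    by (induction "is") (auto intro: f smooth_algebra_partial_deriv)
  then show ?thesis
    unfolding smooth_def differentiable_def using smooth_algebra_derivative by blast
qed

text \<open>
  Each factor tends to \<open>1\<close> inside the interval and vanishes outside, so the product tends to the indicator of the box
  as \<open>m\<close> grows.
\<close>

definition box_bump :: "real^'n::finite \<Rightarrow> real^'n \<Rightarrow> nat \<Rightarrow> real^'n \<Rightarrow> real" where
  "box_bump a b m x = (\<Prod>j\<in>UNIV. exp_tail 0 (real (Suc m) * (x $ j - a $ j)) * exp_tail 0 (real (Suc m) * (b $ j - x $ j)))"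

lemma exp_tail_0_bounds: "0 \<le> exp_tail 0 t" "exp_tail 0 t \<le> 1"
  by (auto simp: exp_tail_def)

lemma box_bump_bounds: "0 \<le> box_bump a b m x" "box_bump a b m x \<le> 1"
  unfolding box_bump_def
  by (auto intro!: prod_nonneg prod_le_1 mult_le_one simp: exp_tail_0_bounds)

lemma box_bump_outside: "x \<notin> box a b \<Longrightarrow> box_bump a b m x = 0"
proof -
  assume "x \<notin> box a b"
  then obtain j where "x $ j \<le> a $ j \<or> b $ j \<le> x $ j" by (auto simp: mem_box_cart not_less)
  then have "real (Suc m) * (x $ j - a $ j) \<le> 0 \<or> real (Suc m) * (b $ j - x $ j) \<le> 0"
    by (auto intro!: mult_nonneg_nonpos)
  then have "exp_tail 0 (real (Suc m) * (x $ j - a $ j)) * exp_tail 0 (real (Suc m) * (b $ j - x $ j)) = 0"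
    by (auto simp: exp_tail_def)
  then show ?thesis unfolding box_bump_def by (intro prod_zero) auto
qed

lemma box_bump_test_function:
  fixes a b :: "real^'n::finite"
  shows "box_bump a b m \<in> test_functions"
proof -
  have "smooth_algebra (\<lambda>x. \<Prod>j\<in>A. exp_tail 0 (real (Suc m) * (x $ j - a $ j)) * exp_tail 0 (real (Suc m) * (b $ j - x $ j)))"
    if "finite A" for A :: "'n set"
    using that
  proof induction
    case empty
    then show ?case by (simp add: smooth_algebra.const)
  next
    case (insert j A)
    have "smooth_algebra (\<lambda>x::real^'n. exp_tail 0 (real (Suc m) * x $ j + (- (real (Suc m) * a $ j))) *
        exp_tail 0 ((- real (Suc m)) * x $ j + real (Suc m) * b $ j))"
      by (intro smooth_algebra.intros)
    then have "smooth_algebra (\<lambda>x::real^'n. exp_tail 0 (real (Suc m) * (x $ j - a $ j)) *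
        exp_tail 0 (real (Suc m) * (b $ j - x $ j)))"
      by (simp add: algebra_simps)
    from smooth_algebra.mult[OF this insert.IH] show ?case using insert.hyps by simp
  qed
  then have "smooth (box_bump a b m)"
    unfolding box_bump_def by (intro smooth_algebra_imp_smooth) auto
  moreover have "support_on UNIV (box_bump a b m) \<subseteq> cbox a b"
    using box_bump_outside box_subset_cbox unfolding support_on_def by fastforce
  then have "closure (support_on UNIV (box_bump a b m)) \<subseteq> cbox a b"
    by (intro closure_minimal) auto
  then have "compact (closure (support_on UNIV (box_bump a b m)))"
    using bounded_subset[OF bounded_cbox] by (simp add: compact_eq_bounded_closed)
  ultimately show ?thesis by (simp add: test_functions_def)
qed

lemma box_bump_tendsto:
  fixes a b :: "real^'n::finite"
  shows "(\<lambda>m. box_bump a b m x) \<longlonglongrightarrow> indicator (box a b) x"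
proof (cases "x \<in> box a b")
  case True
  have 1: "(\<lambda>m. exp_tail 0 (real (Suc m) * t)) \<longlonglongrightarrow> 1" if "t > 0" for t
  proof -
    have "(\<lambda>m. exp (- ((1 / t) * inverse (real (Suc m))))) \<longlonglongrightarrow> exp (- ((1 / t) * 0))"
      by (intro tendsto_intros LIMSEQ_inverse_real_of_nat)
    moreover have "exp_tail 0 (real (Suc m) * t) = exp (- ((1 / t) * inverse (real (Suc m))))" for m
    proof -
      have "real (Suc m) * t > 0" using that by simp
      then show ?thesis by (simp add: exp_tail_def field_simps)
    qed
    ultimately show ?thesis by simp
  qed
  have "(\<lambda>m. box_bump a b m x) \<longlonglongrightarrow> (\<Prod>j\<in>(UNIV::'n set). 1 * 1)"
    unfolding box_bump_def
    by (intro tendsto_prod tendsto_mult 1) (use True in \<open>auto simp: mem_box_cart\<close>)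
  then show ?thesis using True by simp
next
  case False
  then show ?thesis by (simp add: box_bump_outside)
qed

section \<open>Weak gradients and the Sobolev distance\<close>

text \<open>
  The sets on which the integral vanishes form a Dynkin system that contains the boxes, hence all Borel sets.
\<close>

lemma AE_eq_0_if_integral_boxes_eq_0:
  fixes k :: "'a::euclidean_space \<Rightarrow> real"
  assumes k: "integrable lborel k"
    and boxes: "\<And>a b. (LINT x:box a b|lborel. k x) = 0"
  shows "AE x in lborel. k x = 0"
proof -
  have set_int: "set_integrable lborel A k" if "A \<in> sets lborel" for A
    using k that unfolding set_integrable_def by (rule integrable_mult_indicator[rotated])
  have UNIV: "(LINT x:UNIV|lborel. k x) = 0"
  proof -
    have "(\<lambda>n::nat. LINT x:box (- real n *\<^sub>R One) (real n *\<^sub>R One)|lborel. k x) \<longlonglongrightarrow> (LINT x:UNIV|lborel. k x)"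
      unfolding set_lebesgue_integral_def
    proof (rule integral_dominated_convergence[where w="\<lambda>x. norm (k x)"])
      show "AE x in lborel. (\<lambda>n. indicat_real (box (- real n *\<^sub>R One) (real n *\<^sub>R One)) x *\<^sub>R k x)
          \<longlonglongrightarrow> indicat_real UNIV x *\<^sub>R k x"
      proof (intro AE_I2 tendsto_scaleR tendsto_const)
        fix x :: 'a
        obtain N :: nat where N: "norm x < real N" using reals_Archimedean2 by blast
        have "x \<in> box (- real n *\<^sub>R One) (real n *\<^sub>R One)" if "n \<ge> N" for n
        proof -
          have "\<bar>x \<bullet> i\<bar> < real n" if "i \<in> Basis" for i
            using Basis_le_norm[OF that, of x] N \<open>n \<ge> N\<close> by linarith
          then show ?thesis by (fastforce simp: mem_box abs_less_iff)
        qed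
        then show "(\<lambda>n. indicat_real (box (- real n *\<^sub>R One) (real n *\<^sub>R One)) x) \<longlonglongrightarrow> indicat_real UNIV x"
          by (intro tendsto_eventually eventually_sequentiallyI[of N]) auto
      qed
      show "(\<lambda>x. indicat_real UNIV x *\<^sub>R k x) \<in> borel_measurable lborel" using k by simp
      show "(\<lambda>x. indicat_real (box (- real n *\<^sub>R One) (real n *\<^sub>R One)) x *\<^sub>R k x) \<in> borel_measurable lborel" for n
        using borel_measurable_integrable[OF k] by simp
      show "integrable lborel (\<lambda>x. norm (k x))" using k by simp
      show "AE x in lborel. norm (indicat_real (box (- real n *\<^sub>R One) (real n *\<^sub>R One)) x *\<^sub>R k x) \<le> norm (k x)" for n
        by (intro AE_I2) (auto simp: indicator_def)
    qed
    then show ?thesis using boxes LIMSEQ_unique[OF _ tendsto_const] by simp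
  qed
  have zero: "(LINT x:A|lborel. k x) = 0" if "A \<in> sets borel" for A
  proof -
    have "Int_stable (range (\<lambda>(a, b). box a b :: 'a set))"
      by (auto simp: Int_stable_def box_Int_box)
    moreover have "range (\<lambda>(a, b). box a b :: 'a set) \<subseteq> Pow UNIV" by simp
    moreover have sets: "sets (borel :: 'a measure) = sigma_sets UNIV (range (\<lambda>(a, b). box a b :: 'a set))"
      by (simp add: borel_eq_box)
    then have "A \<in> sigma_sets UNIV (range (\<lambda>(a, b). box a b :: 'a set))" using that by simp
    ultimately show ?thesis
    proof (induction rule: sigma_sets_induct_disjoint)
      case (basic A)
      then show ?case using boxes by auto
    next
      case empty
      then show ?case by (simp add: set_lebesgue_integral_def)
    next
      case (compl A)
      then have A: "A \<in> sets lborel" using sets by simp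
      have "(LINT x:UNIV|lborel. k x) = (LINT x:A \<union> (UNIV - A)|lborel. k x)" by simp
      also have "\<dots> = (LINT x:A|lborel. k x) + (LINT x:UNIV - A|lborel. k x)"
        using A by (intro set_integral_Un set_int) auto
      finally show ?case using UNIV compl by simp
    next
      case (union A)
      then have A: "A i \<in> sets lborel" for i using sets by auto
      have "(LINT x:(\<Union>i. A i)|lborel. k x) = (\<Sum>i. LINT x:A i|lborel. k x)"
        using union(1) A by (intro lebesgue_integral_countable_add set_int)
          (auto simp: disjoint_family_on_def)
      then show ?case using union by simp
    qed
  qed
  show ?thesis
    by (rule density_unique_real[OF k]) (use zero in \<open>auto simp: set_lebesgue_integral_def\<close>)
qed

text \<open>
  Smooth cut-offs converge boundedly to indicators of boxes. They are integrated against a Borel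
  version of \<open>k\<close>, so that the argument with Borel sets applies.
\<close>

lemma AE_eq_0_if_orthogonal_to_test_functions:
  fixes k :: "real^'n::finite \<Rightarrow> real"
  assumes k: "integrable lebesgue k"
    and orth: "\<And>\<phi>. \<phi> \<in> test_functions \<Longrightarrow> integral\<^sup>L lebesgue (\<lambda>x. k x * \<phi> x) = 0"
  shows "AE x in lebesgue. k x = 0"
proof -
  obtain k' where k'[measurable]: "k' \<in> borel_measurable lborel" and "AE x in lborel. k x = k' x"
    using completion_ex_borel_measurable_real[of k lborel] k by auto
  then have eq: "AE x in lebesgue. k x = k' x" by (simp add: AE_completion)
  have k'_leb: "k' \<in> borel_measurable lebesgue" using k' by (rule measurable_completion)
  have "integrable lebesgue k'"
    using k eq integrable_cong_AE[of k lebesgue k'] k'_leb by auto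
  then have k'_int: "integrable lborel k'" using integrable_completion[OF k'] by simp
  have "(LINT x:box a b|lborel. k' x) = 0" for a b :: "real^'n"
  proof -
    have [measurable]: "box_bump a b m \<in> borel_measurable borel" for m
      unfolding box_bump_def exp_tail_def by measurable
    have "(\<lambda>m. LINT x|lborel. box_bump a b m x *\<^sub>R k' x) \<longlonglongrightarrow> (LINT x:box a b|lborel. k' x)"
      unfolding set_lebesgue_integral_def
    proof (rule integral_dominated_convergence[where w="\<lambda>x. norm (k' x)"])
      show "AE x in lborel. norm (box_bump a b m x *\<^sub>R k' x) \<le> norm (k' x)" for m
        using box_bump_bounds[of a b m] by (intro AE_I2) (simp add: abs_mult mult_left_le_one_le)
      show "AE x in lborel. (\<lambda>m. box_bump a b m x *\<^sub>R k' x) \<longlonglongrightarrow> indicat_real (box a b) x *\<^sub>R k' x"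
        by (intro AE_I2 tendsto_intros box_bump_tendsto)
    qed (use k'_int in auto)
    moreover have "(LINT x|lborel. box_bump a b m x *\<^sub>R k' x) = 0" for m
    proof -
      have "(LINT x|lborel. box_bump a b m x *\<^sub>R k' x) = integral\<^sup>L lebesgue (\<lambda>x. box_bump a b m x *\<^sub>R k' x)"
        by (rule integral_completion[symmetric]) simp
      also have "\<dots> = integral\<^sup>L lebesgue (\<lambda>x. k x * box_bump a b m x)"
      proof (rule integral_cong_AE)
        have bump: "box_bump a b m \<in> borel_measurable lebesgue"
          by (rule measurable_completion) simp
        show "(\<lambda>x. box_bump a b m x *\<^sub>R k' x) \<in> borel_measurable lebesgue"
          using bump k'_leb by (rule borel_measurable_scaleR)
        show "(\<lambda>x. k x * box_bump a b m x) \<in> borel_measurable lebesgue"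
          using borel_measurable_integrable[OF k] bump by (rule borel_measurable_times)
        show "AE x in lebesgue. box_bump a b m x *\<^sub>R k' x = k x * box_bump a b m x"
          using eq by eventually_elim simp
      qed
      also have "\<dots> = 0" by (rule orth[OF box_bump_test_function])
      finally show ?thesis .
    qed
    ultimately show ?thesis using LIMSEQ_unique[OF _ tendsto_const] by simp
  qed
  then have "AE x in lborel. k' x = 0" by (rule AE_eq_0_if_integral_boxes_eq_0[OF k'_int])
  then have "AE x in lebesgue. k' x = 0" by (rule AE_completion)
  with eq show ?thesis by eventually_elim simp
qed

lemma test_function_derivative:
  assumes "\<phi> \<in> test_functions"
  shows "(\<phi> has_derivative frechet_derivative \<phi> (at x)) (at x)"
    and "continuous_on UNIV \<phi>" and "continuous_on UNIV (partial_deriv i \<phi>)"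
proof -
  have diff: "iter_partial is \<phi> differentiable (at x)" for "is" x
    using assms by (auto simp: test_functions_def smooth_def)
  show "(\<phi> has_derivative frechet_derivative \<phi> (at x)) (at x)"
    using diff[of "[]"] by (simp add: frechet_derivative_works)
  show "continuous_on UNIV \<phi>" "continuous_on UNIV (partial_deriv i \<phi>)"
    using diff[of "[]"] diff[of "[i]"]
    by (auto intro!: continuous_at_imp_continuous_on differentiable_imp_continuous_within)
qed

lemma test_function_borel [measurable]:
  assumes "\<phi> \<in> test_functions"
  shows "\<phi> \<in> borel_measurable borel" "partial_deriv i \<phi> \<in> borel_measurable borel"
  using test_function_derivative[OF assms] by (auto intro: borel_measurable_continuous_onI)

lemma test_function_lebesgue:
  assumes "\<phi> \<in> test_functions"
  shows "\<phi> \<in> borel_measurable lebesgue" "partial_deriv i \<phi> \<in> borel_measurable lebesgue"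
  using test_function_borel[OF assms] by (auto intro!: measurable_completion)

lemma test_function_support:
  assumes "\<phi> \<in> test_functions" and "x \<notin> closure (support_on UNIV \<phi>)"
  shows "\<phi> x = 0" "partial_deriv i \<phi> x = 0"
proof -
  have out: "\<phi> y = 0" if "y \<in> - closure (support_on UNIV \<phi>)" for y
    using that closure_subset[of "support_on UNIV \<phi>"] by (auto simp: support_on_def)
  then show "\<phi> x = 0" using assms by simp
  have "((\<lambda>x. 0) has_derivative (\<lambda>h. 0)) (at x)" by simp
  then have "(\<phi> has_derivative (\<lambda>h. 0)) (at x)"
    by (rule has_derivative_transform_within_open[of _ _ _ _ "- closure (support_on UNIV \<phi>)"])
      (use assms out in \<open>auto simp: open_Compl\<close>)
  then have "(\<lambda>h. 0) = frechet_derivative \<phi> (at x)" by (rule frechet_derivative_at)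
  then show "partial_deriv i \<phi> x = 0" unfolding partial_deriv_def by metis
qed

text \<open>
  Both functions are continuous, and both vanish outside the compact support.
\<close>

lemma test_function_bounded:
  assumes "\<phi> \<in> test_functions"
  obtains B where "B \<ge> 0" "\<And>x. \<bar>\<phi> x\<bar> \<le> B" "\<And>x. \<bar>partial_deriv i \<phi> x\<bar> \<le> B"
proof -
  let ?K = "closure (support_on UNIV \<phi>)"
  have K: "compact ?K" using assms by (simp add: test_functions_def)
  have "bounded (\<phi> ` ?K)" "bounded (partial_deriv i \<phi> ` ?K)"
    using K test_function_derivative[OF assms]
    by (auto intro!: compact_imp_bounded compact_continuous_image intro: continuous_on_subset)
  then obtain B1 B2 where B: "\<And>x. x \<in> ?K \<Longrightarrow> \<bar>\<phi> x\<bar> \<le> B1" "\<And>x. x \<in> ?K \<Longrightarrow> \<bar>partial_deriv i \<phi> x\<bar> \<le> B2"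
    unfolding bounded_iff by (metis image_eqI real_norm_def)
  define B where "B = max 0 (max B1 B2)"
  have "\<bar>\<phi> x\<bar> \<le> B \<and> \<bar>partial_deriv i \<phi> x\<bar> \<le> B" for x
    using B[of x] test_function_support[OF assms, of x] by (cases "x \<in> ?K") (auto simp: B_def)
  moreover have "B \<ge> 0" by (simp add: B_def)
  ultimately show ?thesis using that by blast
qed

text \<open>
  The difference of two weak gradients is orthogonal to all test functions, and smooth cut-offs of boxes
  suffice to conclude.
\<close>

lemma weak_gradient_unique:
  fixes f :: "real^'n::finite \<Rightarrow> real"
  assumes g: "integrable lebesgue g" "weak_gradient f g" and h: "integrable lebesgue h" "weak_gradient f h"
  shows "AE x in lebesgue. g x = h x"
proof -
  have comp: "integrable lebesgue (\<lambda>x. g x $ i)" "integrable lebesgue (\<lambda>x. h x $ i)" for i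
    using g h by (auto intro: integrable_bounded_linear[OF bounded_linear_vec_nth])
  have "AE x in lebesgue. g x $ i - h x $ i = 0" for i
  proof (rule AE_eq_0_if_orthogonal_to_test_functions)
    fix \<phi> :: "real^'n \<Rightarrow> real" assume \<phi>: "\<phi> \<in> test_functions"
    obtain B where B: "B \<ge> 0" "\<And>x. \<bar>\<phi> x\<bar> \<le> B" using test_function_bounded[OF \<phi>] by metis
    have int: "integrable lebesgue (\<lambda>x. k x * \<phi> x)" if "integrable lebesgue k" for k :: "real^'n \<Rightarrow> real"
    proof (rule Bochner_Integration.integrable_bound)
      show "integrable lebesgue (\<lambda>x. B * k x)" using that by simp
      show "(\<lambda>x. k x * \<phi> x) \<in> borel_measurable lebesgue"
        using that test_function_lebesgue(1)[OF \<phi>] by (intro borel_measurable_times) auto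
      show "AE x in lebesgue. norm (k x * \<phi> x) \<le> norm (B * k x)"
        using B by (intro AE_I2) (simp add: abs_mult mult.commute mult_right_mono)
    qed
    have "integral\<^sup>L lebesgue (\<lambda>x. (g x $ i - h x $ i) * \<phi> x) =
        integral\<^sup>L lebesgue (\<lambda>x. g x $ i * \<phi> x) - integral\<^sup>L lebesgue (\<lambda>x. h x $ i * \<phi> x)"
      unfolding left_diff_distrib by (intro Bochner_Integration.integral_diff int comp)
    also have "\<dots> = 0"
    proof -
      have "- integral\<^sup>L lebesgue (\<lambda>x. g x $ i * \<phi> x) = - integral\<^sup>L lebesgue (\<lambda>x. h x $ i * \<phi> x)"
        using g(2) h(2) \<phi> unfolding weak_gradient_def by (metis (no_types))
      then show ?thesis by simp
    qed
    finally show "integral\<^sup>L lebesgue (\<lambda>x. (g x $ i - h x $ i) * \<phi> x) = 0" .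
  qed (use comp in auto)
  then have "AE x in lebesgue. \<forall>i. g x $ i - h x $ i = 0" by (simp add: AE_all_countable)
  then show ?thesis by eventually_elim (simp add: vec_eq_iff)
qed

text \<open>
  By uniqueness, the gradient selected in the definition of the norm may be replaced by any given one.
\<close>

lemma W11_norm_eq:
  assumes "integrable lebesgue g" "weak_gradient f g"
  shows "W11_norm f = integral\<^sup>L lebesgue (\<lambda>x. \<bar>f x\<bar>) + integral\<^sup>L lebesgue (\<lambda>x. norm (g x))"
proof -
  let ?P = "\<lambda>g. integrable lebesgue g \<and> weak_gradient f g"
  have s: "?P (Eps ?P)" using assms by (intro someI[of ?P g]) auto
  have "AE x in lebesgue. (Eps ?P) x = g x"
    using s assms by (intro weak_gradient_unique) auto
  then have "AE x in lebesgue. norm ((Eps ?P) x) = norm (g x)" by eventually_elim simp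
  then have "integral\<^sup>L lebesgue (\<lambda>x. norm ((Eps ?P) x)) = integral\<^sup>L lebesgue (\<lambda>x. norm (g x))"
    using s assms by (intro integral_cong_AE) auto
  then show ?thesis by (simp add: W11_norm_def)
qed

lemma weak_gradient_cong_AE:
  fixes f :: "real^'n::finite \<Rightarrow> real"
  assumes ae: "AE x in lebesgue. f x = f' x" and f: "f \<in> borel_measurable lebesgue" "f' \<in> borel_measurable lebesgue"
    and g: "weak_gradient f g"
  shows "weak_gradient f' g"
  unfolding weak_gradient_def
proof (intro ballI allI)
  fix \<phi> :: "real^'n \<Rightarrow> real" and i assume \<phi>: "\<phi> \<in> test_functions"
  have "integral\<^sup>L lebesgue (\<lambda>x. f' x * partial_deriv i \<phi> x) = integral\<^sup>L lebesgue (\<lambda>x. f x * partial_deriv i \<phi> x)"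
    using ae f test_function_lebesgue(2)[OF \<phi>]
    by (intro integral_cong_AE borel_measurable_times) auto
  then show "integral\<^sup>L lebesgue (\<lambda>x. f' x * partial_deriv i \<phi> x) = - integral\<^sup>L lebesgue (\<lambda>x. g x $ i * \<phi> x)"
    using g \<phi> by (simp add: weak_gradient_def)
qed

lemma W11_class_in_W11: "f \<in> W11_fun \<Longrightarrow> W11_class f \<in> W11"
  unfolding W11_class_def W11_def by (rule quotientI)

text \<open>
  The representatives chosen by the distance agree with \<open>f\<close> and \<open>f'\<close> almost everywhere, so \<open>g\<close> is a weak
  gradient of their difference, too.
\<close>

lemma W11_dist_class:
  assumes f: "f \<in> W11_fun" and f': "f' \<in> W11_fun"
    and g: "integrable lebesgue g" "weak_gradient (\<lambda>x. f x - f' x) g"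
  shows "W11_dist (W11_class f) (W11_class f') =
    integral\<^sup>L lebesgue (\<lambda>x. \<bar>f x - f' x\<bar>) + integral\<^sup>L lebesgue (\<lambda>x. norm (g x))"
proof -
  have rep: "(SOME r. r \<in> W11_class f) \<in> W11_fun \<and> (AE x in lebesgue. f x = (SOME r. r \<in> W11_class f) x)"
    if "f \<in> W11_fun" for f :: "real^'b::finite \<Rightarrow> real"
  proof -
    have "f \<in> W11_class f" using that by (simp add: W11_class_def W11_eq_def)
    then have "(SOME r. r \<in> W11_class f) \<in> W11_class f" by (rule someI[of "\<lambda>r. r \<in> W11_class f"])
    moreover have "r \<in> W11_fun \<and> (AE x in lebesgue. f x = r x)" if "r \<in> W11_class f" for r
      using that by (simp add: W11_class_def W11_eq_def)
    ultimately show ?thesis by blast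
  qed
  define r where "r = (SOME r. r \<in> W11_class f)"
  define r' where "r' = (SOME r. r \<in> W11_class f')"
  have r: "r \<in> W11_fun" "AE x in lebesgue. f x = r x" using rep[OF f] by (auto simp: r_def)
  have r': "r' \<in> W11_fun" "AE x in lebesgue. f' x = r' x" using rep[OF f'] by (auto simp: r'_def)
  have [measurable]: "f \<in> borel_measurable lebesgue" "f' \<in> borel_measurable lebesgue"
    "r \<in> borel_measurable lebesgue" "r' \<in> borel_measurable lebesgue"
    using f f' r r' by (auto simp: W11_fun_def)
  have ae: "AE x in lebesgue. f x - f' x = r x - r' x" using r(2) r'(2) by eventually_elim simp
  then have "weak_gradient (\<lambda>x. r x - r' x) g" by (rule weak_gradient_cong_AE[OF _ _ _ g(2)]) auto
  then have "W11_norm (\<lambda>x. r x - r' x) = integral\<^sup>L lebesgue (\<lambda>x. \<bar>r x - r' x\<bar>) + integral\<^sup>L lebesgue (\<lambda>x. norm (g x))"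
    by (intro W11_norm_eq g)
  moreover have "integral\<^sup>L lebesgue (\<lambda>x. \<bar>r x - r' x\<bar>) = integral\<^sup>L lebesgue (\<lambda>x. \<bar>f x - f' x\<bar>)"
    using ae by (intro integral_cong_AE) auto
  ultimately show ?thesis by (simp add: W11_dist_def r_def r'_def)
qed

lemma mem_cube_iff: "x \<in> cbox (\<chi> j. - R) (\<chi> j. R) \<longleftrightarrow> (\<forall>j. \<bar>x $ j\<bar> \<le> R)"
  for x :: "real^'n::finite"
  by (auto simp: mem_box_cart abs_le_iff minus_le_iff) 

lemma integrable_bounded_support:
  fixes k :: "real^'n::finite \<Rightarrow> 'b::{banach, second_countable_topology}"
  assumes [measurable]: "k \<in> borel_measurable borel" and B: "\<And>x. norm (k x) \<le> B"
    and supp: "\<And>x i. R < \<bar>x $ i\<bar> \<Longrightarrow> k x = 0"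
  shows "integrable lborel k"
proof (rule Bochner_Integration.integrable_bound)
  let ?Q = "cbox (\<chi> j. - R) (\<chi> j. R) :: (real^'n) set"
  show "integrable lborel (\<lambda>x. B * indicator ?Q x)" 
    by (intro integrable_mult_right integrable_real_indicator emeasure_lborel_cbox_finite) auto
  show "AE x in lborel. norm (k x) \<le> norm (B * indicator ?Q x)"
  proof (intro AE_I2)
    fix x
    have "k x = 0" if "x \<notin> ?Q" using that supp by (auto simp: mem_cube_iff not_le)
    moreover have "0 \<le> B" using order_trans[OF norm_ge_zero B] by blast
    ultimately show "norm (k x) \<le> norm (B * indicator ?Q x)"
      using B[of x] by (cases "x \<in> ?Q") auto
  qed
qed simp

lemma integral_lborel_translate:
  fixes k :: "'a::euclidean_space \<Rightarrow> 'b::{banach, second_countable_topology}"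
  assumes [measurable]: "k \<in> borel_measurable borel"
  shows "integral\<^sup>L lborel (\<lambda>x. k (e + x)) = integral\<^sup>L lborel k"
proof -
  have "integral\<^sup>L lborel k = integral\<^sup>L (distr lborel borel ((+) e)) k" by (simp add: lborel_distr_plus)
  also have "\<dots> = integral\<^sup>L lborel (\<lambda>x. k (e + x))" by (rule integral_distr) auto
  finally show ?thesis by simp
qed

lemma norm_axis_real: "norm (axis i s :: real^'n::finite) = \<bar>s\<bar>"
proof -
  have "(axis i s :: real^'n) = s *\<^sub>R axis i 1" by (auto simp: vec_eq_iff axis_def)
  then show ?thesis by (simp add: norm_axis_1)
qed

lemma test_function_difference_quotient:
  fixes \<phi> :: "real^'n::finite \<Rightarrow> real"
  assumes \<phi>: "\<phi> \<in> test_functions"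
  shows "(\<lambda>m. real (Suc m) * (\<phi> (x - axis i (1 / real (Suc m))) - \<phi> x)) \<longlonglongrightarrow> - partial_deriv i \<phi> x"
    and "(\<And>y. \<bar>partial_deriv i \<phi> y\<bar> \<le> B) \<Longrightarrow> \<bar>real (Suc m) * (\<phi> (x - axis i (1 / real (Suc m))) - \<phi> x)\<bar> \<le> B"
proof -
  define h where "h t = \<phi> (x - axis i t)" for t
  have deriv: "(h has_real_derivative - partial_deriv i \<phi> (x - axis i t)) (at t)" for t
  proof -
    have lin: "bounded_linear (\<lambda>t. axis i t :: real^'n)"
      unfolding linear_conv_bounded_linear[symmetric] by (rule linearI) (auto simp: vec_eq_iff axis_def)
    have "((\<lambda>t. x - axis i t) has_derivative (\<lambda>s. - axis i s)) (at t)"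
      by (auto intro!: derivative_eq_intros bounded_linear.has_derivative[OF lin])
    from has_derivative_compose[OF this test_function_derivative(1)[OF \<phi>]]
    have "(h has_derivative (\<lambda>s. frechet_derivative \<phi> (at (x - axis i t)) (- axis i s))) (at t)"
      unfolding h_def .
    moreover have "frechet_derivative \<phi> (at (x - axis i t)) (- axis i s) = - partial_deriv i \<phi> (x - axis i t) * s" for s
    proof -
      have "axis i s = s *\<^sub>R (axis i 1 :: real^'n)" by (auto simp: vec_eq_iff axis_def)
      moreover have "linear (frechet_derivative \<phi> (at (x - axis i t)))"
        using has_derivative_linear[OF test_function_derivative(1)[OF \<phi>]] .
      ultimately show ?thesis by (simp add: linear_neg linear_scale partial_deriv_def)
    qed
    then have "(\<lambda>s. frechet_derivative \<phi> (at (x - axis i t)) (- axis i s)) = (*) (- partial_deriv i \<phi> (x - axis i t))"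
      by (simp add: fun_eq_iff)
    ultimately show ?thesis unfolding has_field_derivative_def by metis
  qed
  have "((\<lambda>s. (h s - h 0) / s) \<longlongrightarrow> - partial_deriv i \<phi> x) (at 0)"
    using deriv[of 0] by (simp add: has_field_derivative_iff axis_def vec_eq_iff zero_vec_def[symmetric])
  moreover have "filterlim (\<lambda>m. inverse (real (Suc m))) (at 0) sequentially"
    by (intro filterlim_atI LIMSEQ_inverse_real_of_nat) auto
  ultimately have "(\<lambda>m. (h (inverse (real (Suc m))) - h 0) / inverse (real (Suc m))) \<longlonglongrightarrow> - partial_deriv i \<phi> x"
    by (rule filterlim_compose)
  moreover have "h 0 = \<phi> x" by (simp add: h_def axis_def zero_vec_def[symmetric])
  ultimately show "(\<lambda>m. real (Suc m) * (\<phi> (x - axis i (1 / real (Suc m))) - \<phi> x)) \<longlonglongrightarrow> - partial_deriv i \<phi> x"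
    by (simp add: h_def inverse_eq_divide mult.commute del: of_nat_Suc)
  assume B: "\<And>y. \<bar>partial_deriv i \<phi> y\<bar> \<le> B"
  have "\<exists>z>0. z < 1 / real (Suc m) \<and> h (1 / real (Suc m)) - h 0 = (1 / real (Suc m) - 0) * (- partial_deriv i \<phi> (x - axis i z))"
    by (intro MVT2 deriv) auto
  then obtain z where "h (1 / real (Suc m)) - h 0 = (1 / real (Suc m)) * (- partial_deriv i \<phi> (x - axis i z))" by auto
  then have "real (Suc m) * (h (1 / real (Suc m)) - h 0) = - partial_deriv i \<phi> (x - axis i z)"
    by (simp del: of_nat_Suc)
  then show "\<bar>real (Suc m) * (\<phi> (x - axis i (1 / real (Suc m))) - \<phi> x)\<bar> \<le> B"
    using B[of "x - axis i z"] \<open>h 0 = \<phi> x\<close> by (simp add: h_def del: of_nat_Suc)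
qed

text \<open>
  A discrete integration by parts: translation invariance moves the difference quotient from \<open>f\<close> to the test
  function, and dominated convergence applies on both sides, because all quotients are bounded by Lipschitz
  constants and live in a fixed cube.
\<close>

lemma lipschitz_weak_gradient:
  fixes f :: "real^'n::finite \<Rightarrow> real" and g :: "real^'n \<Rightarrow> real^'n"
  assumes lip: "C-lipschitz_on UNIV f" and supp: "\<And>x i. R < \<bar>x $ i\<bar> \<Longrightarrow> f x = 0"
    and lim: "\<And>x i. (\<lambda>m. real (Suc m) * (f (x + axis i (1 / real (Suc m))) - f x)) \<longlonglongrightarrow> g x $ i"
  shows "f \<in> borel_measurable borel" "g \<in> borel_measurable borel"
    and "integrable lborel f" "integrable lborel g" "\<And>x i. R < \<bar>x $ i\<bar> \<Longrightarrow> g x = 0"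
    and "weak_gradient f g" "f \<in> W11_fun"
proof -
  have C: "C \<ge> 0" using lip lipschitz_on_nonneg by blast
  have f_cont: "continuous_on UNIV f" using lip by (rule lipschitz_on_continuous_on)
  then show f_borel [measurable]: "f \<in> borel_measurable borel" by (rule borel_measurable_continuous_onI)
  define u where "u i m x = real (Suc m) * (f (x + axis i (1 / real (Suc m))) - f x)" for i m x
  have u_borel [measurable]: "u i m \<in> borel_measurable borel" for i m unfolding u_def by measurable
  have u_lim: "(\<lambda>m. u i m x) \<longlonglongrightarrow> g x $ i" for i x using lim by (simp add: u_def)
  have u_le: "\<bar>u i m x\<bar> \<le> C" for i m x
  proof -
    have "\<bar>f (x + axis i (1 / real (Suc m))) - f x\<bar> \<le> C * (1 / real (Suc m))"
      using lipschitz_onD[OF lip, of "x + axis i (1 / real (Suc m))" x]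
      by (simp add: dist_norm norm_axis_real del: of_nat_Suc)
    then have "real (Suc m) * \<bar>f (x + axis i (1 / real (Suc m))) - f x\<bar> \<le> real (Suc m) * (C * (1 / real (Suc m)))"
      by (intro mult_left_mono) auto
    then show ?thesis by (simp add: u_def abs_mult del: of_nat_Suc)
  qed
  have g_comp [measurable]: "(\<lambda>x. g x $ i) \<in> borel_measurable borel" for i
    using u_lim u_borel by (rule borel_measurable_LIMSEQ_real)
  have "(\<lambda>x. \<Sum>i\<in>UNIV. g x $ i *\<^sub>R (axis i 1 :: real^'n)) \<in> borel_measurable borel"
    by (intro borel_measurable_sum borel_measurable_scaleR g_comp borel_measurable_const)
  moreover have "(\<lambda>x. \<Sum>i\<in>UNIV. g x $ i *\<^sub>R (axis i 1 :: real^'n)) = g"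
    using basis_expansion[of "g _"] by (simp add: scalar_mult_eq_scaleR)
  ultimately show g_borel [measurable]: "g \<in> borel_measurable borel" by simp
  have g_le: "\<bar>g x $ i\<bar> \<le> C" for x i
    using tendsto_rabs[OF u_lim] by (rule tendsto_upperbound) (auto simp: u_le)
  have norm_g: "norm (g x) \<le> real CARD('n) * C" for x
    using norm_le_l1_cart[of "g x"] sum_bounded_above[of UNIV "\<lambda>i. \<bar>g x $ i\<bar>" C] g_le by simp
  show g_supp: "g x = 0" if "R < \<bar>x $ j\<bar>" for x j
  proof -
    have "g x $ i = 0" for i
    proof -
      have "(\<lambda>m. \<bar>x $ j + (if j = i then inverse (real (Suc m)) else 0)\<bar>) \<longlonglongrightarrow> \<bar>x $ j + (if j = i then 0 else 0)\<bar>"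
        using LIMSEQ_inverse_real_of_nat by (intro tendsto_intros) (cases "j = i"; simp del: of_nat_Suc)
      then have "(\<lambda>m. \<bar>(x + axis i (1 / real (Suc m))) $ j\<bar>) \<longlonglongrightarrow> \<bar>x $ j\<bar>"
        by (simp add: axis_def inverse_eq_divide del: of_nat_Suc cong: if_cong)
      then have "\<forall>\<^sub>F m in sequentially. R < \<bar>(x + axis i (1 / real (Suc m))) $ j\<bar>"
        by (rule order_tendstoD) (use that in \<open>simp add: axis_def\<close>)
      then have "\<forall>\<^sub>F m in sequentially. u i m x = 0"
        by eventually_elim (use that supp in \<open>simp add: u_def del: of_nat_Suc\<close>)
      then have "(\<lambda>m. u i m x) \<longlonglongrightarrow> 0" by (rule tendsto_eventually)
      then show ?thesis using u_lim LIMSEQ_unique by blast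
    qed
    then show ?thesis by (simp add: vec_eq_iff)
  qed
  have "\<exists>B. \<forall>x. \<bar>f x\<bar> \<le> B"
  proof -
    have "bounded (f ` cbox (\<chi> j. - R) (\<chi> j. R))"
      by (intro compact_imp_bounded compact_continuous_image continuous_on_subset[OF f_cont]) auto
    then obtain B where B: "\<And>x. x \<in> cbox (\<chi> j. - R) (\<chi> j. R) \<Longrightarrow> \<bar>f x\<bar> \<le> B"
      unfolding bounded_iff by (metis image_eqI real_norm_def)
    have "\<bar>f x\<bar> \<le> max B 0" for x
      using B[of x] supp[of x] by (cases "x \<in> cbox (\<chi> j. - R) (\<chi> j. R)") (auto simp: mem_cube_iff not_le)
    then show ?thesis by blast
  qed
  then obtain Bf where Bf: "\<And>x. \<bar>f x\<bar> \<le> Bf" by blast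
  show f_int: "integrable lborel f" by (rule integrable_bounded_support[OF f_borel, of Bf R]) (use Bf supp in auto)
  show g_int: "integrable lborel g" by (rule integrable_bounded_support[OF g_borel norm_g g_supp])
  show wg: "weak_gradient f g"
    unfolding weak_gradient_def
  proof (intro ballI allI)
    fix \<phi> :: "real^'n \<Rightarrow> real" and i assume \<phi>: "\<phi> \<in> test_functions"
    note [measurable] = test_function_borel[OF \<phi>]
    obtain B where B: "B \<ge> 0" "\<And>x. \<bar>\<phi> x\<bar> \<le> B" "\<And>x. \<bar>partial_deriv i \<phi> x\<bar> \<le> B"
      using test_function_bounded[OF \<phi>] by metis
    let ?Q = "cbox (\<chi> j. - (R + 1)) (\<chi> j. R + 1) :: (real^'n) set"
    have int_Q: "integrable lborel (\<lambda>x. c * indicator ?Q x)" for c :: real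
      by (intro integrable_mult_right integrable_real_indicator emeasure_lborel_cbox_finite) auto
    have u_supp: "u i m x = 0" if "x \<notin> ?Q" for m x
    proof -
      obtain j where j: "R + 1 < \<bar>x $ j\<bar>" using \<open>x \<notin> ?Q\<close> unfolding mem_cube_iff by (auto simp: not_le)
      have "\<bar>axis i (1 / real (Suc m)) $ j\<bar> \<le> 1" by (auto simp: axis_def)
      then have "R < \<bar>(x + axis i (1 / real (Suc m))) $ j\<bar>" using j by (simp del: of_nat_Suc)
      then show ?thesis using j supp[of x j] supp by (simp add: u_def del: of_nat_Suc)
    qed
    have "(\<lambda>m. LINT x|lborel. u i m x * \<phi> x) \<longlonglongrightarrow> (LINT x|lborel. g x $ i * \<phi> x)"
    proof (rule integral_dominated_convergence[where w="\<lambda>x. (C * B) * indicator ?Q x"])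
      show "AE x in lborel. norm (u i m x * \<phi> x) \<le> C * B * indicat_real ?Q x" for m
      proof (intro AE_I2)
        show "norm (u i m x * \<phi> x) \<le> C * B * indicat_real ?Q x" for x
          using mult_mono[OF u_le[of i m x] B(2)[of x]] C u_supp[of x m]
          by (cases "x \<in> ?Q") (auto simp: abs_mult)
      qed
    qed (use int_Q in \<open>auto intro!: tendsto_intros u_lim\<close>)
    moreover have "(LINT x|lborel. u i m x * \<phi> x) =
        (LINT x|lborel. f x * (real (Suc m) * (\<phi> (x - axis i (1 / real (Suc m))) - \<phi> x)))" for m
    proof -
      define e where "e = (axis i (1 / real (Suc m)) :: real^'n)"
      have int: "integrable lborel (\<lambda>x. f x * \<phi> (x - e'))" for e'
      proof (rule integrable_bounded_support[where B="Bf * B" and R=R])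
        show "norm (f x * \<phi> (x - e')) \<le> Bf * B" for x
          using mult_mono[OF Bf[of x] B(2)[of "x - e'"]] order_trans[OF abs_ge_zero Bf[of x]] by (simp add: abs_mult)
      qed (use supp in auto)
      have shift: "(LINT x|lborel. f (x + e) * \<phi> x) = (LINT x|lborel. f x * \<phi> (x - e))"
        using integral_lborel_translate[of "\<lambda>x. f x * \<phi> (x - e)" e] by (simp add: add.commute)
      have "integrable lborel (\<lambda>x. f (x + e) * \<phi> x)"
      proof (rule integrable_bounded_support[where B="Bf * B" and R="R + norm e"])
        show "norm (f (x + e) * \<phi> x) \<le> Bf * B" for x
          using mult_mono[OF Bf[of "x + e"] B(2)[of x]] order_trans[OF abs_ge_zero Bf[of x]] by (simp add: abs_mult)
        show "f (x + e) * \<phi> x = 0" if "R + norm e < \<bar>x $ j\<bar>" for x j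
          using component_le_norm_cart[of e j] that supp[of "x + e" j] by auto
      qed auto
      then have "(LINT x|lborel. u i m x * \<phi> x) = real (Suc m) * ((LINT x|lborel. f (x + e) * \<phi> x) - (LINT x|lborel. f x * \<phi> x))"
        using int[of 0] by (simp add: u_def e_def[symmetric] left_diff_distrib mult.assoc del: of_nat_Suc)
      also have "\<dots> = (LINT x|lborel. real (Suc m) * (f x * \<phi> (x - e) - f x * \<phi> x))"
        using int[of 0] int[of e] by (simp add: shift del: of_nat_Suc)
      finally show ?thesis unfolding e_def by (simp add: algebra_simps del: of_nat_Suc)
    qed
    moreover have "(\<lambda>m. LINT x|lborel. f x * (real (Suc m) * (\<phi> (x - axis i (1 / real (Suc m))) - \<phi> x)))
        \<longlonglongrightarrow> (LINT x|lborel. f x * (- partial_deriv i \<phi> x))"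
    proof (rule integral_dominated_convergence[where w="\<lambda>x. \<bar>f x\<bar> * B"])
      show "AE x in lborel. (\<lambda>m. f x * (real (Suc m) * (\<phi> (x - axis i (1 / real (Suc m))) - \<phi> x)))
          \<longlonglongrightarrow> f x * (- partial_deriv i \<phi> x)"
        by (intro AE_I2 tendsto_intros test_function_difference_quotient(1) \<phi>)
      show "AE x in lborel. norm (f x * (real (Suc m) * (\<phi> (x - axis i (1 / real (Suc m))) - \<phi> x))) \<le> \<bar>f x\<bar> * B" for m
        using test_function_difference_quotient(2)[OF \<phi> B(3)]
        by (intro AE_I2) (simp only: abs_mult real_norm_def mult_left_mono abs_ge_zero)
    qed (use f_int in auto)
    ultimately have "(LINT x|lborel. g x $ i * \<phi> x) = (LINT x|lborel. f x * (- partial_deriv i \<phi> x))"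
      using LIMSEQ_unique by simp
    then have "(LINT x|lborel. f x * partial_deriv i \<phi> x) = - (LINT x|lborel. g x $ i * \<phi> x)" by simp
    then show "(LINT x|lebesgue. f x * partial_deriv i \<phi> x) = - (LINT x|lebesgue. g x $ i * \<phi> x)"
      by (simp add: integral_completion)
  qed
  have "integrable lebesgue f" "integrable lebesgue g"
    using f_int g_int integrable_completion[of f lborel] integrable_completion[of g lborel] by auto
  then show "f \<in> W11_fun" using wg by (auto simp: W11_fun_def)
qed

section \<open>Semiconcave functions of one variable\<close>

text \<open>
  Equivalently, \<open>F x - K x\<^sup>2 / 2\<close> is concave. The form with a supporting parabola from above is the one that infima of
  smooth functions come with.
\<close>

definition semiconcave1 :: "real \<Rightarrow> (real \<Rightarrow> real) \<Rightarrow> bool" where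
  "semiconcave1 K F \<longleftrightarrow> (\<forall>x. \<exists>p. \<forall>s. F (x + s) \<le> F x + p * s + K * s\<^sup>2 / 2)"

lemma semiconcave1_second_difference:
  assumes "semiconcave1 K F"
  shows "F (b + h) - 2 * F b + F (b - h) \<le> K * h\<^sup>2"
proof -
  obtain p where p: "\<And>s. F (b + s) \<le> F b + p * s + K * s\<^sup>2 / 2"
    using assms unfolding semiconcave1_def by metis
  show ?thesis using p[of h] p[of "- h"] by simp
qed

text \<open>
  The supporting parabola at the intermediate point, evaluated at both ends of the chord; the linear
  terms cancel in the convex combination.
\<close>

lemma semiconcave1_above_chord:
  assumes "semiconcave1 K F" and t: "0 \<le> t" "t \<le> 1"
  shows "(1 - t) * F b + t * F (b + h) - K * (t * (1 - t) * h\<^sup>2) / 2 \<le> F (b + t * h)"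
proof -
  obtain p where p: "\<And>s. F ((b + t * h) + s) \<le> F (b + t * h) + p * s + K * s\<^sup>2 / 2"
    using assms(1) unfolding semiconcave1_def by metis
  have "(1 - t) * F b \<le> (1 - t) * (F (b + t * h) + p * (- t * h) + K * (- t * h)\<^sup>2 / 2)"
    using p[of "- t * h"] t by (intro mult_left_mono) auto
  moreover have "t * F (b + h) \<le> t * (F (b + t * h) + p * ((1 - t) * h) + K * ((1 - t) * h)\<^sup>2 / 2)"
    using p[of "(1 - t) * h"] t by (intro mult_left_mono) (auto simp: algebra_simps)
  ultimately have "(1 - t) * F b + t * F (b + h) \<le> (1 - t) * (F (b + t * h) + p * (- t * h) + K * (- t * h)\<^sup>2 / 2)
     + t * (F (b + t * h) + p * ((1 - t) * h) + K * ((1 - t) * h)\<^sup>2 / 2)" by linarith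
  also have "\<dots> = F (b + t * h) + K * (t * (1 - t) * h\<^sup>2) / 2"
    by (simp add: field_simps power2_eq_square)
  finally show ?thesis by simp
qed

lemma semiconcave1_below_extrapolation:
  assumes "semiconcave1 K F" and t: "0 \<le> t"
  shows "F (b + t * h) \<le> F b + t * (F b - F (b - h)) + K * (t * (t + 1) * h\<^sup>2) / 2"
proof -
  obtain p where p: "\<And>s. F (b + s) \<le> F b + p * s + K * s\<^sup>2 / 2"
    using assms(1) unfolding semiconcave1_def by metis
  have "t * F (b - h) \<le> t * (F b - p * h + K * h\<^sup>2 / 2)"
    using p[of "- h"] t by (intro mult_left_mono) auto
  then have "t * (p * h) \<le> t * (F b - F (b - h)) + t * K * h\<^sup>2 / 2" by (simp add: algebra_simps)
  moreover have "F (b + t * h) \<le> F b + t * (p * h) + K * (t * h)\<^sup>2 / 2" using p[of "t * h"] by (simp add: mult_ac)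
  ultimately show ?thesis by (simp add: field_simps power2_eq_square)
qed

text \<open>
  The error is measured by the defect of the second difference from its largest possible value \<open>K h\<^sup>2\<close>,
  because the sum of these defects over a line is known exactly (\<open>sum_curvature\<close>).
\<close>

lemma semiconcave1_interpolation_error:
  assumes F: "semiconcave1 K F" and t: "0 \<le> t" "t \<le> 1" and K: "K \<ge> 0"
  shows "\<bar>F (b + t * h) - ((1 - t) * F b + t * F (b + h))\<bar>
    \<le> (K * h\<^sup>2 - (F (b + h) - 2 * F b + F (b - h))) + K * h\<^sup>2 / 8"
proof -
  define s where "s = F (b + h) - 2 * F b + F (b - h)"
  have s: "s \<le> K * h\<^sup>2" unfolding s_def by (rule semiconcave1_second_difference[OF F])
  have "t * (1 - t) \<le> 1 / 4" using sum_squares_ge_zero[of "t - 1/2" 0] by (simp add: algebra_simps)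
  then have "K * h\<^sup>2 * (t * (1 - t)) \<le> K * h\<^sup>2 * (1 / 4)" using K by (intro mult_left_mono) auto
  then have low: "- (K * h\<^sup>2 / 8) \<le> F (b + t * h) - ((1 - t) * F b + t * F (b + h))"
    using semiconcave1_above_chord[OF F t, of b h] by (simp add: mult_ac)
  have "F (b + t * h) - ((1 - t) * F b + t * F (b + h)) \<le> - (t * s) + K * (t * (t + 1) * h\<^sup>2) / 2"
    using semiconcave1_below_extrapolation[OF F t(1), of b h] by (simp add: s_def algebra_simps)
  also have "K * (t * (t + 1) * h\<^sup>2) / 2 \<le> K * (t * 2 * h\<^sup>2) / 2"
    using t K by (intro divide_right_mono mult_left_mono mult_right_mono) auto
  finally have "F (b + t * h) - ((1 - t) * F b + t * F (b + h)) \<le> t * (K * h\<^sup>2 - s)" by (simp add: algebra_simps)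
  also have "\<dots> \<le> 1 * (K * h\<^sup>2 - s)" using t s by (intro mult_right_mono) auto
  finally have up: "F (b + t * h) - ((1 - t) * F b + t * F (b + h)) \<le> K * h\<^sup>2 - s" by simp
  have "0 \<le> K * h\<^sup>2" using K by simp
  then show ?thesis using low up s unfolding s_def[symmetric] by linarith
qed

text \<open>
  After subtracting \<open>K s / 2\<close>, the difference quotients increase as the step \<open>s\<close> decreases.
\<close>

lemma semiconcave1_right_derivative:
  assumes F: "semiconcave1 K F" and K: "K \<ge> 0"
  shows "\<exists>d. (\<lambda>m. real (Suc m) * (F (b + 1 / real (Suc m)) - F b)) \<longlonglongrightarrow> d"
proof -
  define r where "r m = 1 / real (Suc m)" for m
  have r: "0 < r m" "r (Suc m) \<le> r m" for m by (auto simp: r_def field_simps)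
  have r0: "r \<longlonglongrightarrow> 0" using LIMSEQ_inverse_real_of_nat unfolding r_def by (simp add: inverse_eq_divide)
  define q where "q m = (F (b + r m) - F b) / r m - K * r m / 2" for m
  obtain p where p: "\<And>s. F (b + s) \<le> F b + p * s + K * s\<^sup>2 / 2"
    using F unfolding semiconcave1_def by metis
  have "q m \<le> q (Suc m)" for m
  proof -
    define t where "t = r (Suc m) / r m"
    have t: "0 \<le> t" "t \<le> 1" "r (Suc m) = t * r m" "t > 0"
      using r[of m] r[of "Suc m"] by (auto simp: t_def divide_le_eq)
    have "t * (F (b + r m) - F b) - K * (t * (1 - t) * (r m)\<^sup>2) / 2 \<le> F (b + r (Suc m)) - F b"
      using semiconcave1_above_chord[OF F t(1,2), of b "r m"] by (simp add: t(3) algebra_simps)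
    then have "(t * (F (b + r m) - F b) - K * (t * (1 - t) * (r m)\<^sup>2) / 2) / r (Suc m) \<le> (F (b + r (Suc m)) - F b) / r (Suc m)"
      using r by (intro divide_right_mono) (auto intro: less_imp_le)
    also have "(t * (F (b + r m) - F b) - K * (t * (1 - t) * (r m)\<^sup>2) / 2) / r (Suc m)
        = (F (b + r m) - F b) / r m - K * (1 - t) * r m / 2"
      unfolding t(3) using t(4) r[of m] by (simp add: field_simps power2_eq_square)
    also have "K * (1 - t) * r m / 2 = K * r m / 2 - K * r (Suc m) / 2"
      unfolding t(3) by (simp add: field_simps)
    finally show ?thesis by (simp add: q_def)
  qed
  then have "incseq q" by (rule incseq_SucI)
  moreover have "q m \<le> p" for m
  proof -
    have "(F (b + r m) - F b) / r m \<le> (p * r m + K * (r m)\<^sup>2 / 2) / r m"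
      using p[of "r m"] r[of m] by (intro divide_right_mono) auto
    also have "\<dots> = p + K * r m / 2" using r[of m] by (simp add: field_simps power2_eq_square)
    finally show ?thesis by (simp add: q_def)
  qed
  ultimately obtain d where "q \<longlonglongrightarrow> d" using incseq_convergent[of q p] by blast
  then have "(\<lambda>m. q m + K * r m / 2) \<longlonglongrightarrow> d + K * 0 / 2" by (intro tendsto_intros r0) auto
  moreover have "q m + K * r m / 2 = real (Suc m) * (F (b + 1 / real (Suc m)) - F b)" for m
    by (simp add: q_def r_def del: of_nat_Suc)
  ultimately show ?thesis by auto
qed

lemma semiconcave1_derivative_bounds:
  assumes F: "semiconcave1 K F" and h: "h > 0"
    and d: "(\<lambda>m. real (Suc m) * (F (b + 1 / real (Suc m)) - F b)) \<longlonglongrightarrow> d"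
  shows "(F (b + h) - F b) / h - K * h / 2 \<le> d" and "d \<le> (F b - F (b - h)) / h + K * h / 2"
proof -
  define r where "r m = 1 / real (Suc m)" for m
  have r: "0 < r m" for m by (auto simp: r_def)
  have r0: "r \<longlonglongrightarrow> 0" using LIMSEQ_inverse_real_of_nat unfolding r_def by (simp add: inverse_eq_divide)
  have d': "(\<lambda>m. (F (b + r m) - F b) / r m) \<longlonglongrightarrow> d"
    using d by (simp add: r_def mult.commute del: of_nat_Suc)
  have "\<forall>\<^sub>F m in sequentially. (F (b + h) - F b) / h - K * (h - r m) / 2 \<le> (F (b + r m) - F b) / r m"
    using order_tendstoD(2)[OF r0 h]
  proof eventually_elim
    case (elim m)
    define t where "t = r m / h"
    have t: "0 \<le> t" "t \<le> 1" "r m = t * h" "t > 0"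
      using r[of m] elim h by (auto simp: t_def)
    have "t * (F (b + h) - F b) - K * (t * (1 - t) * h\<^sup>2) / 2 \<le> F (b + r m) - F b"
      using semiconcave1_above_chord[OF F t(1,2), of b h] by (simp add: t(3) algebra_simps)
    then have "(t * (F (b + h) - F b) - K * (t * (1 - t) * h\<^sup>2) / 2) / r m \<le> (F (b + r m) - F b) / r m"
      using r[of m] by (intro divide_right_mono) auto
    also have "(t * (F (b + h) - F b) - K * (t * (1 - t) * h\<^sup>2) / 2) / r m = (F (b + h) - F b) / h - K * (h - r m) / 2"
      unfolding t(3) using t(4) h by (simp add: field_simps power2_eq_square)
    finally show ?case .
  qed
  moreover have "(\<lambda>m. (F (b + h) - F b) / h - K * (h - r m) / 2) \<longlonglongrightarrow> (F (b + h) - F b) / h - K * (h - 0) / 2"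
    by (intro tendsto_intros r0) auto
  ultimately show "(F (b + h) - F b) / h - K * h / 2 \<le> d"
    using tendsto_le[OF _ d'] by fastforce
  obtain p where p: "\<And>s. F (b + s) \<le> F b + p * s + K * s\<^sup>2 / 2"
    using F unfolding semiconcave1_def by metis
  have "(F (b + r m) - F b) / r m \<le> p + K * r m / 2" for m
  proof -
    have "(F (b + r m) - F b) / r m \<le> (p * r m + K * (r m)\<^sup>2 / 2) / r m"
      using p[of "r m"] r[of m] by (intro divide_right_mono) auto
    also have "\<dots> = p + K * r m / 2" using r[of m] by (simp add: field_simps power2_eq_square)
    finally show ?thesis .
  qed
  moreover have "(\<lambda>m. p + K * r m / 2) \<longlonglongrightarrow> p + K * 0 / 2" by (intro tendsto_intros r0) auto
  ultimately have "d \<le> p" using tendsto_le[OF _ _ d'] by (metis (no_types, lifting) add.right_neutral always_eventually div_0 mult_zero_right trivial_limit_sequentially)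
  also have "p \<le> (F b - F (b - h)) / h + K * h / 2"
    using p[of "- h"] h by (simp add: field_simps power2_eq_square)
  finally show "d \<le> (F b - F (b - h)) / h + K * h / 2" .
qed

lemma sum_telescope_int:
  fixes A :: "int \<Rightarrow> 'a::ab_group_add"
  assumes "a \<le> b + 1"
  shows "(\<Sum>k\<in>{a..b}. A (k + 1) - A k) = A (b + 1) - A a"
proof -
  have "a - 1 \<le> b" using assms by simp
  then show ?thesis
  proof (induction b rule: int_ge_induct)
    case base
    then show ?case by simp
  next
    case (step b)
    then have "{a..b + 1} = insert (b + 1) {a..b}" by auto
    then show ?case using step by simp
  qed
qed

lemma sum_shift_int:
  fixes A :: "int \<Rightarrow> 'a::ab_group_add"
  assumes "\<And>k. int m \<le> \<bar>k\<bar> \<Longrightarrow> A k = 0"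
  shows "(\<Sum>k\<in>{- int m..int m}. A (k + 1)) = (\<Sum>k\<in>{- int m..int m}. A k)"
  using sum_telescope_int[of "- int m" "int m" A] assms[of "int m + 1"] assms[of "- int m"]
  by (simp add: sum_subtractf)

lemma sum_second_difference_int:
  fixes A :: "int \<Rightarrow> 'a::comm_ring_1"
  assumes A: "\<And>k. int m \<le> \<bar>k\<bar> \<Longrightarrow> A k = 0"
  shows "(\<Sum>k\<in>{- int m..int m}. A (k + 1) - 2 * A k + A (k - 1)) = 0"
proof -
  have "(\<Sum>k\<in>{- int m..int m}. A (k + 1) - 2 * A k + A (k - 1)) =
      (\<Sum>k\<in>{- int m..int m}. (A (k + 1) - A (k + 1 - 1)) - (A k - A (k - 1)))"
    by (intro sum.cong) (auto simp: algebra_simps)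
  also have "\<dots> = (A (int m + 1) - A (int m)) - (A (- int m) - A (- int m - 1))"
    by (subst sum_telescope_int[of _ _ "\<lambda>k. A k - A (k - 1)"]) auto
  finally show ?thesis using A by simp
qed

context
  fixes F :: "real \<Rightarrow> real" and K h :: real and m :: nat
  assumes F: "semiconcave1 K F" and K: "K \<ge> 0" and h: "h > 0"
    and zero: "\<And>k::int. int m \<le> \<bar>k\<bar> \<Longrightarrow> F (of_int k * h) = 0"
begin

text \<open>
  The second differences of a sequence with finite support add up to \<open>0\<close>. Thus an upper bound for them bounds
  the sum of their absolute values as well.
\<close>

lemma sum_curvature:
  "(\<Sum>k\<in>{- int m..int m}. K * h\<^sup>2 - (F (of_int k * h + h) - 2 * F (of_int k * h) + F (of_int k * h - h)))
    = real (2 * m + 1) * (K * h\<^sup>2)"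
proof -
  have "(\<Sum>k\<in>{- int m..int m}. F (of_int k * h + h) - 2 * F (of_int k * h) + F (of_int k * h - h)) = 0"
    using sum_second_difference_int[of m "\<lambda>k. F (of_int k * h)"] zero by (simp add: algebra_simps)
  then show ?thesis by (simp add: sum_subtractf)
qed

lemma sum_interpolation_error:
  assumes "0 \<le> t" "t \<le> 1"
  shows "(\<Sum>k\<in>{- int m..int m}. \<bar>F (of_int k * h + t * h) - ((1 - t) * F (of_int k * h) + t * F (of_int k * h + h))\<bar>)
    \<le> real (2 * m + 1) * (9 / 8 * K * h\<^sup>2)"
proof -
  have "(\<Sum>k\<in>{- int m..int m}. \<bar>F (of_int k * h + t * h) - ((1 - t) * F (of_int k * h) + t * F (of_int k * h + h))\<bar>)
    \<le> (\<Sum>k\<in>{- int m..int m}. (K * h\<^sup>2 - (F (of_int k * h + h) - 2 * F (of_int k * h) + F (of_int k * h - h))) + K * h\<^sup>2 / 8)"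
    by (intro sum_mono semiconcave1_interpolation_error F assms K)
  also have "\<dots> = real (2 * m + 1) * (K * h\<^sup>2) + real (2 * m + 1) * (K * h\<^sup>2 / 8)"
    unfolding sum.distrib sum_curvature by simp
  also have "\<dots> = real (2 * m + 1) * (9 / 8 * K * h\<^sup>2)" by (simp add: field_simps)
  finally show ?thesis .
qed

lemma sum_derivative_error:
  assumes d: "\<And>k. (\<lambda>j. real (Suc j) * (F (of_int k * h + 1 / real (Suc j)) - F (of_int k * h))) \<longlonglongrightarrow> d k"
  shows "(\<Sum>k\<in>{- int m..int m}. \<bar>d k - (F (of_int k * h + h) - F (of_int k * h)) / h\<bar>)
    \<le> real (2 * m + 1) * (3 / 2 * K * h)"
proof -
  have "\<bar>d k - (F (of_int k * h + h) - F (of_int k * h)) / h\<bar> \<le>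
      (K * h\<^sup>2 - (F (of_int k * h + h) - 2 * F (of_int k * h) + F (of_int k * h - h))) / h + K * h / 2" for k
  proof -
    define b where "b = of_int k * h"
    define s where "s = (K * h\<^sup>2 - (F (b + h) - 2 * F b + F (b - h))) / h"
    have s: "0 \<le> s" unfolding s_def using semiconcave1_second_difference[OF F, of b h] h by simp
    note bounds = semiconcave1_derivative_bounds[OF F h d[of k], folded b_def]
    have "(F b - F (b - h)) / h = (F (b + h) - F b) / h + s - K * h"
      using h by (simp add: s_def field_simps power2_eq_square)
    moreover have "0 \<le> K * h" using K h by simp
    ultimately show ?thesis unfolding b_def[symmetric] s_def[symmetric] using bounds s by linarith
  qed
  then have "(\<Sum>k\<in>{- int m..int m}. \<bar>d k - (F (of_int k * h + h) - F (of_int k * h)) / h\<bar>)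
    \<le> (\<Sum>k\<in>{- int m..int m}. (K * h\<^sup>2 - (F (of_int k * h + h) - 2 * F (of_int k * h) + F (of_int k * h - h))) / h + K * h / 2)"
    by (intro sum_mono)
  also have "\<dots> = real (2 * m + 1) * (K * h\<^sup>2) / h + real (2 * m + 1) * (K * h / 2)"
    unfolding sum.distrib sum_divide_distrib[symmetric] sum_curvature by simp
  also have "\<dots> = real (2 * m + 1) * (3 / 2 * K * h)" using h by (simp add: field_simps power2_eq_square)
  finally show ?thesis .
qed

end

text \<open>
  On the line, the values at shifted grid points are, up to interpolation errors, convex combinations of
  values at neighbouring grid points.
\<close>

lemma sum_abs_difference_shifted:
  assumes F: "semiconcave1 K F" "semiconcave1 K F'" and K: "K \<ge> 0" and h: "h > 0"
    and zero: "\<And>k::int. int m \<le> \<bar>k\<bar> \<Longrightarrow> F (of_int k * h) = 0" "\<And>k::int. int m \<le> \<bar>k\<bar> \<Longrightarrow> F' (of_int k * h) = 0"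
    and y: "0 \<le> y" "y \<le> h"
  shows "(\<Sum>k\<in>{- int m..int m}. \<bar>F (of_int k * h + y) - F' (of_int k * h + y)\<bar>)
    \<le> (\<Sum>k\<in>{- int m..int m}. \<bar>F (of_int k * h) - F' (of_int k * h)\<bar>) + real (2 * m + 1) * (9 / 4 * K * h\<^sup>2)"
proof -
  define t where "t = y / h"
  have t: "0 \<le> t" "t \<le> 1" "y = t * h" using y h by (auto simp: t_def)
  define D where "D k = \<bar>F (of_int k * h) - F' (of_int k * h)\<bar>" for k :: int
  define E where "E F k = \<bar>F (of_int k * h + t * h) - ((1 - t) * F (of_int k * h) + t * F (of_int k * h + h))\<bar>"
    for F :: "real \<Rightarrow> real" and k :: int
  have "\<bar>F (of_int k * h + y) - F' (of_int k * h + y)\<bar> \<le> (1 - t) * D k + t * D (k + 1) + E F k + E F' k" for k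
  proof -
    have k: "of_int (k + 1) * h = of_int k * h + h" by (simp add: algebra_simps)
    define a where "a = F (of_int k * h) - F' (of_int k * h)"
    define c where "c = F (of_int k * h + h) - F' (of_int k * h + h)"
    have "\<bar>(1 - t) * a + t * c\<bar> \<le> (1 - t) * \<bar>a\<bar> + t * \<bar>c\<bar>"
      using t by (intro order_trans[OF abs_triangle_ineq]) (simp add: abs_mult)
    moreover have "(1 - t) * a + t * c = ((1 - t) * F (of_int k * h) + t * F (of_int k * h + h))
        - ((1 - t) * F' (of_int k * h) + t * F' (of_int k * h + h))"
      by (simp add: a_def c_def algebra_simps)
    ultimately show ?thesis unfolding D_def k E_def t(3) a_def c_def by linarith
  qed
  then have "(\<Sum>k\<in>{- int m..int m}. \<bar>F (of_int k * h + y) - F' (of_int k * h + y)\<bar>)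
    \<le> (\<Sum>k\<in>{- int m..int m}. (1 - t) * D k + t * D (k + 1) + E F k + E F' k)" by (intro sum_mono)
  also have "\<dots> = (1 - t) * (\<Sum>k\<in>{- int m..int m}. D k) + t * (\<Sum>k\<in>{- int m..int m}. D (k + 1))
      + (\<Sum>k\<in>{- int m..int m}. E F k) + (\<Sum>k\<in>{- int m..int m}. E F' k)"
    by (simp add: sum.distrib sum_distrib_left)
  also have "(\<Sum>k\<in>{- int m..int m}. D (k + 1)) = (\<Sum>k\<in>{- int m..int m}. D k)"
    by (rule sum_shift_int) (simp add: D_def zero)
  also have "(\<Sum>k\<in>{- int m..int m}. E F k) \<le> real (2 * m + 1) * (9 / 8 * K * h\<^sup>2)"
    unfolding E_def by (intro sum_interpolation_error F K h zero t)
  also have "(\<Sum>k\<in>{- int m..int m}. E F' k) \<le> real (2 * m + 1) * (9 / 8 * K * h\<^sup>2)"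
    unfolding E_def by (intro sum_interpolation_error F K h zero t)
  finally have "(\<Sum>k\<in>{- int m..int m}. \<bar>F (of_int k * h + y) - F' (of_int k * h + y)\<bar>)
    \<le> (1 - t) * sum D {- int m..int m} + t * sum D {- int m..int m}
      + real (2 * m + 1) * (9 / 8 * K * h\<^sup>2) + real (2 * m + 1) * (9 / 8 * K * h\<^sup>2)" by simp
  also have "\<dots> = sum D {- int m..int m} + real (2 * m + 1) * (9 / 4 * K * h\<^sup>2)"
    by (simp add: field_simps)
  finally show ?thesis by (simp add: D_def)
qed

text \<open>
  Derivatives are compared with forward difference quotients. The factor \<open>1 / h\<close> is the price of differentiation;
  it turns an error of order \<open>h\<^sup>2\<close> per grid point into one of order \<open>h\<close>.
\<close>

lemma sum_abs_derivative_difference: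
  assumes F: "semiconcave1 K F" "semiconcave1 K F'" and K: "K \<ge> 0" and h: "h > 0"
    and zero: "\<And>k::int. int m \<le> \<bar>k\<bar> \<Longrightarrow> F (of_int k * h) = 0" "\<And>k::int. int m \<le> \<bar>k\<bar> \<Longrightarrow> F' (of_int k * h) = 0"
    and d: "\<And>k. (\<lambda>j. real (Suc j) * (F (of_int k * h + 1 / real (Suc j)) - F (of_int k * h))) \<longlonglongrightarrow> d k"
      "\<And>k. (\<lambda>j. real (Suc j) * (F' (of_int k * h + 1 / real (Suc j)) - F' (of_int k * h))) \<longlonglongrightarrow> d' k"
  shows "(\<Sum>k\<in>{- int m..int m}. \<bar>d k - d' k\<bar>)
    \<le> 2 / h * (\<Sum>k\<in>{- int m..int m}. \<bar>F (of_int k * h) - F' (of_int k * h)\<bar>) + real (2 * m + 1) * (3 * K * h)"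
proof -
  define D where "D k = \<bar>F (of_int k * h) - F' (of_int k * h)\<bar>" for k :: int
  define E where "E F d k = \<bar>d k - (F (of_int k * h + h) - F (of_int k * h)) / h\<bar>"
    for F :: "real \<Rightarrow> real" and d :: "int \<Rightarrow> real" and k :: int
  have "\<bar>d k - d' k\<bar> \<le> (D (k + 1) + D k) / h + E F d k + E F' d' k" for k
  proof -
    have k: "of_int (k + 1) * h = of_int k * h + h" by (simp add: algebra_simps)
    define a where "a = F (of_int k * h) - F' (of_int k * h)"
    define c where "c = F (of_int k * h + h) - F' (of_int k * h + h)"
    have "\<bar>(c - a) / h\<bar> \<le> (\<bar>c\<bar> + \<bar>a\<bar>) / h"
      using h by (simp add: divide_right_mono)
    moreover have "(c - a) / h = (F (of_int k * h + h) - F (of_int k * h)) / h - (F' (of_int k * h + h) - F' (of_int k * h)) / h"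
      by (simp add: a_def c_def diff_divide_distrib)
    ultimately show ?thesis unfolding D_def k E_def a_def c_def by linarith
  qed
  then have "(\<Sum>k\<in>{- int m..int m}. \<bar>d k - d' k\<bar>)
    \<le> (\<Sum>k\<in>{- int m..int m}. (D (k + 1) + D k) / h + E F d k + E F' d' k)" by (intro sum_mono)
  also have "\<dots> = ((\<Sum>k\<in>{- int m..int m}. D (k + 1)) + (\<Sum>k\<in>{- int m..int m}. D k)) / h
      + (\<Sum>k\<in>{- int m..int m}. E F d k) + (\<Sum>k\<in>{- int m..int m}. E F' d' k)"
    unfolding sum.distrib sum_divide_distrib add_divide_distrib by simp
  also have "(\<Sum>k\<in>{- int m..int m}. D (k + 1)) = (\<Sum>k\<in>{- int m..int m}. D k)"
    by (rule sum_shift_int) (simp add: D_def zero)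
  also have "(\<Sum>k\<in>{- int m..int m}. E F d k) \<le> real (2 * m + 1) * (3 / 2 * K * h)"
    unfolding E_def by (intro sum_derivative_error F K h zero d)
  also have "(\<Sum>k\<in>{- int m..int m}. E F' d' k) \<le> real (2 * m + 1) * (3 / 2 * K * h)"
    unfolding E_def by (intro sum_derivative_error F K h zero d)
  finally have "(\<Sum>k\<in>{- int m..int m}. \<bar>d k - d' k\<bar>)
    \<le> (sum D {- int m..int m} + sum D {- int m..int m}) / h
      + real (2 * m + 1) * (3 / 2 * K * h) + real (2 * m + 1) * (3 / 2 * K * h)" by simp
  also have "\<dots> = 2 / h * sum D {- int m..int m} + real (2 * m + 1) * (3 * K * h)"
    using h by (simp add: field_simps)
  finally show ?thesis by (simp add: D_def)
qed

section \<open>Sums and integrals over grids\<close>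

definition grid :: "nat \<Rightarrow> ('n::finite \<Rightarrow> int) set" where
  "grid m = {z. \<forall>i. z i \<in> {- int m..int m}}"

definition grid_point :: "real \<Rightarrow> ('n::finite \<Rightarrow> int) \<Rightarrow> real^'n \<Rightarrow> real^'n" where
  "grid_point h z y = (\<chi> i. h * of_int (z i) + y $ i)"

lemma grid_eq_PiE: "grid m = PiE UNIV (\<lambda>_. {- int m..int m})"
  by (auto simp: grid_def PiE_def extensional_def)

lemma finite_grid [simp]: "finite (grid m :: ('n::finite \<Rightarrow> int) set)"
  unfolding grid_eq_PiE by (intro finite_PiE) auto

lemma card_grid: "card (grid m :: ('n::finite \<Rightarrow> int) set) = (2 * m + 1) ^ CARD('n)"
proof -
  have "card {- int m..int m} = 2 * m + 1" by simp
  then show ?thesis unfolding grid_eq_PiE by (subst card_PiE) auto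
qed

lemma grid_update: "z \<in> grid m \<Longrightarrow> k \<in> {- int m..int m} \<Longrightarrow> z(i := k) \<in> grid m"
  by (auto simp: grid_def)

text \<open>
  Summing over the lines through all grid points counts each grid point \<open>2 m + 1\<close> times, because
  \<open>(z, k) \<mapsto> (z(i := k), z i)\<close> is an involution. Estimates on lines thus become estimates on the grid.
\<close>

lemma sum_grid_lines:
  fixes g :: "('n::finite \<Rightarrow> int) \<Rightarrow> 'a::comm_semiring_1"
  shows "(\<Sum>z\<in>grid m. \<Sum>k\<in>{- int m..int m}. g (z(i := k))) = of_nat (2 * m + 1) * (\<Sum>z\<in>grid m. g z)"
proof -
  have "(\<Sum>z\<in>grid m. \<Sum>k\<in>{- int m..int m}. g (z(i := k))) =
      (\<Sum>(z, k)\<in>grid m \<times> {- int m..int m}. g (z(i := k)))"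
    by (rule sum.cartesian_product)
  also have "\<dots> = (\<Sum>(z, k)\<in>grid m \<times> {- int m..int m}. g z)"
    by (rule sum.reindex_bij_witness[of _ "\<lambda>(z, k). (z(i := k), z i)" "\<lambda>(z, k). (z(i := k), z i)"])
      (auto simp: grid_def)
  also have "\<dots> = (\<Sum>z\<in>grid m. \<Sum>k\<in>{- int m..int m}. g z)"
    by (rule sum.cartesian_product[symmetric])
  also have "\<dots> = of_nat (2 * m + 1) * (\<Sum>z\<in>grid m. g z)"
  proof -
    have "card {- int m..int m} = 2 * m + 1" by simp
    then show ?thesis by (simp only: sum_constant sum_distrib_left)
  qed
  finally show ?thesis .
qed

lemma sum_grid_le_if_lines_le:
  fixes g g' :: "('n::finite \<Rightarrow> int) \<Rightarrow> real"
  assumes "\<And>z. z \<in> grid m \<Longrightarrow> (\<Sum>k\<in>{- int m..int m}. g (z(i := k))) \<le>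
      a * (\<Sum>k\<in>{- int m..int m}. g' (z(i := k))) + real (2 * m + 1) * c"
  shows "(\<Sum>z\<in>grid m. g z) \<le> a * (\<Sum>z\<in>grid m. g' z) + real (2 * m + 1) ^ CARD('n) * c"
proof -
  let ?n = "real (2 * m + 1)"
  have "?n * (\<Sum>z\<in>grid m. g z) = (\<Sum>z\<in>grid m. \<Sum>k\<in>{- int m..int m}. g (z(i := k)))"
    by (simp add: sum_grid_lines)
  also have "\<dots> \<le> (\<Sum>z\<in>grid m. a * (\<Sum>k\<in>{- int m..int m}. g' (z(i := k))) + ?n * c)"
    by (intro sum_mono assms)
  also have "\<dots> = a * (\<Sum>z\<in>grid m. \<Sum>k\<in>{- int m..int m}. g' (z(i := k))) + real (card (grid m :: ('n \<Rightarrow> int) set)) * (?n * c)"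
    by (simp only: sum.distrib sum_distrib_left sum_constant)
  also have "\<dots> = ?n * (a * (\<Sum>z\<in>grid m. g' z) + ?n ^ CARD('n) * c)"
    by (simp only: sum_grid_lines card_grid of_nat_power of_nat_add of_nat_mult) (simp add: algebra_simps)
  finally show ?thesis by (simp add: mult_le_cancel_left_pos)
qed

lemma grid_point_update: "grid_point h (z(i := k)) y = grid_point h (z(i := 0)) y + axis i (of_int k * h)"
  by (auto simp: grid_point_def vec_eq_iff axis_def)

definition semiconcave_along :: "'n::finite \<Rightarrow> real \<Rightarrow> (real^'n \<Rightarrow> real) \<Rightarrow> bool" where
  "semiconcave_along i K f \<longleftrightarrow> (\<forall>x. semiconcave1 K (\<lambda>s. f (x + axis i s)))"

lemma axis_add: "axis i (s + t) = axis i s + (axis i t :: 'a::monoid_add^'n)"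
  by (auto simp: axis_def vec_eq_iff)

context
  fixes f f' :: "real^'n::finite \<Rightarrow> real" and K h l :: real and m :: nat
  assumes f: "\<And>i. semiconcave_along i K f" "\<And>i. semiconcave_along i K f'"
    and K: "K \<ge> 0" and h: "h > 0"
    and zero: "\<And>x i. l < \<bar>x $ i\<bar> \<Longrightarrow> f x = 0" "\<And>x i. l < \<bar>x $ i\<bar> \<Longrightarrow> f' x = 0"
    and m: "l + h < real m * h"
begin

lemma grid_line_zero:
  assumes y: "0 \<le> y $ i" "y $ i < h" and k: "int m \<le> \<bar>k\<bar>"
  shows "f (grid_point h (z(i := 0)) y + axis i (of_int k * h)) = 0"
    "f' (grid_point h (z(i := 0)) y + axis i (of_int k * h)) = 0"
proof -
  have "(grid_point h (z(i := 0)) y + axis i (of_int k * h)) $ i = h * of_int k + y $ i"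
    by (simp add: grid_point_def axis_def mult.commute)
  moreover have "l < \<bar>h * of_int k + y $ i\<bar>"
  proof -
    have "real m \<le> \<bar>of_int k\<bar>" using k by linarith
    then have "h * real m \<le> h * \<bar>of_int k\<bar>" using h by (intro mult_left_mono) auto
    also have "\<dots> = \<bar>h * of_int k\<bar>" using h by (simp add: abs_mult)
    finally show ?thesis using m y by (simp add: mult.commute)
  qed
  ultimately show "f (grid_point h (z(i := 0)) y + axis i (of_int k * h)) = 0"
    "f' (grid_point h (z(i := 0)) y + axis i (of_int k * h)) = 0"
    using zero by metis+
qed

text \<open>
  Passing from grid points to shifted grid points one coordinate at a time, each step being one-dimensional.
\<close>

lemma sum_grid_offset:
  assumes y: "\<And>i. 0 \<le> y $ i \<and> y $ i < h" and A: "finite A"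
  shows "(\<Sum>z\<in>grid m. \<bar>f (grid_point h z (\<chi> i. if i \<in> A then y $ i else 0)) - f' (grid_point h z (\<chi> i. if i \<in> A then y $ i else 0))\<bar>)
    \<le> (\<Sum>z\<in>grid m. \<bar>f (grid_point h z 0) - f' (grid_point h z 0)\<bar>)
      + real (2 * m + 1) ^ CARD('n) * (real (card A) * (9 / 4 * K * h\<^sup>2))"
  using A
proof induction
  case empty
  have "(\<chi> i. 0) = (0 :: real^'n)" by (simp add: vec_eq_iff)
  then show ?case by simp
next
  case (insert j A)
  define yA where "yA A = (\<chi> i. if i \<in> A then y $ i else 0)" for A
  have step: "grid_point h z (yA (insert j A)) = grid_point h z (yA A) + axis j (y $ j)" for z
    using insert by (auto simp: grid_point_def yA_def vec_eq_iff axis_def)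
  have "(\<Sum>z\<in>grid m. \<bar>f (grid_point h z (yA (insert j A))) - f' (grid_point h z (yA (insert j A)))\<bar>)
      \<le> 1 * (\<Sum>z\<in>grid m. \<bar>f (grid_point h z (yA A)) - f' (grid_point h z (yA A))\<bar>)
        + real (2 * m + 1) ^ CARD('n) * (9 / 4 * K * h\<^sup>2)"
  proof (rule sum_grid_le_if_lines_le[where i=j])
    fix z :: "'n \<Rightarrow> int"
    define b where "b = grid_point h (z(j := 0)) (yA A)"
    have upd: "grid_point h (z(j := k)) (yA A) = b + axis j (of_int k * h)" for k
      unfolding b_def by (rule grid_point_update)
    have yAj: "yA A $ j = 0" using insert by (simp add: yA_def)
    have "(\<Sum>k\<in>{- int m..int m}. \<bar>f (b + axis j (of_int k * h + y $ j)) - f' (b + axis j (of_int k * h + y $ j))\<bar>)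
      \<le> (\<Sum>k\<in>{- int m..int m}. \<bar>f (b + axis j (of_int k * h)) - f' (b + axis j (of_int k * h))\<bar>)
        + real (2 * m + 1) * (9 / 4 * K * h\<^sup>2)"
    proof (rule sum_abs_difference_shifted[OF _ _ K h, of "\<lambda>s. f (b + axis j s)" "\<lambda>s. f' (b + axis j s)"])
      show "semiconcave1 K (\<lambda>s. f (b + axis j s))" "semiconcave1 K (\<lambda>s. f' (b + axis j s))"
        using f by (auto simp: semiconcave_along_def)
      show "f (b + axis j (of_int k * h)) = 0" "f' (b + axis j (of_int k * h)) = 0" if "int m \<le> \<bar>k\<bar>" for k
        unfolding b_def using grid_line_zero[of "yA A" j k z] that yAj h by auto
    qed (use y[of j] in auto)
    then show "(\<Sum>k\<in>{- int m..int m}. \<bar>f (grid_point h (z(j := k)) (yA (insert j A))) - f' (grid_point h (z(j := k)) (yA (insert j A)))\<bar>)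
      \<le> 1 * (\<Sum>k\<in>{- int m..int m}. \<bar>f (grid_point h (z(j := k)) (yA A)) - f' (grid_point h (z(j := k)) (yA A))\<bar>)
        + real (2 * m + 1) * (9 / 4 * K * h\<^sup>2)"
      unfolding step upd add.assoc axis_add[symmetric] by simp
  qed
  moreover have "real (card (insert j A)) = real (card A) + 1" using insert by simp
  ultimately show ?case using insert.IH unfolding yA_def[symmetric] by (simp add: algebra_simps add_divide_distrib)
qed

lemma sum_grid_difference_le:
  assumes y: "\<And>i. 0 \<le> y $ i \<and> y $ i < h"
    and \<delta>: "\<And>z. z \<in> grid m \<Longrightarrow> \<bar>f (grid_point h z 0) - f' (grid_point h z 0)\<bar> \<le> \<delta>"
  shows "(\<Sum>z\<in>grid m. \<bar>f (grid_point h z y) - f' (grid_point h z y)\<bar>)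
    \<le> real (2 * m + 1) ^ CARD('n) * (\<delta> + real CARD('n) * (9 / 4 * K * h\<^sup>2))"
proof -
  have "(\<chi> i. if i \<in> UNIV then y $ i else 0) = y" by (simp add: vec_eq_iff)
  then have "(\<Sum>z\<in>grid m. \<bar>f (grid_point h z y) - f' (grid_point h z y)\<bar>)
    \<le> (\<Sum>z\<in>grid m. \<bar>f (grid_point h z 0) - f' (grid_point h z 0)\<bar>)
      + real (2 * m + 1) ^ CARD('n) * (real CARD('n) * (9 / 4 * K * h\<^sup>2))"
    using sum_grid_offset[of y UNIV] y by simp
  also have "(\<Sum>z\<in>grid m. \<bar>f (grid_point h z 0) - f' (grid_point h z 0)\<bar>) \<le> real (card (grid m :: ('n \<Rightarrow> int) set)) * \<delta>"
    using \<delta> by (rule sum_bounded_above)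
  finally show ?thesis by (simp only: card_grid of_nat_power) (simp add: algebra_simps)
qed

lemma sum_grid_derivative_le:
  assumes y: "\<And>i. 0 \<le> y $ i \<and> y $ i < h"
    and \<delta>: "\<And>z. z \<in> grid m \<Longrightarrow> \<bar>f (grid_point h z 0) - f' (grid_point h z 0)\<bar> \<le> \<delta>"
    and d: "\<And>x. (\<lambda>j. real (Suc j) * (f (x + axis i (1 / real (Suc j))) - f x)) \<longlonglongrightarrow> d x"
      "\<And>x. (\<lambda>j. real (Suc j) * (f' (x + axis i (1 / real (Suc j))) - f' x)) \<longlonglongrightarrow> d' x"
  shows "(\<Sum>z\<in>grid m. \<bar>d (grid_point h z y) - d' (grid_point h z y)\<bar>)
    \<le> real (2 * m + 1) ^ CARD('n) * (2 / h * (\<delta> + real CARD('n) * (9 / 4 * K * h\<^sup>2)) + 3 * K * h)"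
proof -
  have "(\<Sum>z\<in>grid m. \<bar>d (grid_point h z y) - d' (grid_point h z y)\<bar>)
      \<le> 2 / h * (\<Sum>z\<in>grid m. \<bar>f (grid_point h z y) - f' (grid_point h z y)\<bar>)
        + real (2 * m + 1) ^ CARD('n) * (3 * K * h)"
  proof (rule sum_grid_le_if_lines_le[where i=i])
    fix z :: "'n \<Rightarrow> int"
    define b where "b = grid_point h (z(i := 0)) y"
    have upd: "grid_point h (z(i := k)) y = b + axis i (of_int k * h)" for k
      unfolding b_def by (rule grid_point_update)
    have "(\<Sum>k\<in>{- int m..int m}. \<bar>d (b + axis i (of_int k * h)) - d' (b + axis i (of_int k * h))\<bar>)
      \<le> 2 / h * (\<Sum>k\<in>{- int m..int m}. \<bar>f (b + axis i (of_int k * h)) - f' (b + axis i (of_int k * h))\<bar>)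
        + real (2 * m + 1) * (3 * K * h)"
    proof (rule sum_abs_derivative_difference[OF _ _ K h, of "\<lambda>s. f (b + axis i s)" "\<lambda>s. f' (b + axis i s)"])
      show "semiconcave1 K (\<lambda>s. f (b + axis i s))" "semiconcave1 K (\<lambda>s. f' (b + axis i s))"
        using f by (auto simp: semiconcave_along_def)
      show "f (b + axis i (of_int k * h)) = 0" "f' (b + axis i (of_int k * h)) = 0" if "int m \<le> \<bar>k\<bar>" for k
        unfolding b_def using grid_line_zero[of y i k z] that y[of i] by auto
    qed (simp_all only: axis_add add.assoc[symmetric] d)
    then show "(\<Sum>k\<in>{- int m..int m}. \<bar>d (grid_point h (z(i := k)) y) - d' (grid_point h (z(i := k)) y)\<bar>)
      \<le> 2 / h * (\<Sum>k\<in>{- int m..int m}. \<bar>f (grid_point h (z(i := k)) y) - f' (grid_point h (z(i := k)) y)\<bar>)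
        + real (2 * m + 1) * (3 * K * h)"
      unfolding upd .
  qed
  also have "2 / h * (\<Sum>z\<in>grid m. \<bar>f (grid_point h z y) - f' (grid_point h z y)\<bar>)
      \<le> 2 / h * (real (2 * m + 1) ^ CARD('n) * (\<delta> + real CARD('n) * (9 / 4 * K * h\<^sup>2)))"
    using h by (intro mult_left_mono sum_grid_difference_le y \<delta>) auto
  finally show ?thesis by (simp add: algebra_simps)
qed

end

text \<open>
  The space is tiled by translates of a cube of side \<open>h\<close>, so the integral is the integral over \<open>y\<close> in one cube of the
  sum over all translates of \<open>y\<close>. Thus bounds that are uniform in the offset of a grid bound integrals.
\<close>

lemma integral_le_grid_sum:
  fixes k :: "real^'n::finite \<Rightarrow> real"
  assumes k: "integrable lborel k" "\<And>x. 0 \<le> k x" "\<And>x i. l < \<bar>x $ i\<bar> \<Longrightarrow> k x = 0"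
    and h: "h > 0" and m: "l + h < real m * h"
    and S: "\<And>y. (\<And>i. 0 \<le> y $ i \<and> y $ i < h) \<Longrightarrow> (\<Sum>z\<in>grid m. k (grid_point h z y)) \<le> S"
  shows "integral\<^sup>L lborel k \<le> h ^ CARD('n) * S"
proof -
  have [measurable]: "k \<in> borel_measurable borel" using k(1) by auto
  define cell where "cell = {x::real^'n. \<forall>i. 0 \<le> x $ i \<and> x $ i < h}"
  have cell_meas [measurable]: "cell \<in> sets borel" unfolding cell_def by measurable
  define e where "e z = (\<chi> i. h * of_int (z i)) " for z :: "'n \<Rightarrow> int"
  have e: "grid_point h z y = e z + y" for z y by (simp add: grid_point_def e_def vec_eq_iff)
  have int: "integrable lborel (\<lambda>x. indicator cell (x - e z) * k x)" for z
    using integrable_mult_indicator[of "{x. x - e z \<in> cell}" lborel k] k(1)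
    by (simp add: indicator_def cong: if_cong) 
  have le: "k x \<le> (\<Sum>z\<in>grid m. indicator cell (x - e z) * k x)" for x
  proof (cases "k x = 0")
    case False
    then have x: "\<bar>x $ i\<bar> \<le> l" for i using k(3)[of x i] False by (meson not_le_imp_less)
    define z where "z i = \<lfloor>x $ i / h\<rfloor>" for i
    have z: "h * of_int (z i) \<le> x $ i" "x $ i < h * of_int (z i) + h" for i
    proof -
      have "of_int (z i) \<le> x $ i / h" "x $ i / h < of_int (z i) + 1" by (auto simp: z_def)
      then show "h * of_int (z i) \<le> x $ i" "x $ i < h * of_int (z i) + h"
        using h by (auto simp: field_simps)
    qed
    have "z \<in> grid m"
    proof -
      have "- int m \<le> z i \<and> z i \<le> int m" for i
      proof -
        have "h * of_int (z i) < real m * h" "- (real m * h) < h * of_int (z i)"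
          using z[of i] x[of i] m h by linarith+
        then have "h * of_int (z i) < h * real m" "h * (- real m) < h * of_int (z i)"
          by (auto simp: mult.commute)
        then have "of_int (z i) < real m" "- real m < of_int (z i)" using h by (simp_all only: mult_less_cancel_left_pos)
        then show ?thesis by linarith
      qed
      then show ?thesis by (simp add: grid_def)
    qed
    moreover have "x - e z \<in> cell" using z by (simp add: cell_def e_def algebra_simps)
    ultimately have "k x = (\<Sum>z\<in>{z}. indicator cell (x - e z) * k x)" "{z} \<subseteq> grid m" by auto
    then show ?thesis using k(2) by (metis (no_types, lifting) finite_grid sum_mono2 mult_nonneg_nonneg indicator_pos_le)
  qed (simp add: sum_nonneg)
  have "integral\<^sup>L lborel k \<le> integral\<^sup>L lborel (\<lambda>x. \<Sum>z\<in>grid m. indicator cell (x - e z) * k x)"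
    by (intro integral_mono k(1) Bochner_Integration.integrable_sum int le)
  also have "\<dots> = (\<Sum>z\<in>grid m. integral\<^sup>L lborel (\<lambda>x. indicator cell (x - e z) * k x))"
    by (intro Bochner_Integration.integral_sum int)
  also have "\<dots> = (\<Sum>z\<in>grid m. integral\<^sup>L lborel (\<lambda>y. indicator cell y * k (e z + y)))"
  proof (rule sum.cong[OF refl])
    fix z
    show "integral\<^sup>L lborel (\<lambda>x. indicator cell (x - e z) * k x) = integral\<^sup>L lborel (\<lambda>y. indicator cell y * k (e z + y))"
      using integral_lborel_translate[of "\<lambda>x. indicator cell (x - e z) * k x" "e z"] by simp
  qed
  also have "\<dots> = integral\<^sup>L lborel (\<lambda>y. \<Sum>z\<in>grid m. indicator cell y * k (e z + y))"
  proof (rule Bochner_Integration.integral_sum[symmetric])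
    fix z
    have "integrable (distr lborel borel ((+) (e z))) (\<lambda>x. indicator cell (x - e z) * k x)"
      using int[of z] by (simp add: lborel_distr_plus)
    moreover have "(+) (e z) \<in> measurable lborel borel" by simp
    moreover have "(\<lambda>x. indicator cell (x - e z) * k x) \<in> borel_measurable borel" by measurable
    ultimately have "integrable lborel (\<lambda>y. indicator cell (e z + y - e z) * k (e z + y))"
      by (subst integrable_distr_eq[symmetric, where M=lborel and N=borel and g="(+) (e z)" and f="\<lambda>x. indicator cell (x - e z) * k x"])
    then show "integrable lborel (\<lambda>y. indicator cell y * k (e z + y))" by simp
  qed
  also have "\<dots> \<le> integral\<^sup>L lborel (\<lambda>y. S * indicator (cbox 0 (\<chi> i. h) :: (real^'n) set) y)"
  proof (rule integral_mono')
    show "integrable lborel (\<lambda>y. S * indicator (cbox 0 (\<chi> i. h) :: (real^'n) set) y)"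
      by (intro integrable_mult_right integrable_real_indicator emeasure_lborel_cbox_finite) auto
    fix y :: "real^'n"
    have "0 \<le> (\<Sum>z\<in>grid m. k (grid_point h z 0))" by (intro sum_nonneg k(2))
    also have "\<dots> \<le> S" by (rule S) (use h in simp)
    finally have S0: "0 \<le> S" .
    show "0 \<le> S * indicator (cbox 0 (\<chi> i. h) :: (real^'n) set) y" using S0 by simp
    show "(\<Sum>z\<in>grid m. indicator cell y * k (e z + y)) \<le> S * indicator (cbox 0 (\<chi> i. h)) y"
    proof (cases "y \<in> cell")
      case True
      then have "y \<in> cbox 0 (\<chi> i. h)" by (auto simp: cell_def mem_box_cart less_imp_le)
      then show ?thesis using S[of y] True by (simp add: cell_def e)
    qed (use S0 in simp)
  qed
  also have "\<dots> = S * measure lborel (cbox 0 (\<chi> i. h) :: (real^'n) set)" by simp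
  also have "measure lborel (cbox 0 (\<chi> i. h) :: (real^'n) set) = h ^ CARD('n)"
  proof -
    have "0 \<in> cbox 0 ((\<chi> i. h) :: real^'n)" using h by (simp add: mem_box_cart)
    then show ?thesis by (subst content_cbox_cart) auto
  qed
  finally show ?thesis by (simp add: mult.commute)
qed

text \<open>
  A generating function argument: weighting \<open>b\<close> with \<open>2\<close> to the power \<open>- \<Sum> b\<close>, all functions together have
  weight at most \<open>2 ^ card Z\<close>, and each function that is counted has weight at least \<open>2 ^ - s\<close>.
\<close>

lemma card_functions_bounded_sum_le:
  assumes Z: "finite Z"
  shows "finite {b. b \<in> PiE Z (\<lambda>_. UNIV) \<and> (\<Sum>z\<in>Z. b z) \<le> (s::nat)}"
    and "card {b. b \<in> PiE Z (\<lambda>_. UNIV) \<and> (\<Sum>z\<in>Z. b z) \<le> (s::nat)} \<le> 2 ^ (card Z + s)"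
proof -
  let ?B = "{b. b \<in> PiE Z (\<lambda>_. UNIV) \<and> (\<Sum>z\<in>Z. b z) \<le> s}"
  have sub: "?B \<subseteq> PiE Z (\<lambda>_. {..s})"
  proof clarify
    fix b assume b: "b \<in> PiE Z (\<lambda>_. UNIV)" "(\<Sum>z\<in>Z. b z) \<le> s"
    have "b z \<le> s" if "z \<in> Z" for z
      using member_le_sum[of z Z b] that Z b(2) by simp
    then show "b \<in> PiE Z (\<lambda>_. {..s})" using b(1) by (auto simp: PiE_iff)
  qed
  have fin: "finite (PiE Z (\<lambda>_. {..s}))" using Z by (intro finite_PiE) auto
  then show "finite ?B" using sub by (rule rev_finite_subset)
  have "real (card ?B) * (1 / 2) ^ s \<le> (\<Sum>b\<in>?B. \<Prod>z\<in>Z. (1 / 2) ^ b z)"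
  proof -
    have "(1 / 2) ^ s \<le> (\<Prod>z\<in>Z. (1 / 2 :: real) ^ b z)" if "b \<in> ?B" for b
      using that by (simp add: power_sum[symmetric] power_decreasing)
    then show ?thesis by (rule sum_bounded_below)
  qed
  also have "\<dots> \<le> (\<Sum>b\<in>PiE Z (\<lambda>_. {..s}). \<Prod>z\<in>Z. (1 / 2) ^ b z)"
    by (intro sum_mono2 fin sub) (auto intro: prod_nonneg)
  also have "\<dots> = (\<Prod>z\<in>Z. \<Sum>k\<le>s. (1 / 2) ^ k)"
    using Z by (intro prod_sum_PiE[symmetric]) auto
  also have "\<dots> \<le> (\<Prod>z\<in>Z. 2)"
  proof (rule prod_mono)
    have "(\<Sum>k\<le>s. (1 / 2 :: real) ^ k) \<le> 2"
      by (subst sum_gp0) (simp add: field_simps)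
    then show "0 \<le> (\<Sum>k\<le>s. (1 / 2 :: real) ^ k) \<and> (\<Sum>k\<le>s. (1 / 2 :: real) ^ k) \<le> 2" by (simp add: sum_nonneg)
  qed
  also have "\<dots> = 2 ^ card Z" by simp
  finally have "real (card ?B) \<le> 2 ^ card Z * 2 ^ s" by (simp add: field_simps)
  then have "real (card ?B) \<le> real (2 ^ (card Z + s))" by (simp add: power_add)
  then show "card ?B \<le> 2 ^ (card Z + s)" by (simp only: of_nat_le_iff)
qed

section \<open>Encoding semiconcave functions\<close>

definition grid_floor :: "real \<Rightarrow> real \<Rightarrow> (real^'n::finite \<Rightarrow> real) \<Rightarrow> ('n \<Rightarrow> int) \<Rightarrow> int" where
  "grid_floor h \<delta> f z = \<lfloor>f (grid_point h z 0) / \<delta>\<rfloor>"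

definition grid_curvature :: "real \<Rightarrow> real \<Rightarrow> 'n::finite \<Rightarrow> (real^'n \<Rightarrow> real) \<Rightarrow> ('n \<Rightarrow> int) \<Rightarrow> int" where
  "grid_curvature h \<delta> i f z =
     grid_floor h \<delta> f (z(i := z i + 1)) - 2 * grid_floor h \<delta> f z + grid_floor h \<delta> f (z(i := z i - 1))"

text \<open>
  Rounding to multiples of \<open>\<delta> = K h\<^sup>2\<close> keeps second differences below \<open>3\<close>, which makes the entries of the code
  positive before the conversion to natural numbers.
\<close>

definition grid_code :: "real \<Rightarrow> real \<Rightarrow> nat \<Rightarrow> 'n::finite \<Rightarrow> (real^'n \<Rightarrow> real) \<Rightarrow> ('n \<Rightarrow> int) \<Rightarrow> nat" where
  "grid_code h \<delta> m i f = restrict (\<lambda>z. nat (3 - grid_curvature h \<delta> i f z)) (grid m)"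

lemma axis_0: "axis i 0 = 0"
  by (simp add: axis_def vec_eq_iff)

lemma grid_curvature_update:
  "grid_curvature h \<delta> i f (z(i := k)) =
     grid_floor h \<delta> f (z(i := k + 1)) - 2 * grid_floor h \<delta> f (z(i := k)) + grid_floor h \<delta> f (z(i := k - 1))"
  by (simp add: grid_curvature_def)

lemma grid_curvature_less:
  fixes f :: "real^'n::finite \<Rightarrow> real"
  assumes f: "semiconcave_along i K f" and K: "K > 0" and h: "h > 0" and \<delta>: "\<delta> = K * h\<^sup>2"
  shows "grid_curvature h \<delta> i f z < 3"
proof -
  define b where "b = grid_point h z 0"
  have shift: "grid_point h (z(i := z i + 1)) 0 = b + axis i h" "grid_point h (z(i := z i - 1)) 0 = b + axis i (- h)"
    by (auto simp: b_def grid_point_def vec_eq_iff axis_def algebra_simps)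
  have "f (b + axis i h) - 2 * f b + f (b + axis i (- h)) \<le> \<delta>"
    using semiconcave1_second_difference[of K "\<lambda>s. f (b + axis i s)" 0 h] f \<delta> by (simp add: semiconcave_along_def axis_0)
  then have "(f (b + axis i h) - 2 * f b + f (b + axis i (- h))) / \<delta> \<le> \<delta> / \<delta>"
    using K h \<delta> by (intro divide_right_mono) auto
  moreover have "\<delta> > 0" using K h \<delta> by simp
  ultimately have "f (b + axis i h) / \<delta> - 2 * (f b / \<delta>) + f (b + axis i (- h)) / \<delta> \<le> 1"
    by (simp add: diff_divide_distrib add_divide_distrib)
  moreover have "of_int \<lfloor>f (b + axis i h) / \<delta>\<rfloor> \<le> f (b + axis i h) / \<delta>"
    "of_int \<lfloor>f (b + axis i (- h)) / \<delta>\<rfloor> \<le> f (b + axis i (- h)) / \<delta>"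
    "f b / \<delta> < of_int \<lfloor>f b / \<delta>\<rfloor> + 1" by linarith+
  ultimately have "real_of_int (grid_curvature h \<delta> i f z) < 3"
    unfolding grid_curvature_def grid_floor_def shift b_def[symmetric] of_int_add of_int_diff of_int_mult of_int_numeral
    by linarith
  then show ?thesis by simp
qed

lemma grid_floor_outside:
  fixes f :: "real^'n::finite \<Rightarrow> real"
  assumes zero: "\<And>x i. l < \<bar>x $ i\<bar> \<Longrightarrow> f x = 0" and h: "h > 0" and m: "l < real m * h" and z: "int m \<le> \<bar>z i\<bar>"
  shows "grid_floor h \<delta> f z = 0"
proof -
  have "real m \<le> \<bar>of_int (z i)\<bar>" using z by linarith
  then have "h * real m \<le> h * \<bar>of_int (z i)\<bar>" using h by (intro mult_left_mono) auto
  also have "\<dots> = \<bar>grid_point h z 0 $ i\<bar>" using h by (simp add: grid_point_def abs_mult)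
  finally have "l < \<bar>grid_point h z 0 $ i\<bar>" using m by (simp add: mult.commute)
  then show ?thesis unfolding grid_floor_def using zero by simp
qed

text \<open>
  Second differences cancel along each line, so only the constants \<open>3\<close> remain. The sum of the code is
  the same for all functions.
\<close>

lemma sum_grid_code:
  fixes f :: "real^'n::finite \<Rightarrow> real"
  assumes f: "semiconcave_along i K f" and K: "K > 0" and h: "h > 0" and \<delta>: "\<delta> = K * h\<^sup>2"
    and zero: "\<And>x i. l < \<bar>x $ i\<bar> \<Longrightarrow> f x = 0" and m: "l < real m * h"
  shows "(\<Sum>z\<in>grid m. grid_code h \<delta> m i f z) = 3 * (2 * m + 1) ^ CARD('n)"
proof -
  have "of_nat (2 * m + 1) * (\<Sum>z\<in>grid m. grid_curvature h \<delta> i f z) =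
      (\<Sum>z\<in>grid m. \<Sum>k\<in>{- int m..int m}. grid_curvature h \<delta> i f (z(i := k)))"
    by (rule sum_grid_lines[symmetric])
  also have "\<dots> = (\<Sum>z\<in>(grid m :: ('n \<Rightarrow> int) set). 0)"
  proof (rule sum.cong[OF refl])
    fix z :: "'n \<Rightarrow> int"
    show "(\<Sum>k\<in>{- int m..int m}. grid_curvature h \<delta> i f (z(i := k))) = 0"
      unfolding grid_curvature_update
    proof (rule sum_second_difference_int[of m "\<lambda>k. grid_floor h \<delta> f (z(i := k))"])
      show "grid_floor h \<delta> f (z(i := k)) = 0" if "int m \<le> \<bar>k\<bar>" for k
        by (rule grid_floor_outside[OF zero h m, where i=i]) (use that in simp_all)
    qed
  qed
  finally have "(\<Sum>z\<in>grid m. grid_curvature h \<delta> i f z) = 0" by simp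
  then have "(\<Sum>z\<in>grid m. 3 - grid_curvature h \<delta> i f z) = 3 * int (card (grid m :: ('n \<Rightarrow> int) set))"
    by (simp add: sum_subtractf)
  moreover have "int (\<Sum>z\<in>grid m. grid_code h \<delta> m i f z) = (\<Sum>z\<in>grid m. 3 - grid_curvature h \<delta> i f z)"
    unfolding of_nat_sum
    by (intro sum.cong refl) (use grid_curvature_less[OF f K h \<delta>] in \<open>simp add: grid_code_def less_imp_le\<close>)
  ultimately have "int (\<Sum>z\<in>grid m. grid_code h \<delta> m i f z) = int (3 * card (grid m :: ('n \<Rightarrow> int) set))" by simp
  then show ?thesis unfolding of_nat_eq_iff card_grid .
qed

text \<open>
  A line of rounded values starts with zeros, because \<open>f\<close> vanishes there, and is then determined by its second
  differences. Equal rounded values differ by less than \<open>\<delta>\<close> before rounding.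
\<close>

lemma grid_code_determines_values:
  fixes f f' :: "real^'n::finite \<Rightarrow> real"
  assumes f: "semiconcave_along i K f" "semiconcave_along i K f'" and K: "K > 0" and h: "h > 0" and \<delta>: "\<delta> = K * h\<^sup>2"
    and zero: "\<And>x i. l < \<bar>x $ i\<bar> \<Longrightarrow> f x = 0" "\<And>x i. l < \<bar>x $ i\<bar> \<Longrightarrow> f' x = 0" and m: "l < real m * h"
    and code: "grid_code h \<delta> m i f = grid_code h \<delta> m i f'" and z: "z \<in> grid m"
  shows "\<bar>f (grid_point h z 0) - f' (grid_point h z 0)\<bar> \<le> \<delta>"
proof -
  have curv: "grid_curvature h \<delta> i f w = grid_curvature h \<delta> i f' w" if "w \<in> grid m" for w
  proof -
    have "nat (3 - grid_curvature h \<delta> i f w) = nat (3 - grid_curvature h \<delta> i f' w)"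
      using fun_cong[OF code, of w] that by (simp add: grid_code_def)
    then show ?thesis
      using grid_curvature_less[OF f(1) K h \<delta>, of w] grid_curvature_less[OF f(2) K h \<delta>, of w] by simp
  qed
  define e where "e k = grid_floor h \<delta> f (z(i := k)) - grid_floor h \<delta> f' (z(i := k))" for k
  have e0: "e k = 0" if "int m \<le> \<bar>k\<bar>" for k
    unfolding e_def using that grid_floor_outside[OF zero(1) h m, where z="z(i := k)" and i=i and \<delta>=\<delta>]
      grid_floor_outside[OF zero(2) h m, where z="z(i := k)" and i=i and \<delta>=\<delta>] by simp
  have e_step: "e (k + 1) = 2 * e k - e (k - 1)" if "k \<in> {- int m..int m}" for k
    using curv[OF grid_update[OF z that, of i]] unfolding grid_curvature_update e_def by (simp add: algebra_simps)
  have "e (- int m + int j) = 0 \<and> e (- int m + int j - 1) = 0" if "j \<le> 2 * m" for j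
    using that
  proof (induction j)
    case 0
    then show ?case using e0[of "- int m"] e0[of "- int m - 1"] by simp
  next
    case (Suc j)
    then have "e (- int m + int j + 1) = 0" using e_step[of "- int m + int j"] by simp
    then show ?case using Suc by (simp add: algebra_simps)
  qed
  moreover have "z i = - int m + int (nat (z i + int m))" "nat (z i + int m) \<le> 2 * m"
    using z by (auto simp: grid_def dest!: spec[of _ i])
  ultimately have "e (z i) = 0" by metis
  then have "\<lfloor>f (grid_point h z 0) / \<delta>\<rfloor> = \<lfloor>f' (grid_point h z 0) / \<delta>\<rfloor>"
    by (simp add: e_def grid_floor_def)
  then have "\<bar>f (grid_point h z 0) / \<delta> - f' (grid_point h z 0) / \<delta>\<bar> < 1" by linarith
  then have "\<bar>(f (grid_point h z 0) - f' (grid_point h z 0)) / \<delta>\<bar> < 1" by (simp add: diff_divide_distrib)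
  moreover have "\<delta> > 0" using K h \<delta> by simp
  ultimately show ?thesis by (simp add: abs_divide)
qed

definition semiconcave_class :: "real \<Rightarrow> real \<Rightarrow> real \<Rightarrow> (real^'n::finite \<Rightarrow> real) set" where
  "semiconcave_class C K l = {f. C-lipschitz_on UNIV f \<and> (\<forall>i. semiconcave_along i K f) \<and>
     (\<forall>x i. l < \<bar>x $ i\<bar> \<longrightarrow> f x = 0)}"

lemma semiconcave_class_gradient:
  fixes f :: "real^'n::finite \<Rightarrow> real"
  assumes f: "f \<in> semiconcave_class C K l" and K: "K \<ge> 0"
  obtains g :: "real^'n \<Rightarrow> real^'n"
  where "\<And>x i. (\<lambda>j. real (Suc j) * (f (x + axis i (1 / real (Suc j))) - f x)) \<longlonglongrightarrow> g x $ i"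
proof -
  have "\<exists>d. (\<lambda>j. real (Suc j) * (f (x + axis i (1 / real (Suc j))) - f x)) \<longlonglongrightarrow> d" for x i
  proof -
    have "semiconcave1 K (\<lambda>s. f (x + axis i s))" using f by (auto simp: semiconcave_class_def semiconcave_along_def)
    then show ?thesis
      using semiconcave1_right_derivative[of K "\<lambda>s. f (x + axis i s)" 0] K by (simp add: axis_0)
  qed
  then obtain d where "\<And>x i. (\<lambda>j. real (Suc j) * (f (x + axis i (1 / real (Suc j))) - f x)) \<longlonglongrightarrow> d x i"
    by metis
  then show ?thesis using that[of "\<lambda>x. \<chi> i. d x i"] by simp
qed

text \<open>
  The first summand bounds the difference of the functions, of order \<open>h\<^sup>2\<close>, the second one the difference of the
  gradients, of order \<open>h\<close>.
\<close>

lemma W11_dist_le_if_same_code: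
  fixes f f' :: "real^'n::finite \<Rightarrow> real"
  assumes f: "f \<in> semiconcave_class C K l" "f' \<in> semiconcave_class C K l"
    and K: "K > 0" and h: "h > 0" and \<delta>: "\<delta> = K * h\<^sup>2" and m: "l + h < real m * h"
    and code: "grid_code h \<delta> m i f = grid_code h \<delta> m i f'"
  shows "W11_dist (W11_class f) (W11_class f') \<le> (real (2 * m + 1) * h) ^ CARD('n) *
    (K * h\<^sup>2 * (1 + 9 / 4 * real CARD('n)) + K * h * (real CARD('n) * (5 + 9 / 2 * real CARD('n))))"
proof -
  let ?N = "real CARD('n)" and ?n = "real (2 * m + 1)"
  have lip: "C-lipschitz_on UNIV f" "C-lipschitz_on UNIV f'" 
    and sc: "\<And>i. semiconcave_along i K f" "\<And>i. semiconcave_along i K f'"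
    and zero: "\<And>x i. l < \<bar>x $ i\<bar> \<Longrightarrow> f x = 0" "\<And>x i. l < \<bar>x $ i\<bar> \<Longrightarrow> f' x = 0"
    using f by (auto simp: semiconcave_class_def)
  obtain g where g: "\<And>x i. (\<lambda>j. real (Suc j) * (f (x + axis i (1 / real (Suc j))) - f x)) \<longlonglongrightarrow> g x $ i"
    using semiconcave_class_gradient[OF f(1)] K by force
  obtain g' where g': "\<And>x i. (\<lambda>j. real (Suc j) * (f' (x + axis i (1 / real (Suc j))) - f' x)) \<longlonglongrightarrow> g' x $ i"
    using semiconcave_class_gradient[OF f(2)] K by force
  define d where "d x = f x - f' x" for x
  define gd where "gd x = g x - g' x" for x
  have d_lip: "(C + C)-lipschitz_on UNIV d" unfolding d_def by (intro lipschitz_on_diff lip)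
  have d_zero: "d x = 0" if "l < \<bar>x $ i\<bar>" for x i using zero[OF that] by (simp add: d_def)
  have d_lim: "(\<lambda>j. real (Suc j) * (d (x + axis i (1 / real (Suc j))) - d x)) \<longlonglongrightarrow> gd x $ i" for x i
    using tendsto_diff[OF g[of x i] g'[of x i]] by (simp add: d_def gd_def algebra_simps del: of_nat_Suc)
  note wd = lipschitz_weak_gradient[OF d_lip d_zero d_lim]
  have fW: "f \<in> W11_fun" "f' \<in> W11_fun"
    using lipschitz_weak_gradient(7)[OF lip(1) zero(1) g] lipschitz_weak_gradient(7)[OF lip(2) zero(2) g'] by auto
  have m': "l < real m * h" using m h by simp
  have close: "\<bar>f (grid_point h z 0) - f' (grid_point h z 0)\<bar> \<le> \<delta>" if "z \<in> grid m" for z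
    by (rule grid_code_determines_values[OF sc(1)[of i] sc(2)[of i] K h \<delta> zero m' code that])
  define S1 where "S1 = ?n ^ CARD('n) * (\<delta> + ?N * (9 / 4 * K * h\<^sup>2))"
  define S2 where "S2 = ?n ^ CARD('n) * (2 / h * (\<delta> + ?N * (9 / 4 * K * h\<^sup>2)) + 3 * K * h)"
  have K0: "K \<ge> 0" using K by simp
  have "integral\<^sup>L lborel (\<lambda>x. \<bar>d x\<bar>) \<le> h ^ CARD('n) * S1"
  proof (rule integral_le_grid_sum[OF _ _ _ h m])
    show "(\<Sum>z\<in>grid m. \<bar>d (grid_point h z y)\<bar>) \<le> S1" if "\<And>i. 0 \<le> y $ i \<and> y $ i < h" for y
      unfolding S1_def d_def by (rule sum_grid_difference_le[OF sc K0 h zero m that close])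
  qed (use wd(3) d_zero in auto)
  moreover have "integral\<^sup>L lborel (\<lambda>x. norm (gd x)) \<le> h ^ CARD('n) * (?N * S2)"
  proof (rule integral_le_grid_sum[OF _ _ _ h m])
    fix y :: "real^'n" assume y: "\<And>i. 0 \<le> y $ i \<and> y $ i < h"
    have "(\<Sum>z\<in>grid m. norm (gd (grid_point h z y))) \<le> (\<Sum>z\<in>grid m. \<Sum>i\<in>UNIV. \<bar>gd (grid_point h z y) $ i\<bar>)"
      by (intro sum_mono norm_le_l1_cart)
    also have "\<dots> = (\<Sum>i\<in>UNIV. \<Sum>z\<in>grid m. \<bar>g (grid_point h z y) $ i - g' (grid_point h z y) $ i\<bar>)"
      by (subst sum.swap) (simp add: gd_def)
    also have "\<dots> \<le> (\<Sum>i\<in>(UNIV :: 'n set). S2)"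
      unfolding S2_def by (intro sum_mono sum_grid_derivative_le[OF sc K0 h zero m y close g g'])
    finally show "(\<Sum>z\<in>grid m. norm (gd (grid_point h z y))) \<le> ?N * S2" by simp
  qed (use wd(4,5) in auto)
  moreover have "W11_dist (W11_class f) (W11_class f') = integral\<^sup>L lborel (\<lambda>x. \<bar>d x\<bar>) + integral\<^sup>L lborel (\<lambda>x. norm (gd x))"
  proof -
    have "integrable lebesgue gd" using wd(4) wd(2) integrable_completion[of gd lborel] by simp
    then have "W11_dist (W11_class f) (W11_class f') = integral\<^sup>L lebesgue (\<lambda>x. \<bar>d x\<bar>) + integral\<^sup>L lebesgue (\<lambda>x. norm (gd x))"
      unfolding d_def using wd(6) by (intro W11_dist_class fW) (auto simp: d_def)
    then show ?thesis using wd(1,2) by (simp add: integral_completion)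
  qed
  ultimately have "W11_dist (W11_class f) (W11_class f') \<le> h ^ CARD('n) * S1 + h ^ CARD('n) * (?N * S2)" by simp
  also have "\<dots> = (?n * h) ^ CARD('n) * (\<delta> + ?N * (9 / 4 * K * h\<^sup>2) + ?N * (2 / h * (\<delta> + ?N * (9 / 4 * K * h\<^sup>2)) + 3 * K * h))"
    by (simp only: S1_def S2_def power_mult_distrib) (simp only: algebra_simps)
  also have "\<delta> + ?N * (9 / 4 * K * h\<^sup>2) + ?N * (2 / h * (\<delta> + ?N * (9 / 4 * K * h\<^sup>2)) + 3 * K * h) =
      K * h\<^sup>2 * (1 + 9 / 4 * ?N) + K * h * (?N * (5 + 9 / 2 * ?N))"
    using h unfolding \<delta> by (simp add: field_simps power2_eq_square)
  finally show ?thesis .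
qed

text \<open>
  The fibres of a code with finitely many values form a cover.
\<close>

lemma metric_entropy_le_if_code:
  fixes class_of :: "'f \<Rightarrow> 'a" and code :: "'f \<Rightarrow> 'c"
  assumes X: "class_of ` F \<subseteq> X" and fin: "finite (code ` F)" and card: "card (code ` F) \<le> 2 ^ b"
    and close: "\<And>f f'. f \<in> F \<Longrightarrow> f' \<in> F \<Longrightarrow> code f = code f' \<Longrightarrow> d (class_of f) (class_of f') \<le> 2 * \<epsilon>"
  shows "metric_entropy X d (class_of ` F) \<epsilon> \<le> ereal (real b)"
proof -
  define \<U> where "\<U> = (\<lambda>c. class_of ` {f \<in> F. code f = c}) ` code ` F"
  have "enat (card \<U>) \<in> {enat (card \<U>) | \<U>. finite \<U> \<and> class_of ` F \<subseteq> \<Union>\<U> \<and>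
      (\<forall>A\<in>\<U>. A \<subseteq> X \<and> (\<forall>x\<in>A. \<forall>y\<in>A. d x y \<le> 2 * \<epsilon>))}"
  proof (intro CollectI exI[of _ \<U>] conjI refl)
    show "finite \<U>" using fin by (simp add: \<U>_def)
    show "class_of ` F \<subseteq> \<Union>\<U>" by (auto simp: \<U>_def)
    show "\<forall>A\<in>\<U>. A \<subseteq> X \<and> (\<forall>x\<in>A. \<forall>y\<in>A. d x y \<le> 2 * \<epsilon>)"
      using X close by (force simp: \<U>_def)
  qed
  then have "covering_number X d (class_of ` F) \<epsilon> \<le> enat (card \<U>)"
    unfolding covering_number_def by (rule Inf_lower)
  then obtain n where n: "covering_number X d (class_of ` F) \<epsilon> = enat n" "n \<le> card \<U>"
    by (cases "covering_number X d (class_of ` F) \<epsilon>") auto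
  have "card \<U> \<le> 2 ^ b" unfolding \<U>_def using card_image_le[OF fin] card by (rule order_trans)
  then have "n \<le> 2 ^ b" using n by simp
  then have "real n \<le> 2 ^ b" using of_nat_mono[of n "2 ^ b"] by simp
  then have "log 2 (real n) \<le> real b"
  proof (cases "n = 0")
    case False
    then have "log 2 (real n) \<le> log 2 (2 ^ b)"
      using \<open>real n \<le> 2 ^ b\<close> by (subst log_le_cancel_iff) auto
    then show ?thesis by (simp add: log_nat_power)
  qed (simp add: log_def)
  then show ?thesis unfolding metric_entropy_def n(1) by simp
qed

lemma semiconcave_class_entropy_le_grid:
  assumes K: "K > 0" and h: "h > 0" and m: "l + h < real m * h"
    and F: "F \<subseteq> (semiconcave_class C K l :: (real^'n::finite \<Rightarrow> real) set)"
    and \<epsilon>: "(real (2 * m + 1) * h) ^ CARD('n) *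
      (K * h\<^sup>2 * (1 + 9 / 4 * real CARD('n)) + K * h * (real CARD('n) * (5 + 9 / 2 * real CARD('n)))) \<le> 2 * \<epsilon>"
  shows "metric_entropy W11 W11_dist (W11_class ` F) \<epsilon> \<le> ereal (4 * real (2 * m + 1) ^ CARD('n))"
proof -
  define \<delta> where "\<delta> = K * h\<^sup>2"
  define code where "code = grid_code h \<delta> m (undefined :: 'n)"
  let ?s = "3 * (2 * m + 1) ^ CARD('n)" and ?G = "grid m :: ('n \<Rightarrow> int) set"
  let ?B = "{b. b \<in> PiE ?G (\<lambda>_. UNIV) \<and> (\<Sum>z\<in>?G. b z) \<le> ?s}"
  have m': "l < real m * h" using m h by simp
  have sub: "code ` F \<subseteq> ?B"
  proof clarify
    fix f assume "f \<in> F"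
    then have f: "semiconcave_along undefined K f" "\<And>x i. l < \<bar>x $ i\<bar> \<Longrightarrow> f x = 0"
      using F by (auto simp: semiconcave_class_def)
    show "code f \<in> PiE ?G (\<lambda>_. UNIV) \<and> (\<Sum>z\<in>?G. code f z) \<le> ?s"
      using sum_grid_code[OF f(1) K h \<delta>_def f(2) m'] by (simp add: code_def grid_code_def)
  qed
  have "finite ?G" by simp
  note B = card_functions_bounded_sum_le[OF this, of ?s]
  have "card (code ` F) \<le> card ?B" using sub B(1) by (rule card_mono[rotated])
  also have "\<dots> \<le> 2 ^ (card ?G + ?s)" by (rule B(2))
  also have "card ?G + ?s = 4 * (2 * m + 1) ^ CARD('n)" by (simp only: card_grid)
  finally have card: "card (code ` F) \<le> 2 ^ (4 * (2 * m + 1) ^ CARD('n))" .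
  have "metric_entropy W11 W11_dist (W11_class ` F) \<epsilon> \<le> ereal (real (4 * (2 * m + 1) ^ CARD('n)))"
  proof (rule metric_entropy_le_if_code[OF _ _ card])
    show "finite (code ` F)" using sub B(1) by (rule finite_subset)
    show "W11_class ` F \<subseteq> W11"
    proof clarify
      fix f assume "f \<in> F"
      then have f: "f \<in> semiconcave_class C K l" using F by blast
      obtain g where g: "\<And>x i. (\<lambda>j. real (Suc j) * (f (x + axis i (1 / real (Suc j))) - f x)) \<longlonglongrightarrow> g x $ i"
        using semiconcave_class_gradient[OF f] K by force
      have "f \<in> W11_fun"
        by (rule lipschitz_weak_gradient(7)[OF _ _ g, of C l]) (use f in \<open>auto simp: semiconcave_class_def\<close>)
      then show "W11_class f \<in> W11" by (rule W11_class_in_W11)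
    qed
    fix f f' assume "f \<in> F" "f' \<in> F" "code f = code f'"
    then show "W11_dist (W11_class f) (W11_class f') \<le> 2 * \<epsilon>"
      using W11_dist_le_if_same_code[OF _ _ K h \<delta>_def m] F \<epsilon> unfolding code_def by (meson order_trans subsetD)
  qed
  then show ?thesis by simp
qed

theorem semiconcave_class_entropy_le:
  assumes K: "K > 0" and l: "l > 0" and N: "N = CARD('n)"
    and F: "F \<subseteq> (semiconcave_class C K l :: (real^'n::finite \<Rightarrow> real) set)"
  shows "\<forall>\<^sub>F \<epsilon> in at_right 0. metric_entropy W11 W11_dist (W11_class ` F) \<epsilon>
    \<le> ereal (4 * (3 * l) ^ N * ((3 * l) ^ N * K * (5 * (real N)\<^sup>2)) ^ N / \<epsilon> ^ N)"
proof -
  define c where "c = (3 * l) ^ N * K * (5 * (real N)\<^sup>2)"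
  have N1: "real N \<ge> 1" unfolding N by (simp add: Suc_leI)
  have c: "c > 0" using K l N1 by (simp add: c_def)
  have "\<forall>\<^sub>F \<epsilon> in at_right 0. \<epsilon> \<in> {0<..<c * min (l / 5) (1 / 10)}"
    using c l by (intro eventually_at_right_real) simp
  then show ?thesis
  proof eventually_elim
    case (elim \<epsilon>)
    \<comment> \<open>This step size bounds the diameter of the fibres by \<open>2 \<epsilon>\<close>, where \<open>10 N\<^sup>2\<close> absorbs the terms of lower order.\<close>
    define h where "h = \<epsilon> / c"
    have "c * min (l / 5) (1 / 10) \<le> c * (l / 5)" "c * min (l / 5) (1 / 10) \<le> c * (1 / 10)"
      using c by (auto intro!: mult_left_mono)
    then have "\<epsilon> \<le> c * (l / 5)" "\<epsilon> \<le> c * (1 / 10)"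
      using elim unfolding greaterThanLessThan_iff by linarith+
    then have h: "5 * h \<le> l" "h \<le> 1 / 10" using c by (simp_all add: h_def field_simps)
    have h0: "h > 0" using elim c by (simp add: h_def)
    note h = h0 h
    \<comment> \<open>Two extra points on each side: shifted grid points with index \<open>m\<close> in absolute value still lie outside the support.\<close>
    define m where "m = nat \<lfloor>l / h\<rfloor> + 2"
    have lh: "l / h > 0" using l h by simp
    have "real m = of_int \<lfloor>l / h\<rfloor> + 2" using lh by (simp add: m_def)
    then have "l / h + 1 < real m" "real m \<le> l / h + 2" by linarith+
    then have m: "l + h < real m * h" "real m * h \<le> l + 2 * h"
      using h(1) by (auto simp: field_simps)
    have n: "0 \<le> real (2 * m + 1) * h" "real (2 * m + 1) * h \<le> 3 * l" using m h by (auto simp: algebra_simps)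
    have "h * (1 + 9 / 4 * real N) \<le> 1 / 10 * (1 + 9 / 4 * real N)" using h N1 by (intro mult_right_mono) auto
    moreover have "real N \<le> (real N)\<^sup>2" "1 \<le> (real N)\<^sup>2"
      using N1 by (auto simp: power2_eq_square mult_le_cancel_right1 intro: order_trans[OF N1])
    ultimately have "h * (1 + 9 / 4 * real N) + real N * (5 + 9 / 2 * real N) \<le> 10 * (real N)\<^sup>2"
      by (simp add: algebra_simps power2_eq_square)
    then have KN: "K * h * (h * (1 + 9 / 4 * real N) + real N * (5 + 9 / 2 * real N)) \<le> K * h * (10 * (real N)\<^sup>2)"
      using K h by (intro mult_left_mono) auto
    have "(real (2 * m + 1) * h) ^ N * (K * h * (h * (1 + 9 / 4 * real N) + real N * (5 + 9 / 2 * real N)))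
        \<le> (3 * l) ^ N * (K * h * (10 * (real N)\<^sup>2))"
    proof (rule mult_mono)
      show "(real (2 * m + 1) * h) ^ N \<le> (3 * l) ^ N" using n by (intro power_mono) auto
    qed (use KN l K h N1 in auto)
    also have "\<dots> = 2 * (c * h)" by (simp add: c_def)
    also have "c * h = \<epsilon>" using c by (simp add: h_def)
    finally have "metric_entropy W11 W11_dist (W11_class ` F) \<epsilon> \<le> ereal (4 * real (2 * m + 1) ^ CARD('n))"
      by (intro semiconcave_class_entropy_le_grid[OF K h(1) m(1) F]) (simp add: N power2_eq_square algebra_simps)
    also have "4 * real (2 * m + 1) ^ CARD('n) \<le> 4 * (3 * l / h) ^ N"
      unfolding N using n h by (intro mult_left_mono power_mono) (auto simp: pos_le_divide_eq)
    also have "4 * (3 * l / h) ^ N = 4 * (3 * l) ^ N * c ^ N / \<epsilon> ^ N"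
      by (simp add: h_def power_divide power_mult_distrib)
    finally show ?case by (simp add: c_def)
  qed
qed

section \<open>Sums of disjoint bumps\<close>

text \<open>
  The square of the truncated paraboloid is \<open>C\<^sup>1\<close> with Lipschitz gradient, and all constants are explicit.
\<close>

definition bump :: "real \<Rightarrow> real \<Rightarrow> real^'n::finite \<Rightarrow> real" where
  "bump c r x = c * (max 0 (r\<^sup>2 - (norm x)\<^sup>2))\<^sup>2"

definition bump_gradient :: "real \<Rightarrow> real \<Rightarrow> real^'n::finite \<Rightarrow> real^'n" where
  "bump_gradient c r x = (- (4 * c * max 0 (r\<^sup>2 - (norm x)\<^sup>2))) *\<^sub>R x"

lemma positive_part_square_derivative:
  "((\<lambda>s. (max 0 s)\<^sup>2) has_real_derivative 2 * max 0 s) (at s)"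
proof (cases s "0::real" rule: linorder_cases)
  case less
  have "((\<lambda>s. 0) has_real_derivative 0) (at s)" by simp
  then have "((\<lambda>s. (max 0 s)\<^sup>2) has_real_derivative 0) (at s)"
    by (rule has_field_derivative_transform_within_open[of _ _ _ "{..<0}"]) (use less in auto)
  then show ?thesis using less by simp
next
  case greater
  have "((\<lambda>s. s\<^sup>2) has_real_derivative 2 * s) (at s)" by (auto intro!: derivative_eq_intros)
  then have "((\<lambda>s. (max 0 s)\<^sup>2) has_real_derivative 2 * s) (at s)"
    by (rule has_field_derivative_transform_within_open[of _ _ _ "{0<..}"]) (use greater in auto)
  then show ?thesis using greater by simp
next
  case equal
  have "((\<lambda>h. (max 0 h)\<^sup>2 / h) \<longlongrightarrow> 0) (at (0::real))"
  proof (rule Lim_null_comparison)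
    show "\<forall>\<^sub>F h in at (0::real). norm ((max 0 h)\<^sup>2 / h) \<le> \<bar>h\<bar>"
      by (intro always_eventually allI) (auto simp: max_def power2_eq_square)
    show "((\<lambda>h. \<bar>h\<bar>) \<longlongrightarrow> 0) (at (0::real))" by (auto intro!: tendsto_eq_intros)
  qed
  then show ?thesis by (simp add: equal has_field_derivative_iff)
qed

lemma bump_has_gradient: "GDERIV (bump c r) x :> bump_gradient c r x"
proof -
  have "((\<lambda>x. r\<^sup>2 - x \<bullet> x) has_derivative (\<lambda>h. - (2 * (x \<bullet> h)))) (at x)"
    by (auto intro!: derivative_eq_intros simp: inner_commute)
  from has_derivative_compose[OF this positive_part_square_derivative[unfolded has_field_derivative_def]]
  have "((\<lambda>x. (max 0 (r\<^sup>2 - x \<bullet> x))\<^sup>2) has_derivative (\<lambda>h. 2 * max 0 (r\<^sup>2 - x \<bullet> x) * - (2 * (x \<bullet> h)))) (at x)" .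
  then have "((\<lambda>x. c * (max 0 (r\<^sup>2 - x \<bullet> x))\<^sup>2) has_derivative (\<lambda>h. c * (2 * max 0 (r\<^sup>2 - x \<bullet> x) * - (2 * (x \<bullet> h))))) (at x)"
    by (rule has_derivative_mult_right)
  then show ?thesis
    by (simp add: gderiv_def bump_def[abs_def] bump_gradient_def power2_norm_eq_inner inner_commute mult_ac)
qed

lemma bump_outside:
  assumes "r \<ge> 0" "r \<le> norm x"
  shows "bump c r x = 0" "bump_gradient c r x = 0"
proof -
  have "r\<^sup>2 \<le> (norm x)\<^sup>2" using assms by (intro power_mono) auto
  then show "bump c r x = 0" "bump_gradient c r x = 0" by (auto simp: bump_def bump_gradient_def)
qed

lemma norm_bump_gradient:
  assumes "c \<ge> 0" "r \<ge> 0" "norm x \<le> r"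
  shows "norm (bump_gradient c r x) = 4 * c * (r\<^sup>2 - (norm x)\<^sup>2) * norm x"
proof -
  have "(norm x)\<^sup>2 \<le> r\<^sup>2" using assms by (intro power_mono) auto
  then show ?thesis using assms by (simp add: bump_gradient_def abs_mult)
qed

lemma norm_bump_gradient_le:
  assumes c: "c \<ge> 0" and r: "r \<ge> 0"
  shows "norm (bump_gradient c r x) \<le> 8 * c * r\<^sup>2 * max 0 (r - norm x)"
proof (cases "norm x \<le> r")
  case True
  have "4 * c * (r\<^sup>2 - (norm x)\<^sup>2) * norm x = 4 * c * (r - norm x) * ((r + norm x) * norm x)"
    by (simp add: algebra_simps power2_eq_square)
  also have "\<dots> \<le> 4 * c * (r - norm x) * ((r + r) * r)"
    using c r True by (intro mult_left_mono mult_mono) auto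
  finally show ?thesis using True by (simp add: norm_bump_gradient[OF c r True] power2_eq_square mult_ac)
next
  case False
  then show ?thesis using bump_outside(2)[OF r, of x c] by simp
qed

lemma bump_gradient_lipschitz:
  assumes c: "c \<ge> 0" and r: "r \<ge> 0"
  shows "norm (bump_gradient c r x - bump_gradient c r y) \<le> 12 * c * r\<^sup>2 * norm (x - y)"
proof -
  have outside: "norm (bump_gradient c r x - bump_gradient c r y) \<le> 12 * c * r\<^sup>2 * norm (x - y)"
    if y: "r \<le> norm y" for x y :: "real^'n"
  proof -
    have "norm (bump_gradient c r x - bump_gradient c r y) \<le> 8 * c * r\<^sup>2 * max 0 (r - norm x)"
      using bump_outside(2)[OF r y, of c] norm_bump_gradient_le[OF c r, of x] by simp
    also have "\<dots> \<le> 8 * c * r\<^sup>2 * norm (x - y)"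
      using c y norm_triangle_ineq2[of y x] by (intro mult_left_mono) (auto simp: norm_minus_commute)
    also have "\<dots> \<le> 12 * c * r\<^sup>2 * norm (x - y)"
      using c by (intro mult_right_mono) auto
    finally show ?thesis .
  qed
  consider "r \<le> norm y" | "r \<le> norm x" | "norm x < r" "norm y < r" by linarith
  then show ?thesis
  proof cases
    case 2
    then show ?thesis using outside[of x y] by (simp add: norm_minus_commute)
  next
    case 3
    have xr: "(norm x)\<^sup>2 \<le> r\<^sup>2" "(norm y)\<^sup>2 \<le> r\<^sup>2" using 3 by (auto intro!: power_mono)
    have inner: "norm ((r\<^sup>2 - (norm x)\<^sup>2) *\<^sub>R (x - y) + ((norm y)\<^sup>2 - (norm x)\<^sup>2) *\<^sub>R y)
        \<le> r\<^sup>2 * norm (x - y) + norm (x - y) * (2 * r) * r"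
    proof (intro order_trans[OF norm_triangle_ineq] add_mono)
      show "norm ((r\<^sup>2 - (norm x)\<^sup>2) *\<^sub>R (x - y)) \<le> r\<^sup>2 * norm (x - y)"
        using xr by (simp add: mult_right_mono)
      have "\<bar>(norm y)\<^sup>2 - (norm x)\<^sup>2\<bar> = \<bar>norm y - norm x\<bar> * (norm y + norm x)"
        by (simp add: square_diff_square_factored power2_eq_square abs_mult mult.commute)
      also have "\<dots> \<le> norm (x - y) * (2 * r)"
        using norm_triangle_ineq3[of x y] 3 by (intro mult_mono) (auto simp: abs_minus_commute)
      finally show "norm (((norm y)\<^sup>2 - (norm x)\<^sup>2) *\<^sub>R y) \<le> norm (x - y) * (2 * r) * r"
        using 3 r by (simp only: norm_scaleR) (intro mult_mono; auto)
    qed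
    have "bump_gradient c r x - bump_gradient c r y =
        (- (4 * c)) *\<^sub>R ((r\<^sup>2 - (norm x)\<^sup>2) *\<^sub>R (x - y) + ((norm y)\<^sup>2 - (norm x)\<^sup>2) *\<^sub>R y)"
      using xr by (simp add: bump_gradient_def algebra_simps)
    then have "norm (bump_gradient c r x - bump_gradient c r y) =
        4 * c * norm ((r\<^sup>2 - (norm x)\<^sup>2) *\<^sub>R (x - y) + ((norm y)\<^sup>2 - (norm x)\<^sup>2) *\<^sub>R y)"
      using c by (simp only: norm_scaleR) simp
    also have "\<dots> \<le> 4 * c * (r\<^sup>2 * norm (x - y) + norm (x - y) * (2 * r) * r)"
      using c by (intro mult_left_mono inner) auto
    finally show ?thesis by (simp add: algebra_simps power2_eq_square)
  qed (rule outside)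
qed

definition bump_sum :: "real \<Rightarrow> real \<Rightarrow> (real^'n::finite) set \<Rightarrow> real^'n \<Rightarrow> real" where
  "bump_sum c r P x = (\<Sum>p\<in>P. bump c r (x - p))"

definition bump_sum_gradient :: "real \<Rightarrow> real \<Rightarrow> (real^'n::finite) set \<Rightarrow> real^'n \<Rightarrow> real^'n" where
  "bump_sum_gradient c r P x = (\<Sum>p\<in>P. bump_gradient c r (x - p))"

lemma bump_sum_has_gradient: "GDERIV (bump_sum c r P) x :> bump_sum_gradient c r P x"
proof -
  have "((\<lambda>x. bump c r (x - p)) has_derivative (\<lambda>h. h \<bullet> bump_gradient c r (x - p))) (at x)" for p
    by (rule has_derivative_compose[of "\<lambda>x. x - p" "\<lambda>h. h" x UNIV "bump c r" "\<lambda>h. h \<bullet> bump_gradient c r (x - p)"])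
      (use bump_has_gradient[of c r "x - p"] in \<open>auto simp: gderiv_def intro!: derivative_eq_intros\<close>)
  then have "((\<lambda>x. \<Sum>p\<in>P. bump c r (x - p)) has_derivative (\<lambda>h. \<Sum>p\<in>P. h \<bullet> bump_gradient c r (x - p))) (at x)"
    by (intro has_derivative_sum)
  then show ?thesis
    by (simp add: gderiv_def bump_sum_def[abs_def] bump_sum_gradient_def inner_sum_right)
qed

context
  fixes c r :: real and Z :: "(real^'n::finite) set"
  assumes c: "c > 0" and r: "r > 0" and Z: "finite Z"
    and separated: "\<And>p q. p \<in> Z \<Longrightarrow> q \<in> Z \<Longrightarrow> p \<noteq> q \<Longrightarrow> 2 * r \<le> norm (p - q)"
begin

lemma bump_sum_gradient_near:
  assumes P: "P \<subseteq> Z" and p: "p \<in> Z" and near: "norm (x - p) < r"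
  shows "bump_sum_gradient c r P x = (if p \<in> P then bump_gradient c r (x - p) else 0)"
proof -
  have "bump_gradient c r (x - q) = 0" if "q \<in> P" "q \<noteq> p" for q
  proof -
    have "2 * r \<le> norm (p - q)" using separated[of p q] p P that by auto
    also have "p - q = (x - q) - (x - p)" by simp
    also have "norm \<dots> \<le> norm (x - q) + norm (x - p)" by (rule norm_triangle_ineq4)
    finally show ?thesis using near r by (intro bump_outside) auto
  qed
  moreover have "finite P" using P Z by (rule finite_subset)
  ultimately have "bump_sum_gradient c r P x = (\<Sum>q\<in>P. if q = p then bump_gradient c r (x - p) else 0)"
    unfolding bump_sum_gradient_def by (intro sum.cong) auto
  then show ?thesis using \<open>finite P\<close> by simp
qed

lemma bump_sum_gradient_far:
  assumes P: "P \<subseteq> Z" and far: "\<And>p. p \<in> P \<Longrightarrow> r \<le> norm (x - p)"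
  shows "bump_sum_gradient c r P x = 0"
  unfolding bump_sum_gradient_def by (intro sum.neutral ballI bump_outside(2)) (use r far in auto)

lemma norm_bump_sum_gradient_le:
  assumes P: "P \<subseteq> Z"
  shows "norm (bump_sum_gradient c r P x) \<le> 8 * c * r ^ 3"
proof (cases "\<exists>p\<in>P. norm (x - p) < r")
  case True
  then obtain p where p: "p \<in> P" "norm (x - p) < r" by blast
  have "norm (bump_gradient c r (x - p)) \<le> 8 * c * r\<^sup>2 * max 0 (r - norm (x - p))"
    using c r by (intro norm_bump_gradient_le) auto
  also have "\<dots> \<le> 8 * c * r\<^sup>2 * r" using c r by (intro mult_left_mono) auto
  finally show ?thesis
    using bump_sum_gradient_near[OF P, of p x] p P by (auto simp: power2_eq_square power3_eq_cube)
next
  case False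
  then show ?thesis using bump_sum_gradient_far[OF P, of x] c r by (auto simp: not_less)
qed

text \<open>
  Inside one ball this is the estimate for a single bump. Between two balls, the gradients are bounded by the
  distances to the respective spheres, and these distances together are at most \<open>norm (x - y)\<close>, because the balls are disjoint.
\<close>

lemma bump_sum_gradient_lipschitz:
  assumes P: "P \<subseteq> Z"
  shows "norm (bump_sum_gradient c r P x - bump_sum_gradient c r P y) \<le> 12 * c * r\<^sup>2 * norm (x - y)"
proof -
  have single: "norm (bump_sum_gradient c r P x - bump_sum_gradient c r P y) \<le> 12 * c * r\<^sup>2 * norm (x - y)"
    if p: "p \<in> P" "norm (x - p) < r" and y: "norm (y - p) < r \<or> (\<forall>q\<in>P. r \<le> norm (y - q))" for x y p
  proof -
    have "bump_sum_gradient c r P x = bump_gradient c r (x - p)"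
      using bump_sum_gradient_near[OF P, of p x] p P by auto
    moreover have "bump_sum_gradient c r P y = bump_gradient c r (y - p)"
      using y
    proof
      assume "norm (y - p) < r"
      then show ?thesis using bump_sum_gradient_near[OF P, of p y] p P by auto
    next
      assume far: "\<forall>q\<in>P. r \<le> norm (y - q)"
      then show ?thesis using bump_sum_gradient_far[OF P, of y] bump_outside(2)[of r "y - p" c] p r by auto
    qed
    ultimately show ?thesis
      using bump_gradient_lipschitz[of c r "x - p" "y - p"] c r by simp
  qed
  show ?thesis
  proof (cases "\<exists>p\<in>P. norm (x - p) < r")
    case True
    then obtain p where p: "p \<in> P" "norm (x - p) < r" by blast
    show ?thesis
    proof (cases "norm (y - p) < r \<or> (\<forall>q\<in>P. r \<le> norm (y - q))")
      case True
      then show ?thesis using single[OF p] by blast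
    next
      case False
      then obtain q where q: "q \<in> P" "norm (y - q) < r" "q \<noteq> p" by (auto simp: not_le)
      have "2 * r \<le> norm (p - q)" using separated[of p q] p q P by auto
      also have "p - q = (y - q) - (x - p) + (x - y)" by simp
      also have "norm \<dots> \<le> norm (y - q) + norm (x - p) + norm (x - y)"
        by (intro order_trans[OF norm_triangle_ineq] add_right_mono norm_triangle_ineq4)
      finally have gap: "(r - norm (x - p)) + (r - norm (y - q)) \<le> norm (x - y)" by simp
      have "bump_sum_gradient c r P x = bump_gradient c r (x - p)"
        "bump_sum_gradient c r P y = bump_gradient c r (y - q)"
        using bump_sum_gradient_near[OF P, of p x] bump_sum_gradient_near[OF P, of q y] p q P by auto
      then have "norm (bump_sum_gradient c r P x - bump_sum_gradient c r P y)
          \<le> norm (bump_gradient c r (x - p)) + norm (bump_gradient c r (y - q))"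
        by (simp add: norm_triangle_ineq4)
      also have "\<dots> \<le> 8 * c * r\<^sup>2 * max 0 (r - norm (x - p)) + 8 * c * r\<^sup>2 * max 0 (r - norm (y - q))"
        using c r by (intro add_mono norm_bump_gradient_le) auto
      also have "\<dots> = 8 * c * r\<^sup>2 * ((r - norm (x - p)) + (r - norm (y - q)))"
        using p q by (simp add: algebra_simps)
      also have "\<dots> \<le> 8 * c * r\<^sup>2 * norm (x - y)" using c gap by (intro mult_left_mono) auto
      also have "\<dots> \<le> 12 * c * r\<^sup>2 * norm (x - y)" using c by (intro mult_right_mono) auto
      finally show ?thesis .
    qed
  next
    case False
    then have x: "\<forall>q\<in>P. r \<le> norm (x - q)" by (auto simp: not_less)
    show ?thesis
    proof (cases "\<exists>p\<in>P. norm (y - p) < r")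
      case True
      then obtain p where "p \<in> P" "norm (y - p) < r" by blast
      then show ?thesis using single[of p y x] x by (simp add: norm_minus_commute)
    next
      case False
      then show ?thesis using x bump_sum_gradient_far[OF P] c by (auto simp: not_less)
    qed
  qed
qed

lemma bump_sum_outside:
  assumes P: "P \<subseteq> Z" and centers: "\<And>p i. p \<in> Z \<Longrightarrow> \<bar>p $ i\<bar> + r \<le> l" and x: "l < \<bar>x $ i\<bar>"
  shows "bump_sum c r P x = 0"
  unfolding bump_sum_def
proof (intro sum.neutral ballI bump_outside(1))
  fix p assume "p \<in> P"
  then have "\<bar>p $ i\<bar> + r \<le> l" using centers P by blast
  then have "r \<le> \<bar>(x - p) $ i\<bar>" using x by simp
  also have "\<dots> \<le> norm (x - p)" by (rule component_le_norm_cart)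
  finally show "r \<le> norm (x - p)" .
qed (use r in simp)

text \<open>
  The gradient of a bump is small at the centre and at the boundary, but not in the ball of radius \<open>r / 3\<close> around a point
  half way between them, where \<open>r / 6 \<le> norm x \<le> 5 r / 6\<close>.
\<close>

lemma bump_gradient_large:
  assumes e: "norm e = 1" and x: "norm (x - (r / 2) *\<^sub>R e) < r / 3"
  shows "norm x < r" "5 / 9 * c * r ^ 3 \<le> norm (bump_gradient c r x)"
proof -
  have he: "norm ((r / 2) *\<^sub>R e) = r / 2" using e r by simp
  have "norm x \<le> r / 2 + norm (x - (r / 2) *\<^sub>R e)" "r / 2 \<le> norm x + norm (x - (r / 2) *\<^sub>R e)"
    using norm_triangle_ineq[of "(r / 2) *\<^sub>R e" "x - (r / 2) *\<^sub>R e"]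
      norm_triangle_ineq4[of x "x - (r / 2) *\<^sub>R e"] he by auto
  then have s: "r / 6 \<le> norm x" "norm x \<le> 5 * r / 6" using x by auto
  then show nx: "norm x < r" using r by simp
  have "0 \<le> (norm x - r / 6) * (5 * r / 6 - norm x)" using s by simp
  then have "5 / 36 * r\<^sup>2 \<le> (r - norm x) * norm x" by (simp add: field_simps power2_eq_square)
  then have "r * (5 / 36 * r\<^sup>2) \<le> (r + norm x) * ((r - norm x) * norm x)"
    by (intro mult_mono[OF _ \<open>5 / 36 * r\<^sup>2 \<le> _\<close>]) (use r nx in auto)
  then have "4 * c * (r * (5 / 36 * r\<^sup>2)) \<le> 4 * c * ((r + norm x) * ((r - norm x) * norm x))"
    using c by (intro mult_left_mono) auto
  also have "\<dots> = norm (bump_gradient c r x)"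
    using nx c r by (subst norm_bump_gradient) (auto simp: algebra_simps power2_eq_square)
  finally show "5 / 9 * c * r ^ 3 \<le> norm (bump_gradient c r x)" by (simp add: power2_eq_square power3_eq_cube)
qed

lemma bump_sum_difference_quotient:
  assumes P: "P \<subseteq> Z"
  shows "(8 * c * r ^ 3)-lipschitz_on UNIV (bump_sum c r P)"
    and "(\<lambda>j. real (Suc j) * (bump_sum c r P (x + axis i (1 / real (Suc j))) - bump_sum c r P x))
      \<longlonglongrightarrow> bump_sum_gradient c r P x $ i"
proof -
  have deriv: "(bump_sum c r P has_derivative (\<lambda>h. h \<bullet> bump_sum_gradient c r P x)) (at x)" for x
    using bump_sum_has_gradient[of c r P x] by (simp add: gderiv_def)
  show "(8 * c * r ^ 3)-lipschitz_on UNIV (bump_sum c r P)"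
    using bump_sum_has_gradient norm_bump_sum_gradient_le[OF P] by (rule lipschitz_if_gradient_bounded)
  define h where "h t = bump_sum c r P (x + t *\<^sub>R axis i 1)" for t
  have "((\<lambda>t. x + t *\<^sub>R axis i 1) has_derivative (\<lambda>t. t *\<^sub>R axis i 1)) (at 0)"
    by (auto intro!: derivative_eq_intros)
  from has_derivative_compose[OF this, of "bump_sum c r P" "\<lambda>h. h \<bullet> bump_sum_gradient c r P x"] deriv[of x]
  have "(h has_derivative (\<lambda>t. (t *\<^sub>R axis i 1) \<bullet> bump_sum_gradient c r P x)) (at 0)"
    unfolding h_def by simp
  moreover have "(\<lambda>t. (t *\<^sub>R axis i 1) \<bullet> bump_sum_gradient c r P x) = (*) (bump_sum_gradient c r P x $ i)"
    by (simp add: fun_eq_iff inner_axis')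
  ultimately have "(h has_real_derivative bump_sum_gradient c r P x $ i) (at 0)"
    unfolding has_field_derivative_def by metis
  then have "((\<lambda>s. (h s - h 0) / s) \<longlongrightarrow> bump_sum_gradient c r P x $ i) (at 0)"
    by (simp add: has_field_derivative_iff)
  moreover have "filterlim (\<lambda>m. inverse (real (Suc m))) (at 0) sequentially"
    by (intro filterlim_atI LIMSEQ_inverse_real_of_nat) auto
  ultimately have lim: "(\<lambda>m. (h (inverse (real (Suc m))) - h 0) / inverse (real (Suc m))) \<longlonglongrightarrow> bump_sum_gradient c r P x $ i"
    by (rule filterlim_compose)
  have ax: "s *\<^sub>R axis i 1 = (axis i s :: real^'n)" for s by (auto simp: vec_eq_iff axis_def)
  show "(\<lambda>j. real (Suc j) * (bump_sum c r P (x + axis i (1 / real (Suc j))) - bump_sum c r P x))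
      \<longlonglongrightarrow> bump_sum_gradient c r P x $ i"
    using lim by (simp add: h_def ax axis_0 inverse_eq_divide mult.commute del: of_nat_Suc)
qed

text \<open>
  At each position that belongs to exactly one of the sets, the difference of the gradients is the gradient of one
  bump, which is large on a ball of radius \<open>r / 3\<close>; these balls are disjoint.
\<close>

lemma W11_dist_bump_sum_ge:
  assumes P: "P \<subseteq> Z" "Q \<subseteq> Z" and centers: "\<And>p i. p \<in> Z \<Longrightarrow> \<bar>p $ i\<bar> + r \<le> l"
  shows "real (card ((P - Q) \<union> (Q - P))) * (5 / 9 * c * r ^ 3 * ((r / 3) ^ CARD('n) * ball_vol TYPE('n)))
    \<le> W11_dist (W11_class (bump_sum c r P)) (W11_class (bump_sum c r Q))"
proof -
  let ?D = "(P - Q) \<union> (Q - P)"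
  let ?b = "5 / 9 * c * r ^ 3"
  note wP = bump_sum_difference_quotient[OF P(1)] and wQ = bump_sum_difference_quotient[OF P(2)]
  define d where "d x = bump_sum c r P x - bump_sum c r Q x" for x
  define g where "g x = bump_sum_gradient c r P x - bump_sum_gradient c r Q x" for x
  have d_lip: "(8 * c * r ^ 3 + 8 * c * r ^ 3)-lipschitz_on UNIV d"
    unfolding d_def by (intro lipschitz_on_diff wP(1) wQ(1))
  have zP: "bump_sum c r P x = 0" and zQ: "bump_sum c r Q x = 0" if "l < \<bar>x $ i\<bar>" for x i
    using bump_sum_outside[OF P(1) centers that] bump_sum_outside[OF P(2) centers that] by auto
  have d_zero: "d x = 0" if "l < \<bar>x $ i\<bar>" for x i using zP[OF that] zQ[OF that] by (simp add: d_def)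
  have d_lim: "(\<lambda>j. real (Suc j) * (d (x + axis i (1 / real (Suc j))) - d x)) \<longlonglongrightarrow> g x $ i" for x i
    using tendsto_diff[OF wP(2)[of x i] wQ(2)[of x i]] by (simp add: d_def g_def algebra_simps del: of_nat_Suc)
  note wd = lipschitz_weak_gradient[OF d_lip d_zero d_lim]
  have W: "bump_sum c r P \<in> W11_fun" "bump_sum c r Q \<in> W11_fun"
    using lipschitz_weak_gradient(7)[OF wP(1) zP wP(2)] lipschitz_weak_gradient(7)[OF wQ(1) zQ wQ(2)] by auto
  define e :: "real^'n" where "e = axis undefined 1"
  have e: "norm e = 1" by (simp add: e_def)
  define S where "S p = ball (p + (r / 2) *\<^sub>R e) (r / 3)" for p
  have near: "norm (x - p) < r" "?b \<le> norm (bump_gradient c r (x - p))" if "x \<in> S p" for x p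
  proof -
    have "norm ((x - p) - (r / 2) *\<^sub>R e) < r / 3"
      using that by (simp add: S_def dist_norm norm_minus_commute algebra_simps)
    then show "norm (x - p) < r" "?b \<le> norm (bump_gradient c r (x - p))"
      using bump_gradient_large[OF e] by auto
  qed
  have D: "finite ?D" "?D \<subseteq> Z" using P Z by (auto intro: finite_subset)
  have lower: "(\<Sum>p\<in>?D. ?b * indicator (S p) x) \<le> norm (g x)" for x
  proof (cases "\<exists>p\<in>?D. x \<in> S p")
    case True
    then obtain p where p: "p \<in> ?D" "x \<in> S p" by blast
    have "x \<notin> S q" if "q \<in> ?D" "q \<noteq> p" for q
    proof
      assume "x \<in> S q"
      have "2 * r \<le> norm (p - q)" using separated[of p q] p that D by auto
      also have "p - q = (x - q) - (x - p)" by simp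
      also have "norm \<dots> \<le> norm (x - q) + norm (x - p)" by (rule norm_triangle_ineq4)
      finally show False using near(1)[OF p(2)] near(1)[OF \<open>x \<in> S q\<close>] by simp
    qed
    then have "(\<Sum>q\<in>?D. ?b * indicator (S q) x) = (\<Sum>q\<in>?D. if q = p then ?b else 0)"
      using p by (intro sum.cong) auto
    also have "\<dots> = ?b" using D p by simp
    also have "\<dots> \<le> norm (bump_gradient c r (x - p))" by (rule near(2)[OF p(2)])
    also have "\<dots> = norm (g x)"
      using bump_sum_gradient_near[OF P(1) _ near(1)[OF p(2)]] bump_sum_gradient_near[OF P(2) _ near(1)[OF p(2)]] p D
      by (auto simp: g_def)
    finally show ?thesis .
  next
    case False
    then have "(\<Sum>p\<in>?D. ?b * indicator (S p) x) = 0" by (intro sum.neutral) auto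
    then show ?thesis by simp
  qed
  have int: "integrable lborel (\<lambda>x. ?b * indicator (S p) x)" for p
    unfolding S_def
    by (intro integrable_mult_right integrable_real_indicator emeasure_bounded_finite) auto
  have vol: "measure lborel (S p) = (r / 3) ^ CARD('n) * ball_vol TYPE('n)" for p
    unfolding S_def ball_vol_def using r
    by (subst content_ball_conv_unit_ball) (auto simp: measure_completion)
  have "real (card ?D) * (?b * ((r / 3) ^ CARD('n) * ball_vol TYPE('n))) = (\<Sum>p\<in>?D. ?b * measure lborel (S p))"
    unfolding vol by simp
  also have "\<dots> = (\<Sum>p\<in>?D. integral\<^sup>L lborel (\<lambda>x. ?b * indicator (S p) x))" by simp
  also have "\<dots> = integral\<^sup>L lborel (\<lambda>x. \<Sum>p\<in>?D. ?b * indicator (S p) x)"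
    by (intro Bochner_Integration.integral_sum[symmetric] int)
  also have "\<dots> \<le> integral\<^sup>L lborel (\<lambda>x. norm (g x))"
    using wd(4) by (intro integral_mono lower Bochner_Integration.integrable_sum int) auto
  also have "\<dots> \<le> integral\<^sup>L lborel (\<lambda>x. \<bar>d x\<bar>) + integral\<^sup>L lborel (\<lambda>x. norm (g x))" by simp
  also have "\<dots> = W11_dist (W11_class (bump_sum c r P)) (W11_class (bump_sum c r Q))"
  proof -
    have "integrable lebesgue g" using wd(4) wd(2) integrable_completion[of g lborel] by simp
    then have "W11_dist (W11_class (bump_sum c r P)) (W11_class (bump_sum c r Q)) =
        integral\<^sup>L lebesgue (\<lambda>x. \<bar>d x\<bar>) + integral\<^sup>L lebesgue (\<lambda>x. norm (g x))"
      unfolding d_def using wd(6) by (intro W11_dist_class W) (auto simp: d_def)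
    then show ?thesis using wd(1,2) by (simp add: integral_completion)
  qed
  finally show ?thesis by simp
qed

end

section \<open>Packing bounds for the metric entropy\<close>

text \<open>
  The covering number is attained, being the infimum of a set of extended natural numbers.
\<close>

lemma metric_entropy_ge:
  assumes "\<And>\<U>. finite \<U> \<Longrightarrow> K \<subseteq> \<Union>\<U> \<Longrightarrow> (\<And>A x y. A \<in> \<U> \<Longrightarrow> x \<in> A \<Longrightarrow> y \<in> A \<Longrightarrow> d x y \<le> 2 * \<epsilon>) \<Longrightarrow> v \<le> log 2 (real (card \<U>))"
  shows "ereal v \<le> metric_entropy X d K \<epsilon>"
proof -
  define W where "W = {enat (card \<U>) | \<U>. finite \<U> \<and> K \<subseteq> \<Union>\<U> \<and>
      (\<forall>A\<in>\<U>. A \<subseteq> X \<and> (\<forall>x\<in>A. \<forall>y\<in>A. d x y \<le> 2 * \<epsilon>))}"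
  have cov: "covering_number X d K \<epsilon> = Inf W" by (simp add: covering_number_def W_def)
  show ?thesis
  proof (cases "W = {}")
    case True
    then show ?thesis by (simp add: metric_entropy_def cov Inf_enat_def)
  next
    case False
    then obtain w where "w \<in> W" by blast
    then have "(LEAST x. x \<in> W) \<in> W" by (rule LeastI)
    then have "Inf W \<in> W" using False by (simp add: Inf_enat_def)
    moreover have "\<exists>\<U>. x = enat (card \<U>) \<and> finite \<U> \<and> K \<subseteq> \<Union>\<U> \<and>
        (\<forall>A\<in>\<U>. A \<subseteq> X \<and> (\<forall>x\<in>A. \<forall>y\<in>A. d x y \<le> 2 * \<epsilon>))" if "x \<in> W" for x
      using that by (simp add: W_def)
    ultimately obtain \<U> where \<U>: "Inf W = enat (card \<U>)" "finite \<U>" "K \<subseteq> \<Union>\<U>"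
      "\<forall>A\<in>\<U>. A \<subseteq> X \<and> (\<forall>x\<in>A. \<forall>y\<in>A. d x y \<le> 2 * \<epsilon>)" by meson
    then have "v \<le> log 2 (real (card \<U>))" by (intro assms) auto
    then show ?thesis by (simp add: metric_entropy_def cov \<U>(1))
  qed
qed

text \<open>
  Weighting \<open>D\<close> with \<open>(1 / 2) ^ card D\<close> gives total weight \<open>(1 + 1 / 2) ^ card Z\<close>.
\<close>

lemma card_small_subsets_le:
  assumes Z: "finite Z"
  shows "real (card {D. D \<subseteq> Z \<and> card D \<le> t}) \<le> (3 / 2) ^ card Z * 2 ^ t"
proof -
  let ?B = "{D. D \<subseteq> Z \<and> card D \<le> t}"
  have "real (card ?B) * (1 / 2) ^ t \<le> (\<Sum>D\<in>?B. (1 / 2) ^ card D)"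
    by (rule sum_bounded_below) (auto intro: power_decreasing)
  also have "\<dots> \<le> (\<Sum>D\<in>Pow Z. (1 / 2) ^ card D)"
    using Z by (intro sum_mono2) auto
  also have "\<dots> = (\<Prod>z\<in>Z. 1 / 2 + 1)"
    by (subst prod_add[OF Z]) simp
  also have "\<dots> = (3 / 2 :: real) ^ card Z" by simp
  finally show ?thesis by (simp add: field_simps)
qed

lemma card_subsets_small_diameter_le:
  assumes Z: "finite Z" and A: "\<And>P. P \<in> \<A> \<Longrightarrow> P \<subseteq> Z"
    and diam: "\<And>P Q. P \<in> \<A> \<Longrightarrow> Q \<in> \<A> \<Longrightarrow> card ((P - Q) \<union> (Q - P)) \<le> t"
  shows "real (card \<A>) \<le> (3 / 2) ^ card Z * 2 ^ t"
proof (cases "\<A> = {}")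
  case False
  then obtain Q where Q: "Q \<in> \<A>" by blast
  have "inj_on (\<lambda>P. (P - Q) \<union> (Q - P)) \<A>"
  proof (rule inj_onI)
    fix P P' assume eq: "(P - Q) \<union> (Q - P) = (P' - Q) \<union> (Q - P')"
    show "P = P'" using eq by blast
  qed
  moreover have "(\<lambda>P. (P - Q) \<union> (Q - P)) ` \<A> \<subseteq> {D. D \<subseteq> Z \<and> card D \<le> t}"
    using A Q diam by blast
  moreover have "finite {D. D \<subseteq> Z \<and> card D \<le> t}" using Z by (rule rev_finite_subset[OF finite_Pow_iff[THEN iffD2]]) auto
  ultimately have "card \<A> \<le> card {D. D \<subseteq> Z \<and> card D \<le> t}" by (rule card_inj_on_le)
  then have "real (card \<A>) \<le> real (card {D. D \<subseteq> Z \<and> card D \<le> t})" by simp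
  also note card_small_subsets_le[OF Z]
  finally show ?thesis .
qed simp

text \<open>
  Two subsets whose images lie in one set of diameter \<open>2 \<epsilon>\<close> have Hamming distance at most \<open>card Z / 8\<close>, so the set
  contains the images of at most \<open>(3 / 2) ^ n * 2 ^ (n / 8)\<close> subsets, where \<open>n = card Z\<close>. As \<open>log\<^sub>2 (3 / 2) \<le> 5 / 8\<close>, this is at most
  \<open>2 ^ (3 n / 4)\<close> of the \<open>2 ^ n\<close> subsets.
\<close>

theorem metric_entropy_ge_if_hamming:
  assumes Z: "finite Z" and \<beta>: "\<beta> > 0" and \<epsilon>: "16 * \<epsilon> \<le> real (card Z) * \<beta>"
    and inK: "\<And>P. P \<subseteq> Z \<Longrightarrow> w P \<in> K"
    and sep: "\<And>P Q. P \<subseteq> Z \<Longrightarrow> Q \<subseteq> Z \<Longrightarrow> real (card ((P - Q) \<union> (Q - P))) * \<beta> \<le> d (w P) (w Q)"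
  shows "ereal (real (card Z) / 4) \<le> metric_entropy X d K \<epsilon>"
proof (rule metric_entropy_ge)
  fix \<U> assume \<U>: "finite \<U>" "K \<subseteq> \<Union>\<U>" and diam: "\<And>A x y. A \<in> \<U> \<Longrightarrow> x \<in> A \<Longrightarrow> y \<in> A \<Longrightarrow> d x y \<le> 2 * \<epsilon>"
  define n where "n = card Z"
  define B where "B A = {P. P \<subseteq> Z \<and> w P \<in> A}" for A
  have B_le: "real (card (B A)) \<le> (3 / 2) ^ n * 2 ^ (n div 8)" if "A \<in> \<U>" for A
    unfolding n_def
  proof (rule card_subsets_small_diameter_le[OF Z])
    fix P Q assume PQ: "P \<in> B A" "Q \<in> B A"
    have "real (card ((P - Q) \<union> (Q - P))) * \<beta> \<le> 2 * \<epsilon>"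
      using order_trans[OF sep diam[OF that]] PQ by (auto simp: B_def)
    then have "8 * (real (card ((P - Q) \<union> (Q - P))) * \<beta>) \<le> real (card Z) * \<beta>" using \<epsilon> by linarith
    then have "(8 * real (card ((P - Q) \<union> (Q - P)))) * \<beta> \<le> real (card Z) * \<beta>" by simp
    then have "8 * real (card ((P - Q) \<union> (Q - P))) \<le> real (card Z)" using \<beta> by (simp only: mult_le_cancel_right_pos)
    then show "card ((P - Q) \<union> (Q - P)) \<le> card Z div 8" by linarith
  qed (auto simp: B_def)
  have "Pow Z \<subseteq> (\<Union>A\<in>\<U>. B A)"
  proof
    fix P assume "P \<in> Pow Z"
    then have P: "P \<subseteq> Z" by simp
    then obtain A where "A \<in> \<U>" "w P \<in> A" using inK \<U>(2) by blast
    then show "P \<in> (\<Union>A\<in>\<U>. B A)" using P by (auto simp: B_def)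
  qed
  moreover have "finite (\<Union>A\<in>\<U>. B A)" using \<U>(1) Z by (auto simp: B_def)
  ultimately have "card (Pow Z) \<le> card (\<Union>A\<in>\<U>. B A)" by (rule card_mono[rotated])
  also have "\<dots> \<le> (\<Sum>A\<in>\<U>. card (B A))" by (rule card_UN_le[OF \<U>(1)])
  finally have "real (2 ^ n) \<le> real (\<Sum>A\<in>\<U>. card (B A))" using Z by (simp only: card_Pow n_def of_nat_le_iff)
  also have "\<dots> = (\<Sum>A\<in>\<U>. real (card (B A)))" by simp
  also have "\<dots> \<le> (\<Sum>A\<in>\<U>. (3 / 2) ^ n * 2 ^ (n div 8))" by (intro sum_mono B_le)
  finally have main: "2 ^ n \<le> real (card \<U>) * ((3 / 2) ^ n * 2 ^ (n div 8))" by simp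
  then have pos: "real (card \<U>) > 0" 
    by (metis mult_eq_0_iff not_le of_nat_0_less_iff of_nat_0 neq0_conv zero_less_numeral zero_less_power)
  have "log 2 (2 ^ n) \<le> log 2 (real (card \<U>) * ((3 / 2) ^ n * 2 ^ (n div 8)))"
    using main pos by (subst log_le_cancel_iff) auto
  also have "\<dots> = log 2 (real (card \<U>)) + real n * log 2 (3 / 2) + real (n div 8)"
    using pos by (simp add: log_mult log_nat_power)
  finally have "real n \<le> log 2 (real (card \<U>)) + real n * log 2 (3 / 2) + real (n div 8)"
    by (simp add: log_nat_power)
  moreover have "log 2 (3 / 2) \<le> 5 / 8"
  proof -
    have "8 * log 2 (3 / 2) = log 2 ((3 / 2) ^ 8)" by (simp add: log_nat_power)
    also have "\<dots> \<le> log 2 (2 ^ 5)" by (subst log_le_cancel_iff) (auto simp: power_divide)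
    also have "\<dots> = 5" by (simp only: log_nat_power log_eq_one)
    finally show ?thesis by simp
  qed
  then have "real n * log 2 (3 / 2) \<le> real n * (5 / 8)" by (intro mult_left_mono) auto
  moreover have "real (n div 8) \<le> real n / 8" by linarith
  ultimately show "real (card Z) / 4 \<le> log 2 (real (card \<U>))" unfolding n_def by linarith
qed

section \<open>Hessian bounds and the volume of the unit ball\<close>

text \<open>
  Integrating twice along the segment from \<open>p\<close> to \<open>p'\<close>.
\<close>

lemma strong_convexity_of_hessian:
  fixes H :: "real^'n::finite \<Rightarrow> real"
  assumes gradient: "\<And>p. GDERIV H p :> DH p"
    and hessian: "\<And>p. (DH has_derivative (\<lambda>h. D2H p *v h)) (at p)"
    and convex: "\<And>p. positive_semidefinite (D2H p - \<alpha> *\<^sub>R mat 1)"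
  shows "H p + DH p \<bullet> (p' - p) + \<alpha> / 2 * (norm (p' - p))\<^sup>2 \<le> H p'"
proof -
  define v where "v = p' - p"
  have line: "((\<lambda>t. p + t *\<^sub>R v) has_derivative (\<lambda>s. s *\<^sub>R v)) (at t)" for t
    by (auto intro!: derivative_eq_intros)
  have H': "((\<lambda>t. H (p + t *\<^sub>R v)) has_real_derivative DH (p + t *\<^sub>R v) \<bullet> v) (at t)" for t
  proof -
    have "(H has_derivative (\<lambda>h. h \<bullet> DH (p + t *\<^sub>R v))) (at (p + t *\<^sub>R v))"
      using gradient by (simp add: gderiv_def)
    from has_derivative_compose[OF line this] show ?thesis
      unfolding has_field_derivative_def by (rule has_derivative_eq_rhs) (auto simp: inner_commute)
  qed
  have DH': "((\<lambda>t. DH (p + t *\<^sub>R v) \<bullet> v) has_real_derivative (D2H (p + t *\<^sub>R v) *v v) \<bullet> v) (at t)" for t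
  proof -
    from has_derivative_inner_left[OF has_derivative_compose[OF line hessian], of v]
    show ?thesis
      unfolding has_field_derivative_def
      by (rule has_derivative_eq_rhs) (auto simp: matrix_vector_mult_scaleR)
  qed
  have hess: "\<alpha> * (norm v)\<^sup>2 \<le> (D2H q *v v) \<bullet> v" for q
  proof -
    have "0 \<le> v \<bullet> ((D2H q - \<alpha> *\<^sub>R mat 1) *v v)" using convex by (simp add: positive_semidefinite_def)
    also have "\<dots> = (D2H q *v v) \<bullet> v - \<alpha> * (norm v)\<^sup>2"
      by (simp add: matrix_vector_mult_diff_rdistrib scaleR_matrix_vector_assoc[symmetric] inner_diff_right
          power2_norm_eq_inner inner_commute)
    finally show ?thesis by simp
  qed
  define \<psi> where "\<psi> t = DH (p + t *\<^sub>R v) \<bullet> v - DH p \<bullet> v - \<alpha> * t * (norm v)\<^sup>2" for t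
  have \<psi>: "0 \<le> \<psi> t" if "0 \<le> t" for t
  proof -
    have "\<psi> 0 \<le> \<psi> t"
    proof (rule DERIV_nonneg_imp_nondecreasing[OF that])
      fix s
      have "(\<psi> has_real_derivative (D2H (p + s *\<^sub>R v) *v v) \<bullet> v - \<alpha> * (norm v)\<^sup>2) (at s)"
        unfolding \<psi>_def by (auto intro!: derivative_eq_intros DH')
      then show "\<exists>y. (\<psi> has_real_derivative y) (at s) \<and> 0 \<le> y" using hess[of "p + s *\<^sub>R v"] by force
    qed
    then show ?thesis by (simp add: \<psi>_def)
  qed
  define \<Phi> where "\<Phi> t = H (p + t *\<^sub>R v) - t * (DH p \<bullet> v) - \<alpha> / 2 * t\<^sup>2 * (norm v)\<^sup>2" for t
  have "\<Phi> 0 \<le> \<Phi> 1"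
  proof (rule DERIV_nonneg_imp_nondecreasing[of 0 1 \<Phi>])
    fix s :: real assume "0 \<le> s"
    moreover have "(\<Phi> has_real_derivative \<psi> s) (at s)"
      unfolding \<Phi>_def \<psi>_def by (auto intro!: derivative_eq_intros H')
    ultimately show "\<exists>y. (\<Phi> has_real_derivative y) (at s) \<and> 0 \<le> y" using \<psi> by blast
  qed simp
  then show ?thesis by (simp add: \<Phi>_def v_def algebra_simps)
qed

lemma hessian_onorm_pos:
  fixes A :: "real^'n::finite^'n"
  assumes "\<alpha> > 0" and psd: "positive_semidefinite (A - \<alpha> *\<^sub>R mat 1)"
  shows "onorm ((*v) A) > 0"
proof -
  define v :: "real^'n" where "v = axis undefined 1"
  have v: "norm v = 1" by (simp add: v_def)
  have "0 \<le> v \<bullet> ((A - \<alpha> *\<^sub>R mat 1) *v v)" using psd by (simp add: positive_semidefinite_def)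
  also have "\<dots> = v \<bullet> (A *v v) - \<alpha> * (norm v)\<^sup>2"
    by (simp add: matrix_vector_mult_diff_rdistrib scaleR_matrix_vector_assoc[symmetric] inner_diff_right
        power2_norm_eq_inner)
  finally have "\<alpha> \<le> v \<bullet> (A *v v)" using v by simp
  also have "\<dots> \<le> norm v * norm (A *v v)" by (rule norm_cauchy_schwarz)
  also have "\<dots> \<le> onorm ((*v) A)" using onorm[OF matrix_vector_mul_bounded_linear, of A v] v by simp
  finally show ?thesis using assms by simp
qed

text \<open>
  The operator norm of the Hessian is continuous at \<open>0\<close>, so it stays below \<open>\<Lambda>\<close> on a ball, which is convex.
\<close>

lemma gradient_lipschitz_near_0:
  fixes DH :: "real^'n::finite \<Rightarrow> real^'n"
  assumes hessian: "\<And>p. (DH has_derivative (\<lambda>h. D2H p *v h)) (at p)"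
    and cont: "continuous_on UNIV D2H" and less: "onorm ((*v) (D2H 0)) < \<Lambda>"
  obtains \<rho> where "\<rho> > 0" "\<And>p q. norm p \<le> \<rho> \<Longrightarrow> norm q \<le> \<rho> \<Longrightarrow> norm (DH p - DH q) \<le> \<Lambda> * norm (p - q)"
proof -
  define \<eta> where "\<eta> = (\<Lambda> - onorm ((*v) (D2H 0))) / (real CARD('n) * real CARD('n))"
  have \<eta>: "\<eta> > 0" using less by (simp add: \<eta>_def)
  have "isCont D2H 0" using cont by (simp add: continuous_on_eq_continuous_at)
  then obtain \<rho>0 where \<rho>0: "\<rho>0 > 0" "\<And>p. dist p 0 < \<rho>0 \<Longrightarrow> dist (D2H p) (D2H 0) < \<eta>"
    using \<eta> unfolding continuous_at_eps_delta by metis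
  have bound: "onorm ((*v) (D2H p)) \<le> \<Lambda>" if "norm p < \<rho>0" for p
  proof -
    have "\<bar>(D2H p - D2H 0) $ i $ j\<bar> \<le> \<eta>" for i j
    proof -
      have "\<bar>(D2H p - D2H 0) $ i $ j\<bar> \<le> norm ((D2H p - D2H 0) $ i)" by (rule component_le_norm_cart)
      also have "\<dots> \<le> norm (D2H p - D2H 0)" by (rule Finite_Cartesian_Product.norm_nth_le)
      finally show ?thesis using \<rho>0(2)[of p] that by (simp add: dist_norm)
    qed
    then have "onorm ((*v) (D2H p - D2H 0)) \<le> real CARD('n) * real CARD('n) * \<eta>"
      by (rule onorm_le_matrix_component)
    also have "\<dots> = \<Lambda> - onorm ((*v) (D2H 0))" by (simp add: \<eta>_def)
    finally have "onorm ((*v) (D2H p - D2H 0)) + onorm ((*v) (D2H 0)) \<le> \<Lambda>" by simp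
    moreover have "(*v) (D2H p) = (\<lambda>x. (D2H p - D2H 0) *v x + D2H 0 *v x)"
      by (simp add: fun_eq_iff matrix_vector_mult_diff_rdistrib)
    moreover have "onorm (\<lambda>x. (D2H p - D2H 0) *v x + D2H 0 *v x) \<le> onorm ((*v) (D2H p - D2H 0)) + onorm ((*v) (D2H 0))"
      by (intro onorm_triangle matrix_vector_mul_bounded_linear)
    ultimately show ?thesis by simp
  qed
  have "norm (DH p - DH q) \<le> \<Lambda> * norm (p - q)" if "norm p \<le> \<rho>0 / 2" "norm q \<le> \<rho>0 / 2" for p q
  proof (rule differentiable_bound[of "cball 0 (\<rho>0 / 2)"])
    show "(DH has_derivative (\<lambda>h. D2H x *v h)) (at x within cball 0 (\<rho>0 / 2))" for x
      using hessian by (rule has_derivative_at_withinI)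
    show "onorm ((*v) (D2H x)) \<le> \<Lambda>" if "x \<in> cball 0 (\<rho>0 / 2)" for x
      using that \<rho>0(1) by (intro bound) auto
  qed (use that in auto)
  then show ?thesis using that[of "\<rho>0 / 2"] \<rho>0(1) by simp
qed

text \<open>
  The cube of half side \<open>1 / N\<close> lies in the unit ball, as the Euclidean norm is at most the \<open>l\<^sup>1\<close> norm.
\<close>

lemma ball_vol_ge: "(2 / real CARD('n)) ^ CARD('n) \<le> ball_vol TYPE('n::finite)"
proof -
  define s where "s = 1 / real CARD('n)"
  have s: "s > 0" by (simp add: s_def)
  have sub: "box (\<chi> i. - s) (\<chi> i. s) \<subseteq> ball (0 :: real^'n) 1"
  proof
    fix x :: "real^'n" assume x: "x \<in> box (\<chi> i. - s) (\<chi> i. s)"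
    have "\<bar>x $ i\<bar> < s" for i using x by (auto simp: mem_box_cart abs_less_iff minus_less_iff)
    then have "(\<Sum>i\<in>UNIV. \<bar>x $ i\<bar>) < (\<Sum>i\<in>(UNIV :: 'n set). s)" by (intro sum_strict_mono) auto
    also have "\<dots> = 1" by (simp add: s_def)
    finally show "x \<in> ball 0 1" using norm_le_l1_cart[of x] by simp
  qed
  have "(\<chi> i. 0) \<in> cbox (\<chi> i. - s) ((\<chi> i. s) :: real^'n)" using s by (simp add: mem_box_cart)
  then have "measure lborel (cbox (\<chi> i. - s) ((\<chi> i. s) :: real^'n)) = (2 * s) ^ CARD('n)"
    by (subst content_cbox_cart) auto
  then have "(2 * s) ^ CARD('n) = measure lborel (box (\<chi> i. - s) ((\<chi> i. s) :: real^'n))"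
    by (simp add: measure_lborel_box_eq measure_lborel_cbox_eq)
  also have "\<dots> \<le> measure lborel (ball (0 :: real^'n) 1)"
  proof (rule measure_mono_fmeasurable[OF sub])
    show "ball (0 :: real^'n) 1 \<in> fmeasurable lborel" by (intro fmeasurableI emeasure_bounded_finite) auto
  qed simp
  also have "\<dots> = ball_vol TYPE('n)" by (simp add: ball_vol_def measure_completion)
  finally show ?thesis by (simp add: s_def)
qed

lemma ball_vol_pos: "0 < ball_vol TYPE('n::finite)"
proof -
  have "0 < (2 / real CARD('n)) ^ CARD('n)" by simp
  also note ball_vol_ge
  finally show ?thesis .
qed

text \<open>
  Here \<open>X \<ge> 1\<close> bounds \<open>l\<close> and \<open>l K\<close>. After bounding all exponents by multiples of \<open>N\<^sup>2\<close>, the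
  left side is at most \<open>180\<close> to the power \<open>N\<^sup>2\<close>, the right side at least \<open>512\<close> to the power \<open>N\<^sup>2\<close>, times
  the same powers of \<open>N\<close> and \<open>X\<close>.
\<close>

lemma Gamma_upper_ge:
  fixes DH :: "real^'n::finite \<Rightarrow> real^'n"
  assumes \<alpha>: "\<alpha> > 0" and T: "T > 0" and M: "M > 0" and l: "l = prop_radius DH L M T" "l > 0" and N: "N = CARD('n)"
  shows "4 * (3 * l) ^ N * ((3 * l) ^ N * (1 / (\<alpha> * T)) * (5 * (real N)\<^sup>2)) ^ N \<le> Gamma_upper DH \<alpha> L M T"
proof -
  define K where "K = 1 / (\<alpha> * T)"
  define X where "X = 1 + M + (K + 1) * l"
  define n where "n = real N"
  have K: "K > 0" using \<alpha> T by (simp add: K_def)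
  have N1: "N \<ge> 1" unfolding N by (simp add: Suc_leI)
  then have n: "n \<ge> 1" by (simp add: n_def)
  have "K * l > 0" using K l by simp
  then have X: "X \<ge> 1" "l \<le> X" "l * K \<le> X" using M l by (auto simp: X_def algebra_simps)
  have NN: "N \<le> N\<^sup>2" "1 \<le> N\<^sup>2" using N1 by (auto simp: power2_eq_square)
  have "4 * (3 * l) ^ N * ((3 * l) ^ N * K * (5 * n\<^sup>2)) ^ N
      = 4 ^ 1 * 3 ^ N * 5 ^ N * 3 ^ N\<^sup>2 * n ^ (N + N) * ((l * K) ^ N * l ^ N\<^sup>2)"
    by (simp add: power_mult_distrib power_mult[symmetric] power2_eq_square power_add mult_ac)
  also have "\<dots> \<le> 4 ^ N\<^sup>2 * 3 ^ N\<^sup>2 * 5 ^ N\<^sup>2 * 3 ^ N\<^sup>2 * n ^ (3 * N\<^sup>2) * (X ^ N * X ^ N\<^sup>2)"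
    using NN n X l K by (intro mult_mono power_increasing power_mono mult_nonneg_nonneg zero_le_power) auto
  also have "\<dots> = 180 ^ N\<^sup>2 * n ^ (3 * N\<^sup>2) * X ^ (N + N\<^sup>2)"
    by (simp add: power_mult_distrib[symmetric] power_add)
  also have "\<dots> \<le> 512 ^ N\<^sup>2 * n ^ (3 * N\<^sup>2) * X ^ (4 * N\<^sup>2)"
    using NN n X by (intro mult_mono power_increasing power_mono mult_nonneg_nonneg zero_le_power) auto
  also have "\<dots> = ((2 / n) ^ N) ^ N * (4 * n * X) ^ (4 * N\<^sup>2)"
  proof -
    have "(512 :: real) ^ N\<^sup>2 = 2 ^ N\<^sup>2 * 4 ^ (4 * N\<^sup>2)"
      by (simp add: power_mult power_mult_distrib[symmetric])
    moreover have "n ^ (4 * N\<^sup>2) = n ^ N\<^sup>2 * n ^ (3 * N\<^sup>2)" by (simp flip: power_add)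
    ultimately show ?thesis
      using n by (simp add: power_mult_distrib power_divide power_mult[symmetric] power2_eq_square[of N])
  qed
  also have "\<dots> \<le> ball_vol TYPE('n) ^ N * (4 * n * X) ^ (4 * N\<^sup>2)"
    using n X ball_vol_ge[where 'n='n] unfolding n_def N
    by (intro mult_right_mono power_mono) auto
  also have "\<dots> = Gamma_upper DH \<alpha> L M T"
    by (simp add: Gamma_upper_def Let_def N n_def X_def K_def l(1))
  finally show ?thesis by (simp add: K_def n_def)
qed

section \<open>The entropy estimates\<close>

lemma norm_le_SUP_ball:
  fixes D :: "real^'n::finite \<Rightarrow> real^'n"
  assumes cont: "continuous_on UNIV D" and p: "norm p \<le> M"
  shows "norm (D p) \<le> (SUP p\<in>{p. norm p \<le> M}. norm (D p))"
proof -
  have "compact {p::real^'n. norm p \<le> M}" using compact_cball[of "0::real^'n" M] by (simp add: cball_def dist_norm)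
  then have "bounded (D ` {p. norm p \<le> M})"
    by (intro compact_imp_bounded compact_continuous_image continuous_on_subset[OF cont]) auto
  then have "bdd_above ((\<lambda>p. norm (D p)) ` {p. norm p \<le> M})"
    unfolding bounded_iff bdd_above_def by auto
  then show ?thesis using p by (intro cSUP_upper) auto
qed

context convex_hamiltonian
begin

lemma solutions_in_semiconcave_class:
  assumes DH0: "DH 0 = 0" and cont: "continuous_on UNIV DH" and S: "viscosity_semigroup H S" and T: "T > 0"
    and u0: "u0 \<in> initial_data L M"
  shows "(\<lambda>x. S T u0 x + T * H 0) \<in> semiconcave_class M (1 / (\<alpha> * T)) (prop_radius DH L M T)"
proof -
  have lip: "M-lipschitz_on UNIV u0" and supp: "\<And>x i. L < \<bar>x $ i\<bar> \<Longrightarrow> u0 x = 0"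
    using u0 by (auto simp: initial_data_iff)
  have eq: "(\<lambda>x. S T u0 x + T * H 0) = (\<lambda>x. hopf_lax u0 T x + T * H 0)"
    using semigroup_eq_hopf_lax[OF S lip] T by simp
  have "M-lipschitz_on UNIV (hopf_lax u0 T)" using hopf_lax_lipschitz_space[OF lip] T by simp
  then have "M-lipschitz_on UNIV (\<lambda>x. hopf_lax u0 T x + T * H 0)"
    by (simp add: lipschitz_on_def)
  moreover have "semiconcave_along i (1 / (\<alpha> * T)) (\<lambda>x. hopf_lax u0 T x + T * H 0)" for i
    unfolding semiconcave_along_def semiconcave1_def
  proof (intro allI)
    fix x s
    obtain P where P: "\<And>v. hopf_lax u0 T (x + axis i s + v) \<le> hopf_lax u0 T (x + axis i s) + P \<bullet> v + (norm v)\<^sup>2 / (2 * \<alpha> * T)"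
      using hopf_lax_semiconcave[OF lip T, of "x + axis i s"] by blast
    have "hopf_lax u0 T (x + axis i (s + t)) + T * H 0 \<le> hopf_lax u0 T (x + axis i s) + T * H 0 + P $ i * t + 1 / (\<alpha> * T) * t\<^sup>2 / 2" for t
      using P[of "axis i t"] by (simp add: axis_add add.assoc norm_axis_real inner_axis mult_ac)
    then show "\<exists>p. \<forall>t. hopf_lax u0 T (x + axis i (s + t)) + T * H 0 \<le> hopf_lax u0 T (x + axis i s) + T * H 0 + p * t + 1 / (\<alpha> * T) * t\<^sup>2 / 2"
      by blast
  qed
  moreover have "hopf_lax u0 T x + T * H 0 = 0" if "prop_radius DH L M T < \<bar>x $ i\<bar>" for x i
  proof -
    have "hopf_lax u0 T x = - T * H 0"
      using hopf_lax_outside_cube[OF DH0 lip T supp norm_le_SUP_ball[OF cont]] that by (simp add: prop_radius_def)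
    then show ?thesis by simp
  qed
  ultimately show ?thesis unfolding eq semiconcave_class_def by blast
qed

lemma entropy_upper_bound:
  assumes DH0: "DH 0 = 0" and cont: "continuous_on UNIV DH" and S: "viscosity_semigroup H S"
    and T: "T > 0" and L: "L > 0" and M: "M > 0"
  shows "\<forall>\<^sub>F \<epsilon> in at_right 0.
      metric_entropy W11 W11_dist (W11_class ` {\<lambda>x. S T u0 x + T * H 0 | u0. u0 \<in> initial_data L M}) \<epsilon>
        \<le> ereal (Gamma_upper DH \<alpha> L M T * (1 / \<epsilon> ^ CARD('n)))"
proof -
  let ?F = "{\<lambda>x. S T u0 x + T * H 0 | u0. u0 \<in> initial_data L M}"
  define l where "l = prop_radius DH L M T"
  have "0 \<le> (SUP p\<in>{p. norm p \<le> M}. norm (DH p))"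
    using order_trans[OF norm_ge_zero norm_le_SUP_ball[OF cont, of 0 M]] M by simp
  then have l: "l > 0" using L T by (simp add: l_def prop_radius_def add_pos_nonneg)
  have K: "1 / (\<alpha> * T) > 0" using alpha_pos T by simp
  have "?F \<subseteq> semiconcave_class M (1 / (\<alpha> * T)) l"
    using solutions_in_semiconcave_class[OF DH0 cont S T] by (auto simp: l_def)
  from semiconcave_class_entropy_le[OF K l refl this] eventually_at_right_less[of "0::real"]
  show ?thesis
  proof eventually_elim
    case (elim \<epsilon>)
    note elim(1)
    also have "4 * (3 * l) ^ CARD('n) * ((3 * l) ^ CARD('n) * (1 / (\<alpha> * T)) * (5 * (real CARD('n))\<^sup>2)) ^ CARD('n) / \<epsilon> ^ CARD('n)
        \<le> Gamma_upper DH \<alpha> L M T / \<epsilon> ^ CARD('n)"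
      using elim(2) by (intro divide_right_mono Gamma_upper_ge[OF alpha_pos T M l_def l refl]) auto
    finally show ?case by simp
  qed
qed

end

text \<open>
  Centres of the \<open>q ^ N\<close> cells of side \<open>2 r\<close> that start at the corner \<open>(- a, \<dots>, - a)\<close>.
\<close>

definition bump_centers :: "real \<Rightarrow> real \<Rightarrow> nat \<Rightarrow> (real^'n::finite) set" where
  "bump_centers a r q = (\<lambda>z. \<chi> i. r * (2 * real (z i) + 1) - a) ` PiE UNIV (\<lambda>_. {..<q})"

lemma finite_bump_centers: "finite (bump_centers a r q)"
  unfolding bump_centers_def by (intro finite_imageI finite_PiE) auto

lemma card_bump_centers:
  assumes "r > 0"
  shows "card (bump_centers a r q :: (real^'n::finite) set) = q ^ CARD('n)"
proof -
  have "inj_on (\<lambda>z. \<chi> i. r * (2 * real (z i) + 1) - a :: real^'n) (PiE UNIV (\<lambda>_. {..<q}))"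
    using assms by (intro inj_onI) (auto simp: vec_eq_iff fun_eq_iff)
  then have "card (bump_centers a r q :: (real^'n) set) = card (PiE (UNIV :: 'n set) (\<lambda>_. {..<q}))"
    unfolding bump_centers_def by (rule card_image)
  then show ?thesis by (simp add: card_PiE)
qed

lemma bump_centers_separated:
  assumes r: "r > 0" and p: "p \<in> bump_centers a r q" and p': "p' \<in> bump_centers a r q" and neq: "p \<noteq> p'"
  shows "2 * r \<le> norm (p - p')"
proof -
  obtain z z' where p: "p = (\<chi> i. r * (2 * real (z i) + 1) - a)" and p': "p' = (\<chi> i. r * (2 * real (z' i) + 1) - a)"
    using p p' by (auto simp: bump_centers_def)
  then obtain i where "z i \<noteq> z' i" using neq by (metis (no_types, lifting) vec_eq_iff vec_lambda_beta)
  then have "1 \<le> \<bar>real (z i) - real (z' i)\<bar>" by linarith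
  then have "2 * r * 1 \<le> 2 * r * \<bar>real (z i) - real (z' i)\<bar>" using r by (intro mult_left_mono) auto
  also have "\<dots> = \<bar>2 * r * (real (z i) - real (z' i))\<bar>" using r by (simp add: abs_mult)
  also have "\<dots> = \<bar>(p - p') $ i\<bar>" unfolding p p' by (simp add: algebra_simps)
  also have "\<dots> \<le> norm (p - p')" by (rule component_le_norm_cart)
  finally show ?thesis by simp
qed

lemma bump_centers_bounded:
  assumes r: "r > 0" and p: "p \<in> bump_centers a r q" and q: "r * real q \<le> a"
  shows "\<bar>p $ i\<bar> + r \<le> a"
proof -
  obtain z where p: "p = (\<chi> i. r * (2 * real (z i) + 1) - a)" and z: "z i < q"
    using p by (auto simp: bump_centers_def)
  have "real (z i) + 1 \<le> real q" using z by simp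
  then have "r * (2 * (real (z i) + 1)) \<le> r * (2 * real q)" using r by (intro mult_left_mono) auto
  moreover have "0 \<le> r * real (z i)" using r by simp
  ultimately show ?thesis using q unfolding p by (simp add: abs_le_iff algebra_simps)
qed

lemma ln_2_ge_half: "1 / 2 \<le> ln (2 :: real)"
  using ln_le_minus_one[of "1 / 2 :: real"] by (simp add: ln_div)

context convex_hamiltonian
begin

text \<open>
  With this height of the bumps, the gradient has Lipschitz constant \<open>1 / (2 \<Lambda> T)\<close>, and \<open>DH\<close> has Lipschitz constant
  \<open>3 \<Lambda> / 2\<close> on the range of the gradient. So the contraction constant is \<open>3 / 4\<close>.
\<close>

lemma bump_sum_reached:
  fixes Z :: "(real^'n) set"
  assumes DH0: "DH 0 = 0" and S: "viscosity_semigroup H S" and T: "T > 0"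
    and \<Lambda>: "\<Lambda> > 0" and DH_lip: "\<And>p q. norm p \<le> \<rho> \<Longrightarrow> norm q \<le> \<rho> \<Longrightarrow> norm (DH p - DH q) \<le> (3 / 2 * \<Lambda>) * norm (p - q)"
    and r: "r > 0" "r \<le> 2 * (L - l)" and small: "r / (3 * \<Lambda> * T) \<le> \<rho>" "r / (3 * \<Lambda> * T) \<le> M"
    and Z: "finite Z" and separated: "\<And>p q. p \<in> Z \<Longrightarrow> q \<in> Z \<Longrightarrow> p \<noteq> q \<Longrightarrow> 2 * r \<le> norm (p - q)"
    and centers: "\<And>p i. p \<in> Z \<Longrightarrow> \<bar>p $ i\<bar> + r \<le> l" and P: "P \<subseteq> Z"
  shows "bump_sum (1 / (24 * \<Lambda> * T * r\<^sup>2)) r P \<in> {\<lambda>x. S T u0 x + T * H 0 | u0. u0 \<in> initial_data L M}"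
proof -
  define c where "c = 1 / (24 * \<Lambda> * T * r\<^sup>2)"
  have c: "c > 0" using \<Lambda> T r by (simp add: c_def)
  have c_eq: "8 * c * r ^ 3 = r / (3 * \<Lambda> * T)" "12 * c * r\<^sup>2 = 1 / (2 * \<Lambda> * T)"
    using \<Lambda> T r by (auto simp: c_def field_simps power2_eq_square power3_eq_cube)
  obtain u0 where u0: "u0 \<in> initial_data L M" "\<And>x. hopf_lax u0 T x = bump_sum c r P x - T * H 0"
  proof (rule hopf_lax_reaches[OF DH0 T, of "bump_sum c r P" "bump_sum_gradient c r P" "8 * c * r ^ 3" "12 * c * r\<^sup>2" "3 / 2 * \<Lambda>" l L M])
    show "GDERIV (bump_sum c r P) x :> bump_sum_gradient c r P x" for x by (rule bump_sum_has_gradient)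
    show "norm (bump_sum_gradient c r P x) \<le> 8 * c * r ^ 3" for x
      by (rule norm_bump_sum_gradient_le[OF c r(1) Z separated P])
    show "norm (bump_sum_gradient c r P x - bump_sum_gradient c r P y) \<le> 12 * c * r\<^sup>2 * norm (x - y)" for x y
      by (rule bump_sum_gradient_lipschitz[OF c r(1) Z separated P])
    show "norm (DH p - DH q) \<le> 3 / 2 * \<Lambda> * norm (p - q)" if "norm p \<le> 8 * c * r ^ 3" "norm q \<le> 8 * c * r ^ 3" for p q
      using that small(1) unfolding c_eq by (intro DH_lip) auto
    show "T * (3 / 2 * \<Lambda>) * (12 * c * r\<^sup>2) < 1" unfolding c_eq using \<Lambda> T by simp
    show "0 \<le> 3 / 2 * \<Lambda>" using \<Lambda> by simp
    show "bump_sum c r P x = 0" if "l < \<bar>x $ i\<bar>" for x i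
      by (rule bump_sum_outside[OF c r(1) Z separated P centers that])
    show "l + T * (3 / 2 * \<Lambda> * (8 * c * r ^ 3)) \<le> L" unfolding c_eq using \<Lambda> T r by simp
    show "8 * c * r ^ 3 \<le> M" unfolding c_eq by (rule small)
  qed blast
  have "M-lipschitz_on UNIV u0" using u0(1) by (simp add: initial_data_iff)
  then have "S T u0 x = hopf_lax u0 T x" for x using semigroup_eq_hopf_lax[OF S] T by simp
  then have "bump_sum c r P = (\<lambda>x. S T u0 x + T * H 0)" using u0(2) by (simp add: fun_eq_iff)
  then show ?thesis using u0(1) by (auto simp: c_def[symmetric])
qed

text \<open>
  In terms of \<open>X\<close>, the lower constant is \<open>X ^ N / (8 ln 2)\<close>. With \<open>r = \<kappa> \<epsilon>\<close>, about \<open>(6 X / (5 \<epsilon>)) ^ N\<close> bumps of radius \<open>r\<close>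
  fit into the cube of half side \<open>3 L / 4\<close>, and the rest of the cube of half side \<open>L\<close> leaves room for
  propagation. The entropy is at least a quarter of their number, provided that the bumps are large enough for the
  Hamming bound, which limits \<open>\<kappa>\<close> from below.
\<close>

lemma entropy_lower_bound:
  fixes A :: "real^'n^'n"
  assumes DH0: "DH 0 = 0" and S: "viscosity_semigroup H S" and T: "T > 0" and L: "L > 0" and M: "M > 0"
    and \<Lambda>_pos: "onorm ((*v) A) > 0" and \<rho>: "\<rho> > 0"
    and DH_lip: "\<And>p q. norm p \<le> \<rho> \<Longrightarrow> norm q \<le> \<rho> \<Longrightarrow> norm (DH p - DH q) \<le> (3 / 2 * onorm ((*v) A)) * norm (p - q)"
  shows "\<forall>\<^sub>F \<epsilon> in at_right 0.
      ereal (Gamma_lower A L T * (1 / \<epsilon> ^ CARD('n)))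
      \<le> metric_entropy W11 W11_dist (W11_class ` {\<lambda>x. S T u0 x + T * H 0 | u0. u0 \<in> initial_data L M}) \<epsilon>"
proof -
  let ?F = "{\<lambda>x. S T u0 x + T * H 0 | u0. u0 \<in> initial_data L M}"
  define \<Lambda> where "\<Lambda> = onorm ((*v) A)"
  have \<Lambda>: "\<Lambda> > 0" using \<Lambda>_pos by (simp add: \<Lambda>_def)
  define N where "N = CARD('n)"
  have N1: "N \<ge> 1" unfolding N_def by (simp add: Suc_leI)
  define \<omega> where "\<omega> = ball_vol TYPE('n)"
  have \<omega>: "\<omega> > 0" unfolding \<omega>_def by (rule ball_vol_pos)
  define X where "X = \<omega> / (192 * (real N + 1) * \<Lambda> * T) * (L / 4) ^ (N + 1)"
  have X: "X > 0" using \<omega> \<Lambda> T L by (simp add: X_def)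
  have Gamma: "Gamma_lower A L T = 1 / (8 * ln 2) * X ^ N"
    by (simp add: Gamma_lower_def Let_def N_def[symmetric] \<omega>_def[symmetric] \<Lambda>_def[symmetric] X_def
        power_mult_distrib power_mult[symmetric] power_divide power_add mult_ac)
  \<comment> \<open>In dimension one, any factor strictly between \<open>9 / 5\<close> and \<open>3\<close> would do: the upper limit leaves room for \<open>X / \<epsilon>\<close> bumps per axis, the lower one comes from the Hamming bound.\<close>
  define \<kappa> where "\<kappa> = 5 / 2 * (L / 4) / X"
  have \<kappa>: "\<kappa> > 0" using L X by (simp add: \<kappa>_def)
  define e0 where "e0 = min (min (\<rho> * (3 * \<Lambda> * T)) (M * (3 * \<Lambda> * T))) (L / 2) / \<kappa>"
  have e0: "e0 > 0" using \<rho> \<Lambda> T M L \<kappa> by (simp add: e0_def)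
  have "((\<lambda>\<epsilon>. (L / 4 - \<kappa> * \<epsilon> / 3) ^ N) \<longlongrightarrow> (L / 4 - \<kappa> * 0 / 3) ^ N) (at_right 0)"
    by (intro tendsto_intros) auto
  moreover have "3 / 4 * (L / 4) ^ N < (L / 4 - \<kappa> * 0 / 3) ^ N" using L by simp
  ultimately have "\<forall>\<^sub>F \<epsilon> in at_right 0. 3 / 4 * (L / 4) ^ N < (L / 4 - \<kappa> * \<epsilon> / 3) ^ N"
    by (rule order_tendstoD)
  moreover have "\<forall>\<^sub>F \<epsilon> in at_right 0. \<epsilon> \<in> {0<..<e0}" using e0 by (rule eventually_at_right_real)
  moreover have "\<forall>\<^sub>F \<epsilon> in at_right 0. \<epsilon> \<in> {0<..<X / 5}" using X by (intro eventually_at_right_real) simp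
  ultimately show ?thesis
  proof eventually_elim
    case (elim \<epsilon>)
    define r where "r = \<kappa> * \<epsilon>"
    have \<epsilon>: "\<epsilon> > 0" using elim by simp
    have r: "r > 0" using \<kappa> \<epsilon> by (simp add: r_def)
    have "\<epsilon> < e0" using elim by simp
    then have "r < min (min (\<rho> * (3 * \<Lambda> * T)) (M * (3 * \<Lambda> * T))) (L / 2)"
      using \<kappa> unfolding r_def e0_def by (subst (asm) pos_less_divide_eq) (auto simp: mult.commute)
    then have small: "r / (3 * \<Lambda> * T) \<le> \<rho>" "r / (3 * \<Lambda> * T) \<le> M" "r \<le> L / 2"
      using \<Lambda> T by (auto simp: pos_divide_le_eq)
    define q where "q = nat \<lfloor>3 * L / (4 * r)\<rfloor>"
    have frac: "3 * L / (4 * r) > 0" using L r by simp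
    then have "real q = of_int \<lfloor>3 * L / (4 * r)\<rfloor>" by (simp add: q_def)
    then have q: "real q \<le> 3 * L / (4 * r)" "3 * L / (4 * r) < real q + 1" by linarith+
    have qr: "r * real q \<le> 3 * L / 4" "3 * L / 4 - r \<le> r * real q"
      using q r by (auto simp: field_simps)
    define Z where "Z = (bump_centers (3 * L / 4) r q :: (real^'n) set)"
    have finZ: "finite Z" and cardZ: "card Z = q ^ N"
      using finite_bump_centers card_bump_centers[OF r] by (auto simp: Z_def N_def)
    have sepZ: "2 * r \<le> norm (p - p')" if "p \<in> Z" "p' \<in> Z" "p \<noteq> p'" for p p'
      using bump_centers_separated[OF r] that by (auto simp: Z_def)
    have bdZ: "\<bar>p $ i\<bar> + r \<le> 3 * L / 4" if "p \<in> Z" for p i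
      using bump_centers_bounded[OF r _ qr(1)] that by (auto simp: Z_def)
    define c where "c = 1 / (24 * \<Lambda> * T * r\<^sup>2)"
    have c: "c > 0" using \<Lambda> T r by (simp add: c_def)
    define \<beta> where "\<beta> = 5 / 9 * c * r ^ 3 * ((r / 3) ^ N * \<omega>)"
    have \<beta>: "\<beta> > 0" using c r \<omega> by (simp add: \<beta>_def)
    have \<beta>_eq: "\<beta> = 5 / 216 * r / (\<Lambda> * T) * \<omega> * (r / 3) ^ N"
      using \<Lambda> T r by (simp add: \<beta>_def c_def field_simps power2_eq_square power3_eq_cube)
    have "16 * \<epsilon> \<le> real (card Z) * \<beta>"
    proof -
      have "real (card Z) * \<beta> = (5 / 216 * r / (\<Lambda> * T) * \<omega>) * (r * real q / 3) ^ N"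
        by (simp add: cardZ \<beta>_eq power_mult_distrib power_divide)
      also have "\<dots> \<ge> (5 / 216 * r / (\<Lambda> * T) * \<omega>) * (3 / 4 * (L / 4) ^ N)"
      proof (rule mult_left_mono)
        have "3 / 4 * (L / 4) ^ N \<le> (L / 4 - r / 3) ^ N" using elim(1) by (simp add: r_def)
        also have "\<dots> \<le> (r * real q / 3) ^ N"
          using qr(2) small(3) L by (intro power_mono) auto
        finally show "3 / 4 * (L / 4) ^ N \<le> (r * real q / 3) ^ N" .
      qed (use \<Lambda> T \<omega> r in auto)
      moreover have "(5 / 216 * r / (\<Lambda> * T) * \<omega>) * (3 / 4 * (L / 4) ^ N) = 25 / 3 * (real N + 1) * \<epsilon>"
      proof -
        define y where "y = (L / 4) ^ N"
        have "y > 0" using L by (simp add: y_def)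
        have "X = \<omega> / (192 * (real N + 1) * \<Lambda> * T) * (L / 4 * y)" by (simp add: X_def y_def)
        then have "r = 5 / 2 * (L / 4) / (\<omega> / (192 * (real N + 1) * \<Lambda> * T) * (L / 4 * y)) * \<epsilon>"
          by (simp add: r_def \<kappa>_def)
        also have "\<dots> = 480 * (real N + 1) * \<Lambda> * T * \<epsilon> / (\<omega> * y)"
          using \<omega> \<Lambda> T L \<open>y > 0\<close> by (simp add: divide_simps)
        finally have r_eq: "r = 480 * (real N + 1) * \<Lambda> * T * \<epsilon> / (\<omega> * y)" .
        show ?thesis unfolding y_def[symmetric] r_eq using \<omega> \<Lambda> T \<open>y > 0\<close> by (simp add: divide_simps)
      qed
      moreover have "25 / 3 * 2 * \<epsilon> \<le> 25 / 3 * (real N + 1) * \<epsilon>"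
        using N1 \<epsilon> by (intro mult_right_mono) auto
      ultimately show ?thesis using \<epsilon> by linarith
    qed
    then have "ereal (real (card Z) / 4) \<le> metric_entropy W11 W11_dist (W11_class ` ?F) \<epsilon>"
    proof (rule metric_entropy_ge_if_hamming[OF finZ \<beta>, where w="\<lambda>P. W11_class (bump_sum c r P)"])
      fix P assume P: "P \<subseteq> Z"
      have "bump_sum c r P \<in> ?F"
        unfolding c_def
        by (rule bump_sum_reached[OF DH0 S T \<Lambda> _ r _ small(1,2) finZ sepZ bdZ P])
          (use DH_lip small(3) in \<open>auto simp: \<Lambda>_def\<close>)
      then show "W11_class (bump_sum c r P) \<in> W11_class ` ?F" by (rule imageI)
    next
      fix P Q assume "P \<subseteq> Z" "Q \<subseteq> Z"
      then show "real (card (P - Q \<union> (Q - P))) * \<beta> \<le> W11_dist (W11_class (bump_sum c r P)) (W11_class (bump_sum c r Q))"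
        unfolding \<beta>_def N_def \<omega>_def
        by (intro W11_dist_bump_sum_ge[OF c r finZ sepZ _ _ bdZ])
    qed
    moreover have "Gamma_lower A L T * (1 / \<epsilon> ^ CARD('n)) \<le> real (card Z) / 4"
    proof -
      have "X / \<epsilon> \<le> real q"
      proof -
        have "3 * L / (4 * r) = 6 / 5 * (X / \<epsilon>)"
          using L X \<epsilon> by (simp add: r_def \<kappa>_def field_simps)
        moreover have "X / \<epsilon> \<ge> 5" using elim(3) \<epsilon> by (simp add: field_simps)
        ultimately show ?thesis using q(2) by linarith
      qed
      then have "(X / \<epsilon>) ^ N \<le> real q ^ N" using X \<epsilon> by (intro power_mono) auto
      moreover have "1 / (8 * ln 2) \<le> (1 / 4 :: real)" using ln_2_ge_half by (simp add: field_simps)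
      ultimately have "1 / (8 * ln 2) * (X / \<epsilon>) ^ N \<le> 1 / 4 * real q ^ N"
        using X \<epsilon> by (intro mult_mono) auto
      then show ?thesis by (simp add: Gamma cardZ N_def[symmetric] power_divide)
    qed
    ultimately show ?case by (meson ereal_less_eq(3) order_trans)
  qed
qed

end

theorem theorem1:
  fixes H :: "real^'n::finite \<Rightarrow> real"
    and DH :: "real^'n \<Rightarrow> real^'n"
    and D2H :: "real^'n \<Rightarrow> real^'n^'n"
    and S :: "real \<Rightarrow> (real^'n \<Rightarrow> real) \<Rightarrow> real^'n \<Rightarrow> real"
    and \<alpha> L M T :: real
  assumes gradient: "\<And>p. GDERIV H p :> DH p"
    and hessian: "\<And>p. (DH has_derivative (\<lambda>h. D2H p *v h)) (at p)"
    and hessian_continuous: "continuous_on UNIV D2H"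
    and gradient_zero: "DH 0 = 0"
    and alpha_pos: "\<alpha> > 0"
    and uniformly_convex: "\<And>p. positive_semidefinite (D2H p - \<alpha> *\<^sub>R mat 1)"
    and semigroup: "viscosity_semigroup H S"
    and L_pos: "L > 0" and M_pos: "M > 0" and T_pos: "T > 0"
  shows "\<forall>\<^sub>F \<epsilon> in at_right 0.
      metric_entropy W11 W11_dist (W11_class ` {\<lambda>x. S T u0 x + T * H 0 | u0. u0 \<in> initial_data L M}) \<epsilon>
        \<le> ereal (Gamma_upper DH \<alpha> L M T * (1 / \<epsilon> ^ CARD('n))) \<and>
      metric_entropy W11 W11_dist (W11_class ` {\<lambda>x. S T u0 x + T * H 0 | u0. u0 \<in> initial_data L M}) \<epsilon>
        \<ge> ereal (Gamma_lower (D2H 0) L T * (1 / \<epsilon> ^ CARD('n)))"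
proof (rule eventually_conj)
  interpret convex_hamiltonian H DH \<alpha>
    by unfold_locales
      (rule gradient alpha_pos strong_convexity_of_hessian[OF gradient hessian uniformly_convex])+
  have DH_cont: "continuous_on UNIV DH"
    by (meson hessian continuous_at_imp_continuous_on has_derivative_continuous)
  show "\<forall>\<^sub>F \<epsilon> in at_right 0.
      metric_entropy W11 W11_dist (W11_class ` {\<lambda>x. S T u0 x + T * H 0 | u0. u0 \<in> initial_data L M}) \<epsilon>
        \<le> ereal (Gamma_upper DH \<alpha> L M T * (1 / \<epsilon> ^ CARD('n)))"
    by (rule entropy_upper_bound[OF gradient_zero DH_cont semigroup T_pos L_pos M_pos])
  have \<Lambda>: "onorm ((*v) (D2H 0)) > 0" using hessian_onorm_pos[OF alpha_pos uniformly_convex] .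
  then have "onorm ((*v) (D2H 0)) < 3 / 2 * onorm ((*v) (D2H 0))" by simp
  then obtain \<rho> where "\<rho> > 0" "\<And>p q. norm p \<le> \<rho> \<Longrightarrow> norm q \<le> \<rho> \<Longrightarrow>
      norm (DH p - DH q) \<le> (3 / 2 * onorm ((*v) (D2H 0))) * norm (p - q)"
    using gradient_lipschitz_near_0[OF hessian hessian_continuous] by metis
  then show "\<forall>\<^sub>F \<epsilon> in at_right 0.
      metric_entropy W11 W11_dist (W11_class ` {\<lambda>x. S T u0 x + T * H 0 | u0. u0 \<in> initial_data L M}) \<epsilon>
        \<ge> ereal (Gamma_lower (D2H 0) L T * (1 / \<epsilon> ^ CARD('n)))"
    using entropy_lower_bound[OF gradient_zero semigroup T_pos L_pos M_pos \<Lambda>] by simp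
qed

end
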